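(* Let $r\ge 0$ and let $\Lambda$ be a free $\mathbb{Z}$-module of rank $r+2$ with a fixed basis, oriented by the determinant $\det$ in that basis; put $L=\mathrm{Hom}_{\mathbb Z}(\Lambda,\mathbb Z)$. 1. (Modular property) For every family $a_0,\dots,a_{r+1}$ of $r+2$ linearly independent primitive vectors of $\Lambda$, and all $(w,x)\in\mathbb C\times\mathrm{Hom}_{\mathbb Z}(L,\mathbb C)$ at which all factors on the left are defined, $$\prod_{j=0}^{r+1}G_{r,(a_k)_{k\neq j}}(w,x,\Lambda)^{(-1)^j}=\exp\big(i\pi\,B_{r+2,a_0,\dots,a_{r+1}}(w,x,\Lambda)\big),$$ where $(a_k)_{k\ne j}$ denotes the family $(a_0,\dots,a_{j-1},a_{j+1},\dots,a_{r+1})$ in this order. 2. (Equivariance) For every family $\underline a=(a_0,\dots,a_r)$ of $r+1$ linearly independent primitive vectors of $\Lambda$, every $w\in\mathbb C$, $x\in\mathrm{Hom}_{\mathbb Z}(L,\mathbb C)$ and every $g\in\mathrm{SL}_{r+2}(\mathbb Z)$, one has $G_{r,g\underline a}(w,gx,\Lambda)=G_{r,\underline a}(w,x,\Lambda)$; and for every family $a_0,\dots,a_{r+1}$ of $r+2$ linearly independent primitive vectors, $B_{r+2,ga_0,\dots,ga_{r+1}}(w,gx,\Lambda)=B_{r+2,a_0,\dots,a_{r+1}}(w,x,\Lambda)$.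
   Context: $\mathbb H$ is the upper half-plane. For $\underline\tau=(\tau_0,\dots,\tau_r)\in\mathbb H^{r+1}$, $q_j=e^{2i\pi\tau_j}$, $z\in\mathbb C$, $x=e^{2i\pi z}$, Nishizawa's function is $G_r(z,\underline\tau)=\prod_{m_0,\dots,m_r\ge0}\big(1-\prod_j q_j^{m_j+1}x^{-1}\big)\big(1-\prod_jq_j^{m_j}x\big)^{(-1)^r}$ (meromorphic in $z$). It is extended to $\underline\tau\in(\mathbb C\setminus\mathbb R)^{r+1}$ by: if $S=\{j:\mathrm{Im}\,\tau_j<0\}$ and $\underline\tau'$ is obtained from $\underline\tau$ by replacing $\tau_j$ by $-\tau_j$ for $j\in S$, then $G_r(z,\underline\tau)=G_r(z-\sum_{j\in S}\tau_j,\underline\tau')^{(-1)^{|S|}}$ (i.e. $G_r(z,\ldots,-\tau_j,\ldots)=G_r(z+\tau_j,\underline\tau)^{-1}$). For $\delta\in L$ and $x\in\mathrm{Hom}_{\mathbb Z}(L,\mathbb C)$ write $\delta(x)=x(\delta)$. A positive dual family to linearly independent primitive $a_0,\dots,a_m\in\Lambda$ is $(\alpha_0,\dots,\alpha_m)\in L^{m+1}$ with $\alpha_j(a_j)>0$ and $\alpha_j(a_k)=0$ for $k\ne j$. For $r+1$ linearly independent primitive $\underline a=(a_0,\dots,a_r)$, let $s\in\mathbb Z_{>0}$ and $\gamma\in L$ primitive with $\det(a_0,\dots,a_r,c)=s\gamma(c)$ for all $c\in\Lambda$; for a positive dual family $\underline\alpha$ to $\underline a$ put $F(\underline\alpha)=\{\delta\in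 L:0\le\delta(a_j)<\alpha_j(a_j)\ \forall j\}$ and define the geometric function $$G_{r,\underline a}(w,x,\Lambda)=\prod_{\delta\in F(\underline\alpha)/\mathbb Z\gamma}G_r\Big(\frac{w+\delta(x)}{\gamma(x)},\frac{\alpha_0(x)}{\gamma(x)},\dots,\frac{\alpha_r(x)}{\gamma(x)}\Big),$$ which is independent of the choice of $\underline\alpha$ and defined where $\gamma(x)\neq0$, all $\alpha_j(x)/\gamma(x)\notin\mathbb R$ and $w$ avoids the poles. Multiple Bernoulli polynomials: for $\underline\omega\in(\mathbb C\setminus\{0\})^{n}$, $e^{zt}\prod_{j=1}^n\frac{\omega_jt}{e^{\omega_jt}-1}=\sum_{k\ge0}B^*_{n,k}(z,\underline\omega)\frac{t^k}{k!}$. For $r+2$ linearly independent primitive $a_0,\dots,a_{r+1}\in\Lambda$, let $\epsilon$ be the sign of $(-1)^{r+1}\det(a_0,\dots,a_{r+1})$, let $(\alpha_0,\dots,\alpha_{r+1})$ be the unique positive dual family to $(a_0,\dots,a_{r+1})$ consisting of primitive elements of $L$, $F=\{\delta\in L:0\le\delta(a_j)<\alpha_j(a_j)\ \forall j\}$ (finite), and $B_{r+2,a_0,\dots,a_{r+1}}(w,x,\Lambda)=\Big(\prod_{j=0}^{r+1}\alpha_j(x)\Big)^{-1}\frac{-2\epsilon}{(r+2)!}\sum_{\delta\in F}B^*_{r+2,r+2}(w+\delta(x),\alpha_0(x),\dots,\alpha_{r+1}(x))$. $\mathrm{SL}_{r+2}(\mathbb Z)$ acts on $\Lambda$ through the fixed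 basis, and on $\mathrm{Hom}_{\mathbb Z}(L,\mathbb C)$ by $(gx)(\delta)=x(\delta\circ g)$; $g\underline a=(ga_0,\dots,ga_r)$. *)

theory Defs
  imports "HOL-Complex_Analysis.Complex_Analysis"
          "HOL-Computational_Algebra.Formal_Power_Series"
          "Jordan_Normal_Form.Determinant"
begin

text \<open>Lambda = Z^n (n = r+2) with its fixed basis; vectors are functions nat => int vanishing
  at indices >= n.  L = Hom(Lambda,Z) is represented by coordinates in the dual basis, so it is
  the same set; the pairing delta(c) is the usual dot product.  Elements x of Hom(L,C) are
  functions on L that are additive on L; delta(x) = x delta.\<close>

definition lat :: "nat \<Rightarrow> (nat \<Rightarrow> int) set" where
  "lat n = {v. \<forall>i\<ge>n. v i = 0}"

definition pair :: "nat \<Rightarrow> (nat \<Rightarrow> int) \<Rightarrow> (nat \<Rightarrow> int) \<Rightarrow> int" where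
  "pair n \<delta> c = (\<Sum>i<n. \<delta> i * c i)"

definition homLC :: "nat \<Rightarrow> ((nat \<Rightarrow> int) \<Rightarrow> complex) \<Rightarrow> bool" where
  "homLC n x \<longleftrightarrow> (\<forall>\<delta>\<in>lat n. \<forall>\<delta>'\<in>lat n. x (\<lambda>i. \<delta> i + \<delta>' i) = x \<delta> + x \<delta>')"

definition primitive :: "nat \<Rightarrow> (nat \<Rightarrow> int) \<Rightarrow> bool" where
  "primitive n v \<longleftrightarrow> v \<in> lat n \<and>
     (\<forall>k::int. \<forall>u\<in>lat n. v = (\<lambda>i. k * u i) \<longrightarrow> k = 1 \<or> k = -1)"

definition lin_indep :: "nat \<Rightarrow> nat \<Rightarrow> (nat \<Rightarrow> nat \<Rightarrow> int) \<Rightarrow> bool" where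
  "lin_indep n m a \<longleftrightarrow>
     (\<forall>c::nat \<Rightarrow> int. (\<forall>i<n. (\<Sum>k<m. c k * a k i) = 0) \<longrightarrow> (\<forall>k<m. c k = 0))"

definition fam_ok :: "nat \<Rightarrow> nat \<Rightarrow> (nat \<Rightarrow> nat \<Rightarrow> int) \<Rightarrow> bool" where
  "fam_ok n m a \<longleftrightarrow> (\<forall>k<m. primitive n (a k)) \<and> lin_indep n m a"

definition detf :: "nat \<Rightarrow> (nat \<Rightarrow> nat \<Rightarrow> int) \<Rightarrow> int" where
  "detf n v = det (mat n n (\<lambda>(i, j). v j i))"

definition posdual :: "nat \<Rightarrow> nat \<Rightarrow> (nat \<Rightarrow> nat \<Rightarrow> int) \<Rightarrow> (nat \<Rightarrow> nat \<Rightarrow> int) \<Rightarrow> bool" where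
  "posdual n m a \<alpha> \<longleftrightarrow>
     (\<forall>j<m. \<alpha> j \<in> lat n \<and> pair n (\<alpha> j) (a j) > 0 \<and>
        (\<forall>k<m. k \<noteq> j \<longrightarrow> pair n (\<alpha> j) (a k) = 0))"

definition del_fam :: "nat \<Rightarrow> (nat \<Rightarrow> 'a) \<Rightarrow> nat \<Rightarrow> 'a" where
  "del_fam j a = (\<lambda>k. if k < j then a k else a (Suc k))"

definition SL :: "nat \<Rightarrow> (nat \<Rightarrow> nat \<Rightarrow> int) set" where
  "SL n = {g. det (mat n n (\<lambda>(i, j). g i j)) = 1}"

definition gact :: "nat \<Rightarrow> (nat \<Rightarrow> nat \<Rightarrow> int) \<Rightarrow> (nat \<Rightarrow> int) \<Rightarrow> nat \<Rightarrow> int" where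
  "gact n g v = (\<lambda>i. if i < n then (\<Sum>l<n. g i l * v l) else 0)"

text \<open>delta o g as an element of L (dual coordinates)\<close>
definition lcomp :: "nat \<Rightarrow> (nat \<Rightarrow> int) \<Rightarrow> (nat \<Rightarrow> nat \<Rightarrow> int) \<Rightarrow> nat \<Rightarrow> int" where
  "lcomp n \<delta> g = (\<lambda>l. if l < n then (\<Sum>i<n. \<delta> i * g i l) else 0)"

definition dact :: "nat \<Rightarrow> (nat \<Rightarrow> nat \<Rightarrow> int) \<Rightarrow> ((nat \<Rightarrow> int) \<Rightarrow> complex) \<Rightarrow> (nat \<Rightarrow> int) \<Rightarrow> complex" where
  "dact n g x = (\<lambda>\<delta>. x (lcomp n \<delta> g))"

definition gfam :: "nat \<Rightarrow> (nat \<Rightarrow> nat \<Rightarrow> int) \<Rightarrow> (nat \<Rightarrow> nat \<Rightarrow> int) \<Rightarrow> nat \<Rightarrow> nat \<Rightarrow> int" where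
  "gfam n g a = (\<lambda>k. gact n g (a k))"

text \<open>The product over (m_0,...,m_r) in N^(r+1) is the limit of the finite products over the
  boxes {0..N-1}^(r+1) (the product is absolutely convergent for tau in H^(r+1)).\<close>
definition nish_box :: "nat \<Rightarrow> nat \<Rightarrow> (nat \<Rightarrow> nat) set" where
  "nish_box r N = PiE {..r} (\<lambda>_. {..<N})"

definition qexp :: "complex \<Rightarrow> complex" where
  "qexp t = exp (2 * pi * \<i> * t)"

definition nishP1 :: "nat \<Rightarrow> (nat \<Rightarrow> complex) \<Rightarrow> complex \<Rightarrow> complex" where
  "nishP1 r \<tau> z = lim (\<lambda>N. \<Prod>m\<in>nish_box r N.
      1 - (\<Prod>j\<le>r. qexp (\<tau> j) ^ (m j + 1)) * inverse (qexp z))"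

definition nishP2 :: "nat \<Rightarrow> (nat \<Rightarrow> complex) \<Rightarrow> complex \<Rightarrow> complex" where
  "nishP2 r \<tau> z = lim (\<lambda>N. \<Prod>m\<in>nish_box r N.
      1 - (\<Prod>j\<le>r. qexp (\<tau> j) ^ (m j)) * qexp z)"

text \<open>G_r(z, tau) for tau in H^(r+1) (pointwise expression of the meromorphic function)\<close>
definition nish_upper :: "nat \<Rightarrow> (nat \<Rightarrow> complex) \<Rightarrow> complex \<Rightarrow> complex" where
  "nish_upper r \<tau> z = nishP1 r \<tau> z * nishP2 r \<tau> z powi ((-1::int) ^ r)"

definition nishG :: "nat \<Rightarrow> (nat \<Rightarrow> complex) \<Rightarrow> complex \<Rightarrow> complex" where
  "nishG r \<tau> z =
     (let S = {j. j \<le> r \<and> Im (\<tau> j) < 0};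
          \<tau>' = (\<lambda>j. if j \<in> S then - \<tau> j else \<tau> j)
      in nish_upper r \<tau>' (z - (\<Sum>j\<in>S. \<tau> j)) powi ((-1::int) ^ card S))"

definition gamma_of :: "nat \<Rightarrow> (nat \<Rightarrow> nat \<Rightarrow> int) \<Rightarrow> nat \<Rightarrow> int" where
  "gamma_of r a = (SOME \<gamma>. primitive (r+2) \<gamma> \<and>
     (\<exists>s::int. s > 0 \<and> (\<forall>c\<in>lat (r+2).
        detf (r+2) (\<lambda>k. if k \<le> r then a k else c) = s * pair (r+2) \<gamma> c)))"

definition alpha_of :: "nat \<Rightarrow> (nat \<Rightarrow> nat \<Rightarrow> int) \<Rightarrow> nat \<Rightarrow> nat \<Rightarrow> int" where
  "alpha_of r a = (SOME \<alpha>. posdual (r+2) (r+1) a \<alpha>)"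

definition Fset :: "nat \<Rightarrow> nat \<Rightarrow> (nat \<Rightarrow> nat \<Rightarrow> int) \<Rightarrow> (nat \<Rightarrow> nat \<Rightarrow> int) \<Rightarrow> (nat \<Rightarrow> int) set" where
  "Fset n m a \<alpha> = {\<delta> \<in> lat n. \<forall>j<m. 0 \<le> pair n \<delta> (a j) \<and> pair n \<delta> (a j) < pair n (\<alpha> j) (a j)}"

definition modrel :: "(nat \<Rightarrow> int) set \<Rightarrow> (nat \<Rightarrow> int) \<Rightarrow> ((nat \<Rightarrow> int) \<times> (nat \<Rightarrow> int)) set" where
  "modrel F \<gamma> = {(\<delta>, \<delta>'). \<delta> \<in> F \<and> \<delta>' \<in> F \<and> (\<exists>k::int. \<delta>' = (\<lambda>i. \<delta> i + k * \<gamma> i))}"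

definition geomG :: "nat \<Rightarrow> (nat \<Rightarrow> nat \<Rightarrow> int) \<Rightarrow> complex \<Rightarrow> ((nat \<Rightarrow> int) \<Rightarrow> complex) \<Rightarrow> complex" where
  "geomG r a w x =
     (let \<gamma> = gamma_of r a; \<alpha> = alpha_of r a; F = Fset (r+2) (r+1) a \<alpha>
      in \<Prod>C\<in>F // modrel F \<gamma>.
           (let \<delta> = (SOME \<delta>. \<delta> \<in> C)
            in nishG r (\<lambda>j. x (\<alpha> j) / x \<gamma>) ((w + x \<delta>) / x \<gamma>)))"

definition geom_dom :: "nat \<Rightarrow> (nat \<Rightarrow> nat \<Rightarrow> int) \<Rightarrow> ((nat \<Rightarrow> int) \<Rightarrow> complex) \<Rightarrow> bool" where
  "geom_dom r a x \<longleftrightarrow> x (gamma_of r a) \<noteq> 0 \<and>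
     (\<forall>j\<le>r. x (alpha_of r a j) / x (gamma_of r a) \<notin> \<real>)"

text \<open>e^{zt} prod_j omega_j t/(e^{omega_j t}-1) = sum_k B*_{n,k}(z,omega) t^k/k!, as formal power series\<close>
definition bstar :: "nat \<Rightarrow> nat \<Rightarrow> complex \<Rightarrow> (nat \<Rightarrow> complex) \<Rightarrow> complex" where
  "bstar n k z \<omega> = fact k * fps_nth (fps_exp z *
     (\<Prod>j<n. inverse (fps_const (1 / \<omega> j) * fps_shift 1 (fps_exp (\<omega> j) - 1)))) k"

text \<open>the unique positive dual family of primitive elements, for r+2 vectors\<close>
definition alpha_prim :: "nat \<Rightarrow> (nat \<Rightarrow> nat \<Rightarrow> int) \<Rightarrow> nat \<Rightarrow> nat \<Rightarrow> int" where
  "alpha_prim r a = (SOME \<alpha>. posdual (r+2) (r+2) a \<alpha> \<and> (\<forall>j<r+2. primitive (r+2) (\<alpha> j)))"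

definition bernB :: "nat \<Rightarrow> (nat \<Rightarrow> nat \<Rightarrow> int) \<Rightarrow> complex \<Rightarrow> ((nat \<Rightarrow> int) \<Rightarrow> complex) \<Rightarrow> complex" where
  "bernB r a w x =
     (let \<alpha> = alpha_prim r a;
          \<epsilon> = sgn ((-1) ^ (r+1) * detf (r+2) a);
          F = Fset (r+2) (r+2) a \<alpha>
      in inverse (\<Prod>j<r+2. x (\<alpha> j)) * (- 2 * of_int \<epsilon> / fact (r+2)) *
         (\<Sum>\<delta>\<in>F. bstar (r+2) (r+2) (w + x \<delta>) (\<lambda>j. x (\<alpha> j))))"

end

theory Submission
  imports Defs
begin

text \<open>
  In the strip where both halves of the product converge, the logarithm of
  \<open>G\<^sub>r(z, \<tau>)\<close> is the sum over \<open>m \<noteq> 0\<close> of \<open>x\<^sup>m / (m \<Prod>\<^sub>j (q\<^sub>j\<^sup>m - 1))\<close>, whatever the signs of the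
  \<open>Im \<tau>\<^sub>j\<close>. For periods \<open>\<omega>\<^sub>0, \<dots>, \<omega>\<^sub>r\<^sub>+\<^sub>1\<close> with non-real ratios these terms, taken at
  \<open>z / \<omega>\<^sub>k\<close> and \<open>\<omega>\<^sub>j / \<omega>\<^sub>k\<close>, are \<open>2\<pi>\<i>\<close> times the residues of
  \<open>e\<^sup>z\<^sup>t / (t \<Prod>\<^sub>j (exp (\<omega>\<^sub>j t) - 1))\<close> at the simple poles \<open>2\<pi>\<i>m / \<omega>\<^sub>k\<close>, and the residue at
  \<open>0\<close> is the Bernoulli term. For \<open>z\<close> near the centre \<open>(\<Sum>\<^sub>j \<omega>\<^sub>j) / 2\<close> of the zonotope
  the kernel decays exponentially in every direction, so its integrals over large circles
  staying away from the poles tend to \<open>0\<close> and the residues sum to \<open>0\<close>. Analytic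
  continuation in \<open>z\<close> gives the modular property of \<open>G\<^sub>r\<close> for all \<open>z\<close>.

  The same expansion shows that the geometric function does not depend on the dual family, since the
  sum over \<open>F(\<alpha>) / \<int>\<gamma>\<close> divided by \<open>\<Prod>\<^sub>j (q\<^sub>j\<^sup>m - 1)\<close> is unchanged when the box is
  subdivided. Hence all factors can be computed with the primitive dual family of
  \<open>a\<^sub>0, \<dots>, a\<^sub>r\<^sub>+\<^sub>1\<close>. Then \<open>\<gamma>\<close> is \<open>\<plusminus>\<alpha>\<^sub>j\<close>, the finite set \<open>F\<close> represents every quotient, and the
  product splits over \<open>F\<close> into copies of the modular property of \<open>G\<^sub>r\<close>.
\<close>

subsection \<open>Fourier expansion of the logarithm of Nishizawa's function\<close>

text \<open>The poles of the kernel lie on r + 2 different lines through 0 with unrelated spacings,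
  so a circle of radius about N can be kept away from them only by a distance of order 1/N. Each
  factor \<open>exp (\<omega> j * t) - 1\<close> then costs a power of N, which the exponential
  decay absorbs. The strip of convergence depends on k, but half the sum of the periods is centred
  in all strips at once, and one constant \<mu> gives both the rate of decay and a disc contained in
  every strip. \<open>geomG\<close> involves Hilbert choices (dual family, representatives) and
  multiplies literal values, with division by zero equal to zero. Two expressions for it that agree
  as meromorphic functions may differ at points where a pole of one factor meets a zero of another.
  Hence identities are proved off a discrete closed set (\<open>cosparse\<close>) and carried to a
  given w by limits, that is by \<open>remove_sings\<close>. The signs fit because reversing
  \<gamma> inverts G by a reflection formula: the alternating exponents and the orientations of
  \<gamma> combine into one exponent \<epsilon> common to all factors.\<close>

lemma qexp_0 [simp]: "qexp 0 = 1"
  by (simp add: qexp_def)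

lemma qexp_nonzero [simp]: "qexp z \<noteq> 0"
  by (simp add: qexp_def)

lemma qexp_add: "qexp (a + b) = qexp a * qexp b"
  by (simp add: qexp_def ring_distribs exp_add)

lemma qexp_minus: "qexp (- a) = inverse (qexp a)"
  by (simp add: qexp_def exp_minus)

lemma qexp_diff: "qexp (a - b) = qexp a / qexp b"
  by (simp add: qexp_def ring_distribs exp_diff)

lemma qexp_sum: "finite A \<Longrightarrow> qexp (\<Sum>i\<in>A. f i) = (\<Prod>i\<in>A. qexp (f i))"
  by (induction rule: finite_induct) (auto simp: qexp_add)

lemma norm_qexp: "norm (qexp z) = exp (- (2 * pi * Im z))"
  by (simp add: qexp_def)

lemma qexp_of_nat_mult: "qexp (of_nat n * z) = qexp z ^ n"
proof -
  have "2 * pi * \<i> * (of_nat n * z) = of_nat n * (2 * pi * \<i> * z)"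
    by (simp add: algebra_simps)
  then show ?thesis
    unfolding qexp_def by (simp only: exp_of_nat_mult)
qed

lemma qexp_of_int [simp]: "qexp (of_int k) = 1"
proof -
  have "2 * complex_of_real pi * \<i> * of_int k = (2 * of_int k * of_real pi) * \<i>"
    by (simp add: mult_ac)
  then show ?thesis
    unfolding qexp_def using exp_integer_2pi[of "of_int k"] by (simp add: mult_ac)
qed

lemma qexp_eq_1_imp_real: "qexp z = 1 \<Longrightarrow> Im z = 0"
  using norm_qexp[of z] by simp

lemma holomorphic_on_qexp [holomorphic_intros]:
  "f holomorphic_on A \<Longrightarrow> (\<lambda>z. qexp (f z)) holomorphic_on A"
  unfolding qexp_def by (intro holomorphic_intros)

section \<open>Convergence and holomorphy of the multiple infinite product\<close>

lemma finite_nish_box [simp]: "finite (nish_box r N)"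
  by (simp add: nish_box_def finite_PiE)

lemma nish_box_mono: "N \<le> M \<Longrightarrow> nish_box r N \<subseteq> nish_box r M"
  unfolding nish_box_def by (intro PiE_mono) auto

lemma sum_nish_box:
  fixes f :: "nat \<Rightarrow> nat \<Rightarrow> 'a :: comm_semiring_1"
  shows "(\<Sum>m\<in>nish_box r N. \<Prod>j\<le>r. f j (m j)) = (\<Prod>j\<le>r. \<Sum>i<N. f j i)"
  unfolding nish_box_def by (rule prod_sum_PiE [symmetric]) auto

text \<open>Multiplying out, every non-constant monomial on the left is bounded by the one on the
  right, and the constant 1 is removed on both sides.\<close>

lemma norm_prod_minus1_le:
  fixes f :: "'a \<Rightarrow> complex"
  assumes "finite A"
  shows "norm ((\<Prod>n\<in>A. 1 + f n) - 1) \<le> (\<Prod>n\<in>A. 1 + norm (f n)) - 1"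
  using assms
proof (induction A rule: finite_induct)
  case (insert x A)
  let ?P = "\<Prod>n\<in>A. 1 + f n" and ?Q = "\<Prod>n\<in>A. 1 + norm (f n)"
  have "norm ?P \<le> ?Q"
    using insert.IH norm_triangle_ineq2[of ?P 1] by simp
  then have "norm (f x * ?P) \<le> norm (f x) * ?Q"
    by (simp add: norm_mult mult_left_mono)
  moreover have "norm ((1 + f x) * ?P - 1) \<le> norm (?P - 1) + norm (f x * ?P)"
    using norm_triangle_ineq[of "?P - 1" "f x * ?P"] by (simp add: algebra_simps)
  ultimately show ?case
    using insert by (simp add: algebra_simps)
qed auto

text \<open>The multiple q-Pochhammer symbol with bases \<open>q 0, ..., q r\<close>. Both halves of
  Nishizawa's product are values of this one entire function of x, so convergence is treated
  once.\<close>

definition qpoch :: "nat \<Rightarrow> (nat \<Rightarrow> complex) \<Rightarrow> complex \<Rightarrow> complex" where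
  "qpoch r q x = lim (\<lambda>N. \<Prod>m\<in>nish_box r N. 1 - (\<Prod>j\<le>r. q j ^ m j) * x)"

text \<open>A box sum of monomials factors into partial sums of geometric series.\<close>

lemma sum_nish_box_norm_tendsto:
  fixes q :: "nat \<Rightarrow> complex"
  assumes q: "\<And>j. j \<le> r \<Longrightarrow> norm (q j) < 1"
  shows "(\<lambda>N. \<Sum>m\<in>nish_box r N. norm (\<Prod>j\<le>r. q j ^ m j)) \<longlonglongrightarrow> (\<Prod>j\<le>r. 1 / (1 - norm (q j)))"
proof -
  have "(\<lambda>N. \<Prod>j\<le>r. \<Sum>i<N. norm (q j) ^ i) \<longlonglongrightarrow> (\<Prod>j\<le>r. 1 / (1 - norm (q j)))"
  proof (rule tendsto_prod)
    fix j assume "j \<in> {..r}"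
    then have "(\<lambda>i. norm (q j) ^ i) sums (1 / (1 - norm (q j)))"
      using q by (intro geometric_sums) auto
    then show "(\<lambda>N. \<Sum>i<N. norm (q j) ^ i) \<longlonglongrightarrow> 1 / (1 - norm (q j))"
      by (simp add: sums_def)
  qed
  then show ?thesis
    by (simp add: sum_nish_box[symmetric] prod_norm[symmetric] norm_power)
qed

text \<open>Passing from box N to box M multiplies the product by factors whose product differs from
  1 by at most \<open>exp (B * (S M - S N)) - 1\<close>. The sums \<open>S N\<close> converge, and
  the products stay bounded by \<open>exp (B * C)\<close>, so the sequence is uniformly Cauchy on
  the disc.\<close>

lemma uniformly_convergent_qpoch:
  fixes q :: "nat \<Rightarrow> complex"
  assumes q: "\<And>j. j \<le> r \<Longrightarrow> norm (q j) < 1"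
  shows "uniformly_convergent_on (cball 0 B) (\<lambda>N x. \<Prod>m\<in>nish_box r N. 1 - (\<Prod>j\<le>r. q j ^ m j) * x)"
proof (cases "B \<ge> 0")
  case False
  then show ?thesis by (simp add: uniformly_convergent_on_def)
next
  case True
  define f where "f m x = - ((\<Prod>j\<le>r. q j ^ m j) * x)" for m x
  define c where "c m = norm (\<Prod>j\<le>r. q j ^ m j)" for m
  define S where "S N = (\<Sum>m\<in>nish_box r N. c m)" for N
  define P where "P N x = (\<Prod>m\<in>nish_box r N. 1 + f m x)" for N x
  have c0: "c m \<ge> 0" for m by (simp add: c_def)
  have Slim: "S \<longlonglongrightarrow> (\<Prod>j\<le>r. 1 / (1 - norm (q j)))"
    unfolding S_def c_def by (rule sum_nish_box_norm_tendsto[OF q])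
  have Smono: "S N \<le> S M" if "N \<le> M" for N M
    unfolding S_def using nish_box_mono[OF that] c0 by (intro sum_mono2) auto
  then have "incseq S" by (simp add: incseq_def)
  obtain C where C: "\<And>N. S N \<le> C"
    using incseq_le[OF \<open>incseq S\<close> Slim] by blast
  have prod_le: "(\<Prod>m\<in>A. 1 + norm (f m x)) \<le> exp (B * (\<Sum>m\<in>A. c m))"
    if "finite A" "norm x \<le> B" for A x
  proof -
    have "(\<Prod>m\<in>A. 1 + norm (f m x)) \<le> (\<Prod>m\<in>A. exp (B * c m))"
    proof (intro prod_mono conjI)
      fix m
      have "norm (f m x) \<le> B * c m"
        using that c0[of m] by (simp add: f_def c_def norm_mult mult.commute mult_right_mono)
      then show "1 + norm (f m x) \<le> exp (B * c m)"
        using exp_ge_add_one_self[of "B * c m"] by linarith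
    qed auto
    also have "\<dots> = exp (B * (\<Sum>m\<in>A. c m))"
      using that by (simp add: exp_sum sum_distrib_left)
    finally show ?thesis .
  qed
  have diff: "dist (P N x) (P M x) \<le> exp (B * C) * (exp (B * (S M - S N)) - 1)"
    if "N \<le> M" "norm x \<le> B" for N M x
  proof -
    let ?D = "nish_box r M - nish_box r N"
    have split: "P M x = P N x * (\<Prod>m\<in>?D. 1 + f m x)"
      unfolding P_def using prod.subset_diff[OF nish_box_mono[OF that(1), of r]]
      by (simp add: mult.commute)
    have SD: "(\<Sum>m\<in>?D. c m) = S M - S N"
      unfolding S_def using nish_box_mono[OF that(1), of r] by (subst sum_diff) auto
    have "norm (P N x) \<le> (\<Prod>m\<in>nish_box r N. 1 + norm (f m x))"
      unfolding P_def prod_norm[symmetric]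
      by (intro prod_mono conjI norm_ge_zero order_trans[OF norm_triangle_ineq]) simp
    also have "\<dots> \<le> exp (B * S N)" unfolding S_def by (rule prod_le) (use that in auto)
    also have "\<dots> \<le> exp (B * C)" using C True by (simp add: mult_left_mono)
    finally have 1: "norm (P N x) \<le> exp (B * C)" .
    have "norm ((\<Prod>m\<in>?D. 1 + f m x) - 1) \<le> (\<Prod>m\<in>?D. 1 + norm (f m x)) - 1"
      by (rule norm_prod_minus1_le) simp
    also have "\<dots> \<le> exp (B * (S M - S N)) - 1"
      using prod_le[of ?D x] that SD by simp
    finally have 2: "norm ((\<Prod>m\<in>?D. 1 + f m x) - 1) \<le> exp (B * (S M - S N)) - 1" .
    have "dist (P N x) (P M x) = norm (P N x) * norm ((\<Prod>m\<in>?D. 1 + f m x) - 1)"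
      unfolding split dist_norm norm_minus_commute[of "P N x"] norm_mult[symmetric]
      by (simp add: algebra_simps)
    also have "\<dots> \<le> exp (B * C) * (exp (B * (S M - S N)) - 1)"
      by (intro mult_mono 1 2) auto
    finally show ?thesis .
  qed
  have "uniformly_Cauchy_on (cball 0 B) P"
  proof (rule uniformly_Cauchy_onI')
    fix e :: real assume e: "e > 0"
    define l where "l = (\<Prod>j\<le>r. 1 / (1 - norm (q j)))"
    have Sl: "S N \<le> l" for N
      unfolding l_def by (rule incseq_le[OF \<open>incseq S\<close> Slim])
    have "(\<lambda>N. exp (B * C) * (exp (B * (l - S N)) - 1)) \<longlonglongrightarrow> exp (B * C) * (exp (B * (l - l)) - 1)"
      unfolding l_def by (intro tendsto_intros Slim)
    then have "eventually (\<lambda>N. exp (B * C) * (exp (B * (l - S N)) - 1) < e) sequentially"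
      using e by (intro order_tendstoD) auto
    then obtain N0 where N0: "\<And>N. N \<ge> N0 \<Longrightarrow> exp (B * C) * (exp (B * (l - S N)) - 1) < e"
      by (auto simp: eventually_at_top_linorder)
    show "\<exists>M. \<forall>x\<in>cball (0 :: complex) B. \<forall>m\<ge>M. \<forall>n>m. dist (P m x) (P n x) < e"
    proof (intro exI[of _ N0] ballI allI impI)
      fix x :: complex and N M assume "x \<in> cball 0 B" "N0 \<le> N" "N < M"
      then have "dist (P N x) (P M x) \<le> exp (B * C) * (exp (B * (S M - S N)) - 1)"
        by (intro diff) auto
      also have "\<dots> \<le> exp (B * C) * (exp (B * (l - S N)) - 1)"
        using Sl[of M] True by (simp add: mult_left_mono)
      also have "\<dots> < e" using N0 \<open>N0 \<le> N\<close> by blast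
      finally show "dist (P N x) (P M x) < e" .
    qed
  qed
  then have "uniformly_convergent_on (cball 0 B) P"
    by (rule Cauchy_uniformly_convergent)
  then show ?thesis unfolding P_def f_def by simp
qed

lemma qpoch_tendsto:
  assumes q: "\<And>j. j \<le> r \<Longrightarrow> norm (q j) < 1"
  shows "(\<lambda>N. \<Prod>m\<in>nish_box r N. 1 - (\<Prod>j\<le>r. q j ^ m j) * x) \<longlonglongrightarrow> qpoch r q x"
proof -
  have "convergent (\<lambda>N. \<Prod>m\<in>nish_box r N. 1 - (\<Prod>j\<le>r. q j ^ m j) * x)"
    by (rule uniformly_convergent_imp_convergent[OF uniformly_convergent_qpoch[OF q, where B = "norm x"]]) auto
  then show ?thesis
    by (simp add: convergent_LIMSEQ_iff qpoch_def)
qed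

lemma holomorphic_qpoch:
  assumes q: "\<And>j. j \<le> r \<Longrightarrow> norm (q j) < 1"
  shows "qpoch r q holomorphic_on UNIV"
proof (rule holomorphic_uniform_sequence[OF open_UNIV])
  show "(\<lambda>x. \<Prod>m\<in>nish_box r N. 1 - (\<Prod>j\<le>r. q j ^ m j) * x) holomorphic_on UNIV" for N
    by (intro holomorphic_intros)
next
  fix x :: complex
  have "uniform_limit (cball 0 (norm x + 1)) (\<lambda>N x. \<Prod>m\<in>nish_box r N. 1 - (\<Prod>j\<le>r. q j ^ m j) * x)
          (\<lambda>x. qpoch r q x) sequentially"
    unfolding qpoch_def using uniformly_convergent_qpoch[OF q, where B = "norm x + 1"]
    by (subst (asm) uniformly_convergent_uniform_limit_iff)
  then have "uniform_limit (cball x 1) (\<lambda>N x. \<Prod>m\<in>nish_box r N. 1 - (\<Prod>j\<le>r. q j ^ m j) * x)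
          (qpoch r q) sequentially"
  proof (rule uniform_limit_on_subset)
    show "cball x 1 \<subseteq> cball 0 (norm x + 1)"
    proof
      fix y assume "y \<in> cball x 1"
      then show "y \<in> cball 0 (norm x + 1)"
        using norm_triangle_ineq2[of y x] by (simp add: dist_norm norm_minus_commute)
    qed
  qed
  then show "\<exists>d>0. cball x d \<subseteq> UNIV \<and> uniform_limit (cball x d)
               (\<lambda>N x. \<Prod>m\<in>nish_box r N. 1 - (\<Prod>j\<le>r. q j ^ m j) * x) (qpoch r q) sequentially"
    by (intro exI[of _ 1]) auto
qed


text \<open>Each \<open>Ln (1 - ...)\<close> is expanded in powers of x. For fixed l the sum over a
  box is a product of finite geometric sums, and Tannery's theorem lets the box grow inside the sum
  over l. The term l = 0 is zero because of the division by \<open>of_nat 0\<close>.\<close>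

lemma qpoch_eq_exp:
  assumes q: "\<And>j. j \<le> r \<Longrightarrow> norm (q j) < 1" and x: "norm x < 1"
  shows "summable (\<lambda>l. - (x ^ l) / (of_nat l * (\<Prod>j\<le>r. 1 - q j ^ l)))"
    and "qpoch r q x = exp (\<Sum>l. - (x ^ l) / (of_nat l * (\<Prod>j\<le>r. 1 - q j ^ l)))"
proof -
  define a where "a l N = - (x ^ l) / of_nat l * (\<Prod>j\<le>r. \<Sum>i<N. (q j ^ l) ^ i)" for l N :: nat
  define b where "b l = - (x ^ l) / of_nat l * (\<Prod>j\<le>r. 1 / (1 - q j ^ l))" for l :: nat
  define K where "K = (\<Prod>j\<le>r. 1 / (1 - norm (q j)))"
  have ql: "norm (q j ^ l) < 1" if "j \<le> r" "l > 0" for j l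
    using q[OF that(1)] that(2) by (simp add: norm_power power_less_one_iff)
  have prodlim: "(\<Prod>m\<in>nish_box r N. 1 - (\<Prod>j\<le>r. q j ^ m j) * x) = exp (\<Sum>l. a l N)" for N
  proof -
    have qm: "norm ((\<Prod>j\<le>r. q j ^ m j) * x) < 1" for m
    proof -
      have "norm (\<Prod>j\<le>r. q j ^ m j) \<le> 1"
        unfolding prod_norm[symmetric] using q
        by (intro prod_le_1) (auto simp: norm_power power_le_one less_imp_le)
      then show ?thesis
        using x by (metis dual_order.strict_trans2 mult_left_le_one_le norm_ge_zero norm_mult)
    qed
    have "(\<lambda>l. \<Sum>m\<in>nish_box r N. - (((\<Prod>j\<le>r. q j ^ m j) * x) ^ l) / of_nat l)
            sums (\<Sum>m\<in>nish_box r N. Ln (1 - (\<Prod>j\<le>r. q j ^ m j) * x))"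
    proof (rule sums_sum)
      fix m
      show "(\<lambda>l. - (((\<Prod>j\<le>r. q j ^ m j) * x) ^ l) / of_nat l) sums Ln (1 - (\<Prod>j\<le>r. q j ^ m j) * x)"
        using Ln_series'[of "- ((\<Prod>j\<le>r. q j ^ m j) * x)"] qm[of m] by simp
    qed
    moreover have "(\<Sum>m\<in>nish_box r N. - (((\<Prod>j\<le>r. q j ^ m j) * x) ^ l) / of_nat l) = a l N" for l
    proof -
      have "(\<Sum>m\<in>nish_box r N. - (((\<Prod>j\<le>r. q j ^ m j) * x) ^ l) / of_nat l) =
            (\<Sum>m\<in>nish_box r N. - (x ^ l) / of_nat l * (\<Prod>j\<le>r. (q j ^ l) ^ m j))"
        by (intro sum.cong refl)
           (simp add: power_mult_distrib prod_power_distrib power_mult[symmetric] mult.commute)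
      also have "\<dots> = a l N"
        unfolding a_def sum_nish_box[symmetric] by (simp add: sum_distrib_left)
      finally show ?thesis .
    qed
    ultimately have "(\<lambda>l. a l N) sums (\<Sum>m\<in>nish_box r N. Ln (1 - (\<Prod>j\<le>r. q j ^ m j) * x))"
      by simp
    then have "exp (\<Sum>l. a l N) = exp (\<Sum>m\<in>nish_box r N. Ln (1 - (\<Prod>j\<le>r. q j ^ m j) * x))"
      by (simp add: sums_iff)
    also have "\<dots> = (\<Prod>m\<in>nish_box r N. 1 - (\<Prod>j\<le>r. q j ^ m j) * x)"
      unfolding exp_sum[OF finite_nish_box]
    proof (intro prod.cong refl exp_Ln)
      fix m
      show "1 - (\<Prod>j\<le>r. q j ^ m j) * x \<noteq> 0"
        using qm[of m] by (metis eq_iff_diff_eq_0 less_irrefl norm_one)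
    qed
    finally show ?thesis by simp
  qed
  have alim: "(\<lambda>N. a l N) \<longlonglongrightarrow> b l" for l
  proof (cases "l = 0")
    case False
    show ?thesis unfolding a_def b_def
    proof (intro tendsto_intros)
      fix j assume "j \<in> {..r}"
      then show "(\<lambda>N. \<Sum>i<N. (q j ^ l) ^ i) \<longlonglongrightarrow> 1 / (1 - q j ^ l)"
        using geometric_sums[OF ql[of j l]] False by (simp add: sums_def)
    qed
  qed (simp add: a_def b_def)
  have bound: "norm (a l N) \<le> norm x ^ l * K" for l N
  proof (cases "l = 0")
    case True
    have "K \<ge> 0" unfolding K_def using q by (intro prod_nonneg) (auto simp: less_imp_le)
    with True show ?thesis by (simp add: a_def)
  next
    case False
    have "norm (\<Prod>j\<le>r. \<Sum>i<N. (q j ^ l) ^ i) \<le> K"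
      unfolding prod_norm[symmetric] K_def
    proof (intro prod_mono conjI norm_ge_zero)
      fix j assume j: "j \<in> {..r}"
      have "norm (\<Sum>i<N. (q j ^ l) ^ i) \<le> (\<Sum>i<N. norm (q j) ^ i)"
      proof (rule sum_norm_le)
        fix i
        \<comment> \<open>Since \<open>norm (q j) < 1\<close>, this bounds the powers of
          \<open>q j ^ l\<close> by those of \<open>q j\<close>, so that \<open>K\<close> does not
          depend on l and \<open>norm x ^ l * K\<close> is a summable majorant.\<close>
        have "i \<le> l * i" using False by (cases l) auto
        then show "norm ((q j ^ l) ^ i) \<le> norm (q j) ^ i"
          using q[of j] j False
          by (simp add: norm_power power_mult[symmetric] power_decreasing less_imp_le)
      qed
      also have "\<dots> \<le> (\<Sum>i. norm (q j) ^ i)"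
        using q[of j] j by (intro sum_le_suminf summable_geometric) auto
      also have "\<dots> = 1 / (1 - norm (q j))"
        using q[of j] j by (intro suminf_geometric) auto
      finally show "norm (\<Sum>i<N. (q j ^ l) ^ i) \<le> 1 / (1 - norm (q j))" .
    qed
    moreover have "norm (- (x ^ l) / of_nat l) \<le> norm x ^ l"
      using False by (simp add: norm_divide norm_power divide_le_eq mult_le_cancel_left1)
    ultimately show ?thesis
      unfolding a_def norm_mult by (intro mult_mono) auto
  qed
  have ev: "eventually (\<lambda>(l, N). norm (a l N) \<le> norm x ^ l * K) (at_top \<times>\<^sub>F sequentially)"
    by (intro always_eventually) (auto simp: bound)
  have summ: "summable (\<lambda>l. norm x ^ l * K)"
    using x by (intro summable_mult2 summable_geometric) auto
  have tann: "summable (\<lambda>l. norm (b l)) \<and> (\<lambda>N. \<Sum>l. a l N) \<longlonglongrightarrow> suminf b"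
    using tannerys_theorem[OF alim ev summ] by simp
  have beq: "b = (\<lambda>l. - (x ^ l) / (of_nat l * (\<Prod>j\<le>r. 1 - q j ^ l)))"
    by (auto simp: b_def prod_dividef fun_eq_iff)
  show "summable (\<lambda>l. - (x ^ l) / (of_nat l * (\<Prod>j\<le>r. 1 - q j ^ l)))"
    using summable_norm_cancel[OF conjunct1[OF tann]] by (simp only: beq)
  have "(\<lambda>N. exp (\<Sum>l. a l N)) \<longlonglongrightarrow> exp (suminf b)"
    using tann by (intro tendsto_intros) auto
  then show "qpoch r q x = exp (\<Sum>l. - (x ^ l) / (of_nat l * (\<Prod>j\<le>r. 1 - q j ^ l)))"
    using LIMSEQ_unique[OF qpoch_tendsto[of r q x]] q by (simp only: prodlim beq)
qed

lemma nishP2_eq_qpoch: "nishP2 r \<tau> z = qpoch r (\<lambda>j. qexp (\<tau> j)) (qexp z)"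
  by (simp add: nishP2_def qpoch_def)

text \<open>The shifts m_j + 1 pull out one factor \<open>qexp (\<tau> j)\<close> for each j;
  together with the inverse of \<open>qexp z\<close> they form the new argument.\<close>

lemma nishP1_eq_qpoch:
  "nishP1 r \<tau> z = qpoch r (\<lambda>j. qexp (\<tau> j)) (qexp ((\<Sum>j\<le>r. \<tau> j) - z))"
  by (simp add: nishP1_def qpoch_def qexp_diff qexp_sum prod.distrib divide_inverse mult_ac)

lemma meromorphic_nish_upper:
  assumes "\<And>j. j \<le> r \<Longrightarrow> Im (\<tau> j) > 0"
  shows "nish_upper r \<tau> meromorphic_on UNIV"
proof -
  have q: "norm (qexp (\<tau> j)) < 1" if "j \<le> r" for j
    using assms[OF that] by (simp add: norm_qexp)
  have hol: "(\<lambda>z. qpoch r (\<lambda>j. qexp (\<tau> j)) (f z)) holomorphic_on UNIV" if "f holomorphic_on UNIV" for f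
    using holomorphic_on_compose_gen[OF that holomorphic_qpoch[of r "\<lambda>j. qexp (\<tau> j)"]] q
    by (simp add: o_def)
  have "nishP1 r \<tau> holomorphic_on UNIV" "nishP2 r \<tau> holomorphic_on UNIV"
    unfolding nishP1_eq_qpoch[abs_def] nishP2_eq_qpoch[abs_def] by (intro hol holomorphic_intros)+
  then have "nishP1 r \<tau> meromorphic_on UNIV" "nishP2 r \<tau> meromorphic_on UNIV"
    by (simp_all add: analytic_on_imp_meromorphic_on analytic_on_open)
  then show ?thesis
    unfolding nish_upper_def[abs_def] by (intro meromorphic_intros)
qed

text \<open>The \<open>m\<close>-th term of the Fourier expansion of the logarithm of Nishizawa's function;
  it vanishes for \<open>m = 0\<close> because of the division by zero.\<close>
definition nterm :: "nat \<Rightarrow> (nat \<Rightarrow> complex) \<Rightarrow> complex \<Rightarrow> int \<Rightarrow> complex" where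
  "nterm r \<tau> z m = qexp (of_int m * z) / (of_int m * (\<Prod>j\<le>r. qexp (of_int m * \<tau> j) - 1))"

lemma qexp_int_mult: "qexp (of_int (int l) * z) = qexp z ^ l" "qexp (of_int (- int l) * z) = inverse (qexp z ^ l)"
  using qexp_of_nat_mult[of l z] qexp_minus[of "of_nat l * z"] by simp_all

lemma exp_powi_sign: "exp s powi ((-1::int) ^ k) = exp ((-1) ^ k * (s :: complex))"
  by (cases "even k") (auto simp: exp_minus)

lemma prod_one_minus: "(\<Prod>j\<le>r. 1 - f j) = (-1) ^ Suc r * (\<Prod>j\<le>r. f j - (1 :: complex))"
proof -
  have "(\<Prod>j\<le>r. 1 - f j) = (\<Prod>j\<le>r. (-1) * (f j - 1))" by simp
  then show ?thesis by (simp only: prod.distrib prod_constant) simp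
qed

text \<open>The bounds on \<open>Im z\<close> make both \<open>qexp z\<close> and
  \<open>qexp ((\<Sum>j\<le>r. \<tau> j) - z)\<close> smaller than 1 in norm. The factor
  \<open>nishP2\<close> supplies the terms m > 0 and \<open>nishP1\<close> those with m < 0. For m >
  0 the exponent (-1)^r is absorbed by writing the denominators with q^m - 1 instead of 1 - q^m.
  Pairing l with -l leaves a series over the naturals.\<close>

lemma nish_upper_eq_exp:
  assumes \<tau>: "\<And>j. j \<le> r \<Longrightarrow> Im (\<tau> j) > 0" and z: "0 < Im z" "Im z < (\<Sum>j\<le>r. Im (\<tau> j))"
  shows "\<exists>s. (\<lambda>l. nterm r \<tau> z (int l) + nterm r \<tau> z (- int l)) sums s \<and> nish_upper r \<tau> z = exp s"
proof -
  define q where "q j = qexp (\<tau> j)" for j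
  have q: "norm (q j) < 1" if "j \<le> r" for j
    using \<tau>[OF that] by (simp add: norm_qexp q_def)
  define y where "y = qexp ((\<Sum>j\<le>r. \<tau> j) - z)"
  have x1: "norm (qexp z) < 1" and y1: "norm y < 1"
    using z by (simp_all add: norm_qexp y_def)
  define b where "b x l = - (x ^ l) / (of_nat l * (\<Prod>j\<le>r. 1 - q j ^ l))" for x l
  have 1: "summable (b (qexp z))" "nishP2 r \<tau> z = exp (suminf (b (qexp z)))"
    and 2: "summable (b y)" "nishP1 r \<tau> z = exp (suminf (b y))"
    unfolding b_def nishP1_eq_qpoch nishP2_eq_qpoch y_def[symmetric] q_def[symmetric]
    using qpoch_eq_exp[OF q x1] qpoch_eq_exp[OF q y1] by simp_all
  have t1: "nterm r \<tau> z (int l) = (-1) ^ r * b (qexp z) l" for l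
    by (simp only: nterm_def qexp_int_mult b_def prod_one_minus q_def) (auto simp: uminus_power_if)
  have t2: "nterm r \<tau> z (- int l) = b y l" for l
  proof -
    have e: "(\<Prod>j\<le>r. inverse (q j ^ l) - 1) = (\<Prod>j\<le>r. (1 - q j ^ l)) / (\<Prod>j\<le>r. q j) ^ l"
      unfolding prod_power_distrib prod_dividef[symmetric]
      by (intro prod.cong refl) (simp add: q_def field_simps)
    have "y = (\<Prod>j\<le>r. q j) / qexp z"
      by (simp add: y_def qexp_diff qexp_sum q_def)
    moreover have "(\<Prod>j\<le>r. q j) \<noteq> 0" by (simp add: q_def)
    ultimately show ?thesis
      unfolding nterm_def qexp_int_mult q_def[symmetric] e b_def
      by (simp only: power_divide) (simp add: field_simps)
  qed
  have "(\<lambda>l. nterm r \<tau> z (int l) + nterm r \<tau> z (- int l)) sums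
          ((-1) ^ r * suminf (b (qexp z)) + suminf (b y))"
    unfolding t1 t2 by (intro sums_add sums_mult summable_sums 1 2)
  moreover have "nish_upper r \<tau> z = exp ((-1) ^ r * suminf (b (qexp z)) + suminf (b y))"
    unfolding nish_upper_def 1 2 exp_powi_sign exp_add by simp
  ultimately show ?thesis by blast
qed

lemma meromorphic_nishG:
  assumes "\<And>j. j \<le> r \<Longrightarrow> Im (\<tau> j) \<noteq> 0"
  shows "nishG r \<tau> meromorphic_on UNIV"
proof -
  define S where "S = {j. j \<le> r \<and> Im (\<tau> j) < 0}"
  define \<tau>' where "\<tau>' = (\<lambda>j. if j \<in> S then - \<tau> j else \<tau> j)"
  have "nish_upper r \<tau>' meromorphic_on UNIV"
    by (intro meromorphic_nish_upper) (use assms in \<open>auto simp: \<tau>'_def S_def linorder_neq_iff\<close>)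
  then have "(\<lambda>z. nish_upper r \<tau>' (z - (\<Sum>j\<in>S. \<tau> j))) meromorphic_on UNIV"
    by (rule meromorphic_on_compose) (auto intro!: analytic_intros)
  then show ?thesis
    unfolding nishG_def[abs_def] Let_def S_def[symmetric] \<tau>'_def[symmetric]
    by (intro meromorphic_intros)
qed

text \<open>The strip is the one of \<open>nish_upper\<close> for the reflected parameters, moved by
  the sum of the \<open>\<tau> j\<close> with negative imaginary part. The series keeps its form
  because reflecting one parameter and shifting z changes every term only by a sign, which the
  exponent \<open>(-1) ^ card S\<close> undoes.\<close>

lemma nishG_eq_exp:
  assumes \<tau>: "\<And>j. j \<le> r \<Longrightarrow> Im (\<tau> j) \<noteq> 0"
    and z: "(\<Sum>j\<le>r. min 0 (Im (\<tau> j))) < Im z" "Im z < (\<Sum>j\<le>r. max 0 (Im (\<tau> j)))"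
  shows "\<exists>s. (\<lambda>l. nterm r \<tau> z (int l) + nterm r \<tau> z (- int l)) sums s \<and> nishG r \<tau> z = exp s"
proof -
  define S where "S = {j. j \<le> r \<and> Im (\<tau> j) < 0}"
  define \<tau>' where "\<tau>' = (\<lambda>j. if j \<in> S then - \<tau> j else \<tau> j)"
  have S: "S \<subseteq> {..r}" "finite S" by (auto simp: S_def)
  have SI: "(\<Sum>j\<in>S. Im (\<tau> j)) = (\<Sum>j\<le>r. min 0 (Im (\<tau> j)))"
    by (rule sum.mono_neutral_cong_left) (auto simp: S_def)
  have "(\<Sum>j\<le>r. Im (\<tau>' j)) = (\<Sum>j\<le>r. max 0 (Im (\<tau> j)) - min 0 (Im (\<tau> j)))"
    by (intro sum.cong) (auto simp: S_def \<tau>'_def)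
  moreover have "Im (\<tau>' j) > 0" if "j \<le> r" for j
    using \<tau>[OF that] that by (auto simp: \<tau>'_def S_def)
  ultimately obtain s where s: "(\<lambda>l. nterm r \<tau>' (z - (\<Sum>j\<in>S. \<tau> j)) (int l) + nterm r \<tau>' (z - (\<Sum>j\<in>S. \<tau> j)) (- int l)) sums s"
      "nish_upper r \<tau>' (z - (\<Sum>j\<in>S. \<tau> j)) = exp s"
    using nish_upper_eq_exp[of r \<tau>' "z - (\<Sum>j\<in>S. \<tau> j)"] z SI
    by (auto simp: sum_subtractf)
  \<comment> \<open>For each j in S this is the identity 1/q - 1 = -(q - 1)/q; the resulting factor
    q is cancelled by the shift of z.\<close>
  have t: "(-1) ^ card S * nterm r \<tau>' (z - (\<Sum>j\<in>S. \<tau> j)) m = nterm r \<tau> z m" for m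
  proof (cases "m = 0")
    case False
    have nz: "qexp (of_int m * \<tau> j) - 1 \<noteq> 0" if "j \<le> r" for j
      using qexp_eq_1_imp_real[of "of_int m * \<tau> j"] \<tau>[OF that] False by auto
    have "(\<Prod>j\<le>r. qexp (of_int m * \<tau>' j) - 1) =
          (\<Prod>j\<le>r. (if j \<in> S then - inverse (qexp (of_int m * \<tau> j)) else 1) * (qexp (of_int m * \<tau> j) - 1))"
      by (intro prod.cong refl) (auto simp: \<tau>'_def qexp_minus field_simps)
    also have "\<dots> = (\<Prod>j\<in>S. - inverse (qexp (of_int m * \<tau> j))) * (\<Prod>j\<le>r. qexp (of_int m * \<tau> j) - 1)"
      using S by (subst prod.distrib, subst prod.inter_restrict[symmetric]) (auto simp: Int_absorb1)
    also have "(\<Prod>j\<in>S. - inverse (qexp (of_int m * \<tau> j))) = (-1) ^ card S * inverse (qexp (of_int m * (\<Sum>j\<in>S. \<tau> j)))"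
      by (simp add: prod_uminus qexp_sum[OF S(2)] sum_distrib_left prod_inversef[symmetric])
    finally have e: "(\<Prod>j\<le>r. qexp (of_int m * \<tau>' j) - 1) =
        (-1) ^ card S * inverse (qexp (of_int m * (\<Sum>j\<in>S. \<tau> j))) * (\<Prod>j\<le>r. qexp (of_int m * \<tau> j) - 1)" .
    have "(\<Prod>j\<le>r. qexp (of_int m * \<tau> j) - 1) \<noteq> 0" using nz by auto
    then show ?thesis
      unfolding nterm_def e using False
      by (simp add: right_diff_distrib qexp_diff field_simps)
  qed (simp add: nterm_def)
  have "(\<lambda>l. nterm r \<tau> z (int l) + nterm r \<tau> z (- int l)) sums ((-1) ^ card S * s)"
    using sums_mult[OF s(1), of "(-1) ^ card S"] by (simp only: distrib_left t)
  moreover have "nishG r \<tau> z = exp ((-1) ^ card S * s)"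
    unfolding nishG_def Let_def S_def[symmetric] \<tau>'_def[symmetric] s(2) exp_powi_sign ..
  ultimately show ?thesis by blast
qed

subsection \<open>The modular property for a single family of periods\<close>

text \<open>If \<open>exp u\<close> is close to 1, its principal logarithm is small, and this
  logarithm differs from u by a multiple of 2 pi i.\<close>

lemma norm_exp_minus_1_ge_aux:
  assumes d: "\<And>m::int. d \<le> norm (u - 2 * pi * \<i> * of_int m)" "0 \<le> d" "d \<le> 1"
  shows "norm (exp u - 1) \<ge> d / 2"
proof (rule ccontr)
  assume "\<not> ?thesis"
  then have less: "norm (exp u - 1) < d / 2" by simp
  then have "norm (Ln (1 + (exp u - 1))) \<le> 2 * norm (exp u - 1)"
    using d by (intro norm_Ln_le) auto
  then have small: "norm (Ln (exp u)) < d" using less by simp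
  have "exp (Ln (exp u)) = exp u" by simp
  then obtain n :: int where "Ln (exp u) = u + (of_int (2 * n) * pi) * \<i>"
    unfolding exp_eq by blast
  then have "norm (u - 2 * pi * \<i> * of_int (- n)) < d"
    using small by (simp add: algebra_simps)
  with d(1)[of "- n"] show False by linarith
qed

text \<open>For positive real part, factor out \<open>exp u\<close> and apply the previous bound to
  -u. The growth factor is what later cancels against the numerator of the kernel.\<close>

lemma norm_exp_minus_1_ge:
  assumes d: "\<And>m::int. d \<le> norm (u - 2 * pi * \<i> * of_int m)" "0 \<le> d" "d \<le> 1"
  shows "norm (exp u - 1) \<ge> exp (max 0 (Re u)) * (d / 2)"
proof (cases "Re u \<le> 0")
  case True
  then show ?thesis using norm_exp_minus_1_ge_aux[OF d] by simp
next
  case False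
  have "d \<le> norm (- u - 2 * pi * \<i> * of_int m)" for m :: int
    using d(1)[of "- m"] norm_minus_cancel[of "- u - 2 * pi * \<i> * of_int m"]
    by (simp add: algebra_simps)
  then have "norm (exp (- u) - 1) \<ge> d / 2"
    using d by (intro norm_exp_minus_1_ge_aux) auto
  moreover have "exp u - 1 = exp u * (- (exp (- u) - 1))"
    by (simp add: algebra_simps exp_minus)
  then have "norm (exp u - 1) = exp (Re u) * norm (exp (- u) - 1)"
    by (metis norm_minus_cancel norm_mult norm_exp_eq_Re)
  ultimately show ?thesis using False by simp
qed

text \<open>Pigeonhole: among the K + 1 points \<open>T + i / (K + 1)\<close>, no two can be within
  half the spacing of the same element of E, so K elements cannot block all of them.\<close>

lemma exists_real_avoiding_finite:
  fixes E :: "real set"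
  assumes "finite E" "card E \<le> K"
  shows "\<exists>R. T \<le> R \<and> R \<le> T + 1 \<and> (\<forall>e\<in>E. \<bar>R - e\<bar> \<ge> 1 / (2 * (real K + 1)))"
proof (rule ccontr)
  assume neg: "\<not> ?thesis"
  define p where "p i = T + real i / (real K + 1)" for i :: nat
  have "\<exists>e\<in>E. \<bar>p i - e\<bar> < 1 / (2 * (real K + 1))" if "i \<in> {..K}" for i
  proof -
    have "T \<le> p i" "p i \<le> T + 1" using that by (auto simp: p_def field_simps)
    with neg show ?thesis by (meson not_le)
  qed
  then obtain e where e: "\<And>i. i \<in> {..K} \<Longrightarrow> e i \<in> E"
      "\<And>i. i \<in> {..K} \<Longrightarrow> \<bar>p i - e i\<bar> < 1 / (2 * (real K + 1))"
    by metis
  have "inj_on e {..K}"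
  proof (rule inj_onI)
    fix i j assume ij: "i \<in> {..K}" "j \<in> {..K}" "e i = e j"
    have "\<bar>p i - p j\<bar> < 1 / (2 * (real K + 1)) + 1 / (2 * (real K + 1))"
      using e(2)[OF ij(1)] e(2)[OF ij(2)] ij(3) by linarith
    also have "\<dots> = 1 / (real K + 1)" by (simp add: field_simps)
    finally have "\<bar>p i - p j\<bar> < 1 / (real K + 1)" .
    moreover have "p i - p j = (real i - real j) / (real K + 1)"
      by (simp add: p_def diff_divide_distrib)
    ultimately have "\<bar>real i - real j\<bar> < 1" by (simp add: divide_less_cancel)
    then show "i = j" by linarith
  qed
  then have "card (e ` {..K}) = Suc K" by (simp add: card_image)
  moreover have "card (e ` {..K}) \<le> card E"
    using e(1) assms(1) by (intro card_mono) auto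
  ultimately show False using assms(2) by simp
qed

text \<open>The values \<open>2 * pi * m / norm (\<omega> k)\<close> are the moduli of the poles of
  the kernel. Only O(N) of them can come near the interval from N to N + 1, so a gap of order 1/(N +
  1) can be found there.\<close>

lemma exists_radii_avoiding_poles:
  fixes \<omega> :: "nat \<Rightarrow> complex"
  assumes \<omega>: "\<And>k. k < n \<Longrightarrow> \<omega> k \<noteq> 0"
  shows "\<exists>D\<ge>1. \<forall>N::nat. \<exists>R. real N \<le> R \<and> R \<le> real N + 1 \<and>
           (\<forall>k<n. \<forall>m::nat. \<bar>R - 2 * pi * real m / norm (\<omega> k)\<bar> \<ge> 1 / (D * (real N + 1)))"
proof -
  obtain C :: nat where C: "\<And>k. k < n \<Longrightarrow> norm (\<omega> k) \<le> real C"
  proof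
    fix k assume "k < n"
    then have "norm (\<omega> k) \<le> (\<Sum>j<n. norm (\<omega> j))" by (intro member_le_sum) auto
    also have "\<dots> \<le> real (nat \<lceil>\<Sum>j<n. norm (\<omega> j)\<rceil>)" by linarith
    finally show "norm (\<omega> k) \<le> real (nat \<lceil>\<Sum>j<n. norm (\<omega> j)\<rceil>)" .
  qed
  \<comment> \<open>Chosen so that \<open>2 * (K + 1) \<le> D * (N + 1)\<close> for the number
    \<open>K\<close> of moduli that have to be avoided.\<close>
  define D where "D = 2 * (real n * (real C + 1) + 1)"
  have D: "D \<ge> 1" by (simp add: D_def)
  have "\<exists>R. real N \<le> R \<and> R \<le> real N + 1 \<and>
           (\<forall>k<n. \<forall>m::nat. \<bar>R - 2 * pi * real m / norm (\<omega> k)\<bar> \<ge> 1 / (D * (real N + 1)))" for N :: nat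
  proof -
    define E where "E = (\<lambda>(k, m). 2 * pi * real m / norm (\<omega> k)) ` ({..<n} \<times> {..C * (N + 1)})"
    define K where "K = n * (C * (N + 1) + 1)"
    have "card E \<le> card ({..<n} \<times> {..C * (N + 1)})"
      unfolding E_def by (rule card_image_le) auto
    then have "card E \<le> K" "finite E" by (auto simp: K_def E_def)
    then obtain R where R: "real N \<le> R" "R \<le> real N + 1" "\<And>e. e \<in> E \<Longrightarrow> \<bar>R - e\<bar> \<ge> 1 / (2 * (real K + 1))"
      using exists_real_avoiding_finite[of E K "real N"] by auto
    have "real K + 1 \<le> real n * ((real C + 1) * (real N + 1)) + (real N + 1)"
      by (simp add: K_def algebra_simps)
    also have "\<dots> = (real n * (real C + 1) + 1) * (real N + 1)"
      by (simp add: algebra_simps)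
    finally have KD: "2 * (real K + 1) \<le> D * (real N + 1)" by (simp add: D_def algebra_simps)
    have "\<bar>R - 2 * pi * real m / norm (\<omega> k)\<bar> \<ge> 1 / (D * (real N + 1))" if "k < n" for k and m :: nat
    proof (cases "m \<le> C * (N + 1)")
      case True
      then have "2 * pi * real m / norm (\<omega> k) \<in> E"
        unfolding E_def using that by (intro image_eqI[of _ _ "(k, m)"]) auto
      then have "\<bar>R - 2 * pi * real m / norm (\<omega> k)\<bar> \<ge> 1 / (2 * (real K + 1))" by (rule R)
      moreover have "1 / (2 * (real K + 1)) \<ge> 1 / (D * (real N + 1))"
        using KD by (intro divide_left_mono) auto
      ultimately show ?thesis by linarith
    next
      \<comment> \<open>For larger m the modulus is at least 2 pi (N + 1), hence exceeds R by at
        least 1.\<close>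
      case False
      have pos: "norm (\<omega> k) > 0" using \<omega>[OF that] by simp
      have "norm (\<omega> k) * (real N + 1) \<le> real C * (real N + 1)"
        using C[OF that] by (intro mult_right_mono) auto
      also have "\<dots> = real (C * (N + 1))" by (simp add: algebra_simps)
      also have "\<dots> \<le> real m" using False by linarith
      finally have "real N + 1 \<le> real m / norm (\<omega> k)"
        using pos by (simp add: field_simps)
      then have "2 * pi * (real N + 1) \<le> 2 * pi * (real m / norm (\<omega> k))"
        by (intro mult_left_mono) auto
      moreover have "2 * pi * (real N + 1) \<ge> 2 * (real N + 1)"
        using pi_gt3 by (intro mult_right_mono) auto
      ultimately have "2 * pi * real m / norm (\<omega> k) - R \<ge> 1"
        using R(1,2) by simp
      moreover have "1 / (D * (real N + 1)) \<le> 1"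
        using mult_mono[of 1 D 1 "real N + 1"] D by (simp add: divide_le_eq)
      ultimately show ?thesis by linarith
    qed
    with R show ?thesis by blast
  qed
  with D show ?thesis by blast
qed

text \<open>The right-hand side is homogeneous in t, so its minimum over the unit circle serves as
  \<mu>. It is positive: a zero t would make \<open>\<omega> 0 * t\<close> and
  \<open>\<omega> 1 * t\<close> both purely imaginary and their ratio real.\<close>

lemma sum_abs_Re_ge:
  fixes \<omega> :: "nat \<Rightarrow> complex"
  assumes n: "n \<ge> 2" and \<omega>: "\<And>j k. j < n \<Longrightarrow> k < n \<Longrightarrow> j \<noteq> k \<Longrightarrow> \<omega> j / \<omega> k \<notin> \<real>"
  shows "\<exists>\<mu>>0. \<forall>t. \<mu> * norm t \<le> (\<Sum>j<n. \<bar>Re (\<omega> j * t)\<bar>) / 2"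
proof -
  define h where "h t = (\<Sum>j<n. \<bar>Re (\<omega> j * t)\<bar>) / 2" for t
  have "\<exists>t0\<in>sphere 0 1. \<forall>t\<in>sphere 0 1. h t0 \<le> h t"
    unfolding h_def by (intro continuous_attains_inf continuous_intros) (auto intro!: exI[of _ 1])
  then obtain t0 where t0: "norm t0 = 1" "\<And>t. norm t = 1 \<Longrightarrow> h t0 \<le> h t" by auto
  have "h t0 > 0"
  proof (rule ccontr)
    assume "\<not> h t0 > 0"
    moreover have "h t0 \<ge> 0" by (simp add: h_def sum_nonneg)
    ultimately have "(\<Sum>j<n. \<bar>Re (\<omega> j * t0)\<bar>) = 0" unfolding h_def by linarith
    then have "\<forall>j\<in>{..<n}. \<bar>Re (\<omega> j * t0)\<bar> = 0" by (subst (asm) sum_nonneg_eq_0_iff) auto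
    then have "Re (\<omega> 0 * t0) = 0" "Re (\<omega> 1 * t0) = 0" using n by auto
    then have "Im ((\<omega> 0 * t0) / (\<omega> 1 * t0)) = 0"
      by (simp only: Im_divide) simp
    moreover have "t0 \<noteq> 0" using t0 by auto
    ultimately have "\<omega> 0 / \<omega> 1 \<in> \<real>" by (simp add: complex_is_Real_iff)
    with \<omega>[of 0 1] n show False by auto
  qed
  moreover have "h t0 * norm t \<le> h t" for t
  proof (cases "t = 0")
    case False
    have eq: "\<bar>Re (\<omega> j * (t / norm t))\<bar> = \<bar>Re (\<omega> j * t)\<bar> / norm t" for j
    proof -
      have "\<omega> j * (t / norm t) = (\<omega> j * t) / of_real (norm t)" by simp
      then show ?thesis by (simp only: Re_divide_of_real) simp
    qed
    have "h t0 \<le> h (t / norm t)" using False by (intro t0) (simp add: norm_divide)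
    also have "\<dots> = h t / norm t"
      unfolding h_def eq sum_divide_distrib[symmetric] by simp
    finally show ?thesis using False by (simp add: field_simps)
  qed (simp add: h_def)
  ultimately show ?thesis unfolding h_def by blast
qed

lemma prod_del_fam:
  assumes "k \<le> r + 1"
  shows "(\<Prod>j\<le>r. f (del_fam k \<omega> j)) = (\<Prod>j\<in>{..<r+2} - {k}. f (\<omega> j))"
  by (rule prod.reindex_bij_witness[where i = "\<lambda>j. if j < k then j else j - 1" and j = "\<lambda>j. if j < k then j else Suc j"])
     (use assms in \<open>auto simp: del_fam_def\<close>)

lemma sum_del_fam:
  assumes "k \<le> r + 1"
  shows "(\<Sum>j\<le>r. f (del_fam k \<omega> j)) = (\<Sum>j\<in>{..<r+2} - {k}. f (\<omega> j))"
  by (rule sum.reindex_bij_witness[where i = "\<lambda>j. if j < k then j else j - 1" and j = "\<lambda>j. if j < k then j else Suc j"])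
     (use assms in \<open>auto simp: del_fam_def\<close>)

text \<open>Identity theorem: off a sparse set the difference is either always zero or never zero,
  and the second case is impossible near a point of U.\<close>

lemma meromorphic_eq_cosparse:
  assumes "f meromorphic_on UNIV" "g meromorphic_on UNIV" "open U" "U \<noteq> {}"
    and eq: "\<And>z. z \<in> U \<Longrightarrow> f z = g z"
  shows "eventually (\<lambda>z. f z = g z) (cosparse UNIV)"
proof -
  have "(\<lambda>z. f z - g z) meromorphic_on UNIV" by (intro meromorphic_intros assms)
  then consider "eventually (\<lambda>z. f z - g z = 0) (cosparse UNIV)" | "eventually (\<lambda>z. f z - g z \<noteq> 0) (cosparse UNIV)"
    using meromorphic_imp_constant_or_avoid[of "\<lambda>z. f z - g z" UNIV 0] by auto
  then show ?thesis
  proof cases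
    case 2
    obtain u where u: "u \<in> U" using assms by auto
    have "eventually (\<lambda>z. f z - g z \<noteq> 0) (at u)"
      using 2 by (simp add: eventually_cosparse_open_eq)
    moreover have "eventually (\<lambda>z. z \<in> U) (at u)"
      using u \<open>open U\<close> by (simp add: eventually_at_in_open')
    ultimately have "eventually (\<lambda>z. False) (at u)"
      by eventually_elim (use eq in auto)
    then show ?thesis by simp
  qed simp
qed


lemma holomorphic_bstar: "(\<lambda>z. bstar n k z \<omega>) holomorphic_on A"
  unfolding bstar_def fps_mult_nth fps_exp_nth by (intro holomorphic_intros) auto

section \<open>Residues and decay of the kernel for a fixed family of periods\<close>

locale narukawa =
  fixes r :: nat and \<omega> :: "nat \<Rightarrow> complex"
  assumes nz: "\<And>j. j < r + 2 \<Longrightarrow> \<omega> j \<noteq> 0"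
    and ratio: "\<And>j k. j < r + 2 \<Longrightarrow> k < r + 2 \<Longrightarrow> j \<noteq> k \<Longrightarrow> \<omega> j / \<omega> k \<notin> \<real>"
begin

definition kernel :: "complex \<Rightarrow> complex \<Rightarrow> complex" where
  "kernel z t = exp (z * t) / (t * (\<Prod>j<r+2. exp (\<omega> j * t) - 1))"

abbreviation lterm :: "complex \<Rightarrow> nat \<Rightarrow> int \<Rightarrow> complex" where
  "lterm z k \<equiv> nterm r (\<lambda>j. del_fam k \<omega> j / \<omega> k) (z / \<omega> k)"

definition pole :: "nat \<Rightarrow> int \<Rightarrow> complex" where
  "pole k m = 2 * pi * \<i> * of_int m / \<omega> k"

lemma pole_zero_iff: "k < r + 2 \<Longrightarrow> pole k m = 0 \<longleftrightarrow> m = 0"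
  using nz by (simp add: pole_def)

lemma exp_eq_1_iff_pole: "k < r + 2 \<Longrightarrow> exp (\<omega> k * t) = 1 \<longleftrightarrow> (\<exists>m. t = pole k m)"
proof -
  assume "k < r + 2"
  have "exp (\<omega> k * t) = exp 0 \<longleftrightarrow> (\<exists>m. t = pole k m)"
    unfolding exp_eq pole_def using nz[OF \<open>k < r + 2\<close>] by (simp add: field_simps)
  then show ?thesis by simp
qed

text \<open>The two progressions of poles lie on different lines through 0 because the ratio of the
  periods is not real. So all poles other than 0 are simple, and the residue sum counts each
  once.\<close>

lemma pole_inj:
  assumes "j < r + 2" "k < r + 2" "m \<noteq> 0" "pole k m = pole j m'"
  shows "j = k \<and> m = m'"
proof -
  have eq: "of_int m * \<omega> j = of_int m' * \<omega> k"
    using assms nz[of j] nz[of k] by (simp add: pole_def field_simps)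
  have "j = k"
  proof (rule ccontr)
    assume "j \<noteq> k"
    have "\<omega> j / \<omega> k = of_int m' / of_int m" using eq assms nz[of k] by (simp add: field_simps)
    also have "\<dots> \<in> \<real>" by (intro Reals_divide) auto
    finally show False using ratio[OF assms(1,2) \<open>j \<noteq> k\<close>] by simp
  qed
  with eq nz[of k] assms show ?thesis by simp
qed

lemma norm_pole: "norm (pole k m) = 2 * pi * \<bar>of_int m\<bar> / norm (\<omega> k)"
  by (simp add: pole_def norm_mult norm_divide)

text \<open>Only the factor \<open>exp (\<omega> k * t) - 1\<close> vanishes at the pole, with
  derivative \<open>\<omega> k\<close> there. The factor t of the kernel, multiplied by
  \<open>\<omega> k\<close>, becomes 2 pi i m and accounts for the division by m in
  \<open>nterm\<close>.\<close>

lemma residue_kernel_pole: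
  assumes k: "k < r + 2" and m: "m \<noteq> 0"
  shows "residue (kernel z) (pole k m) = lterm z k m / (2 * pi * \<i>)"
proof -
  let ?J = "{..<r+2} - {k}"
  define p where "p = pole k m"
  define f where "f t = exp (z * t) / (t * (\<Prod>j\<in>?J. exp (\<omega> j * t) - 1))" for t
  define U where "U = - {0} \<inter> (\<Inter>j\<in>?J. {t. exp (\<omega> j * t) \<noteq> 1})"
  have "open {t. exp (\<omega> j * t) \<noteq> 1}" for j
    by (intro open_Collect_neq continuous_intros)
  then have "open U" unfolding U_def by (intro open_Int open_INT) auto
  have "exp (\<omega> j * p) \<noteq> 1" if "j \<in> ?J" for j
    using that exp_eq_1_iff_pole[of j p] pole_inj[of j k m] k m by (auto simp: p_def)
  then have pU: "p \<in> U"
    using k m by (auto simp: U_def p_def pole_zero_iff)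
  then obtain e where e: "e > 0" "ball p e \<subseteq> U"
    using \<open>open U\<close> by (auto simp: open_contains_ball)
  have fhol: "f holomorphic_on ball p e"
    unfolding f_def using e(2) by (intro holomorphic_intros) (auto simp: U_def)
  have fp: "f p \<noteq> 0" unfolding f_def using pU by (auto simp: U_def)
  have keq: "kernel z = (\<lambda>t. f t / (exp (\<omega> k * t) - 1))"
  proof
    fix t
    have "(\<Prod>j<r+2. exp (\<omega> j * t) - 1) = (exp (\<omega> k * t) - 1) * (\<Prod>j\<in>?J. exp (\<omega> j * t) - 1)"
      using k by (intro prod.remove) auto
    then show "kernel z t = f t / (exp (\<omega> k * t) - 1)"
      unfolding kernel_def f_def by (simp only: divide_divide_eq_left mult_ac)
  qed
  have \<omega>kp: "\<omega> k * p = 2 * pi * \<i> * of_int m" using nz[OF k] by (simp add: p_def pole_def)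
  have ek: "exp (\<omega> k * p) = 1" unfolding p_def using exp_eq_1_iff_pole[OF k] by blast
  have "residue (\<lambda>t. f t / (exp (\<omega> k * t) - 1)) p = f p / (\<omega> k * exp (\<omega> k * p))"
    by (rule residue_simple_pole_deriv[where s = "ball p e"])
       (use fhol fp e nz[OF k] ek in \<open>auto intro!: holomorphic_intros derivative_eq_intros\<close>)
  also have "\<dots> = f p / \<omega> k" by (simp add: ek)
  also have "\<dots> = exp (z * p) / (2 * pi * \<i> * of_int m * (\<Prod>j\<in>?J. exp (\<omega> j * p) - 1))"
    unfolding f_def \<omega>kp[symmetric] by (simp add: mult_ac)
  also have "exp (z * p) = qexp (of_int m * (z / \<omega> k))"
    by (simp add: qexp_def p_def pole_def mult_ac)
  also have "(\<Prod>j\<in>?J. exp (\<omega> j * p) - 1) = (\<Prod>j\<le>r. qexp (of_int m * (del_fam k \<omega> j / \<omega> k)) - 1)"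
    using k by (subst prod_del_fam) (auto simp: qexp_def p_def pole_def mult_ac)
  finally show ?thesis
    unfolding keq[symmetric] p_def by (simp add: nterm_def mult_ac)
qed

text \<open>Multiplied by t^(r+3), the kernel is the generating function of the Bernoulli
  polynomials divided by the product of the periods; the residue is its coefficient of
  t^(r+2).\<close>

lemma residue_kernel_0:
  "residue (kernel z) 0 = bstar (r + 2) (r + 2) z \<omega> / (fact (r + 2) * (\<Prod>j<r+2. \<omega> j))"
proof -
  \<comment> \<open>The function \<open>\<omega> j * t / (exp (\<omega> j * t) - 1)\<close> with its
    singularity at 0 filled in, written in the shape that matches \<open>fps_shift\<close> in
    \<open>bstar\<close>.\<close>
  define g where "g j t = inverse (1 / \<omega> j * (if t = 0 then \<omega> j else (exp (\<omega> j * t) - 1) / t ^ 1))" for j t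
  have gexp: "g j has_fps_expansion inverse (fps_const (1 / \<omega> j) * fps_shift 1 (fps_exp (\<omega> j) - 1))"
    if "j < r + 2" for j
    unfolding g_def
  proof (intro fps_expansion_intros)
    have "fps_exp (\<omega> j) - 1 \<noteq> 0"
    proof
      assume "fps_exp (\<omega> j) - 1 = 0"
      then have "fps_nth (fps_exp (\<omega> j) - 1) 1 = 0" by (simp only: fps_zero_nth)
      then show False using nz[OF that] by simp
    qed
    then show "1 \<le> subdegree (fps_exp (\<omega> j) - 1)"
      by (intro subdegree_geI) auto
  qed (use nz[OF that] in auto)
  have gprod: "(\<lambda>t. \<Prod>j\<in>A. g j t) has_fps_expansion
          (\<Prod>j\<in>A. inverse (fps_const (1 / \<omega> j) * fps_shift 1 (fps_exp (\<omega> j) - 1)))"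
    if "finite A" "A \<subseteq> {..<r+2}" for A
    using that
  proof (induction A rule: finite_induct)
    case (insert j A)
    then have "(\<lambda>t. g j t * (\<Prod>j\<in>A. g j t)) has_fps_expansion
          (inverse (fps_const (1 / \<omega> j) * fps_shift 1 (fps_exp (\<omega> j) - 1)) *
          (\<Prod>j\<in>A. inverse (fps_const (1 / \<omega> j) * fps_shift 1 (fps_exp (\<omega> j) - 1))))"
      by (intro has_fps_expansion_mult gexp insert.IH) auto
    then show ?case using insert.hyps by (simp only: prod.insert not_False_eq_True)
  qed simp
  have "(\<lambda>t. 1 / (\<Prod>j<r+2. \<omega> j) * (exp (z * t) * (\<Prod>j<r+2. g j t))) has_fps_expansion
     fps_const (1 / (\<Prod>j<r+2. \<omega> j)) * (fps_exp z * (\<Prod>j<r+2. inverse (fps_const (1 / \<omega> j) * fps_shift 1 (fps_exp (\<omega> j) - 1))))"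
    by (intro has_fps_expansion_mult has_fps_expansion_const has_fps_expansion_exp gprod) auto
  then have "residue (\<lambda>t. 1 / (\<Prod>j<r+2. \<omega> j) * (exp (z * t) * (\<Prod>j<r+2. g j t)) / t ^ Suc (r + 2)) 0 =
     fps_nth (fps_const (1 / (\<Prod>j<r+2. \<omega> j)) * (fps_exp z * (\<Prod>j<r+2. inverse (fps_const (1 / \<omega> j) * fps_shift 1 (fps_exp (\<omega> j) - 1))))) (r + 2)"
    by (rule residue_fps_expansion_over_power_at_0)
  also have "\<dots> = bstar (r + 2) (r + 2) z \<omega> / (fact (r + 2) * (\<Prod>j<r+2. \<omega> j))"
    unfolding bstar_def fps_mult_left_const_nth by (simp del: fact_Suc)
  also have "residue (\<lambda>t. 1 / (\<Prod>j<r+2. \<omega> j) * (exp (z * t) * (\<Prod>j<r+2. g j t)) / t ^ Suc (r + 2)) 0 = residue (kernel z) 0"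
  proof (intro residue_cong refl)
    show "\<forall>\<^sub>F t in at 0. 1 / (\<Prod>j<r+2. \<omega> j) * (exp (z * t) * (\<Prod>j<r+2. g j t)) / t ^ Suc (r + 2) = kernel z t"
      unfolding eventually_at_filter
    proof (intro always_eventually allI impI)
      fix t :: complex assume t: "t \<noteq> 0"
      have "(\<Prod>j<r+2. g j t) = (\<Prod>j<r+2. \<omega> j * t / (exp (\<omega> j * t) - 1))"
        using t by (intro prod.cong) (auto simp: g_def field_simps)
      also have "\<dots> = (\<Prod>j<r+2. \<omega> j) * t ^ (r + 2) / (\<Prod>j<r+2. exp (\<omega> j * t) - 1)"
        by (simp only: prod_dividef prod.distrib prod_constant card_lessThan)
      finally have e: "(\<Prod>j<r+2. g j t) = (\<Prod>j<r+2. \<omega> j) * t ^ (r + 2) / (\<Prod>j<r+2. exp (\<omega> j * t) - 1)" .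
      have "(\<Prod>j<r+2. \<omega> j) \<noteq> 0" using nz by auto
      then show "1 / (\<Prod>j<r+2. \<omega> j) * (exp (z * t) * (\<Prod>j<r+2. g j t)) / t ^ Suc (r + 2) = kernel z t"
        unfolding e kernel_def power_Suc using t by (simp add: divide_simps del: power_Suc)
    qed
  qed
  finally show ?thesis by simp
qed


text \<open>The gap keeps the poles off the circle and even off the annulus up to R + g, so the
  residue theorem applies on that larger disc. The upper limit for l selects the m with
  \<open>norm (pole k m) < R\<close>: for integers, being below a real number and below its ceiling
  are equivalent.\<close>

lemma contour_integral_kernel:
  assumes R: "R > 0" and g: "g > 0"
    and gap: "\<And>k m. k < r + 2 \<Longrightarrow> \<bar>R - 2 * pi * real m / norm (\<omega> k)\<bar> \<ge> g"
  shows "contour_integral (circlepath 0 R) (kernel z) = 2 * pi * \<i> * residue (kernel z) 0 +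
    (\<Sum>k<r+2. \<Sum>l<nat \<lceil>R * norm (\<omega> k) / (2 * pi)\<rceil>.
       lterm z k (int l) + lterm z k (- int l))"
proof -
  define T where "T k m = lterm z k m" for k m
  define L where "L k = nat \<lceil>R * norm (\<omega> k) / (2 * pi)\<rceil>" for k
  define M where "M k = {m :: int. m \<noteq> 0 \<and> \<bar>m\<bar> < int (L k)}" for k
  define I where "I = Sigma {..<r+2} M"
  define P where "P = (\<lambda>(k, m). pole k m) ` I"
  have finM: "finite (M k)" for k
    by (rule finite_subset[of _ "{- int (L k)..int (L k)}"]) (auto simp: M_def)
  then have finI: "finite I" by (auto simp: I_def)
  have L_iff: "\<bar>m\<bar> < int (L k) \<longleftrightarrow> norm (pole k m) < R" if "k < r + 2" for k m
  proof -
    have pos: "norm (\<omega> k) > 0" using nz[OF that] by simp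
    have "int (L k) = \<lceil>R * norm (\<omega> k) / (2 * pi)\<rceil>"
    proof -
      have "0 < R * norm (\<omega> k) / (2 * pi)" using R pos by (intro divide_pos_pos mult_pos_pos) auto
      then have "0 \<le> \<lceil>R * norm (\<omega> k) / (2 * pi)\<rceil>" by linarith
      then show ?thesis by (simp add: L_def)
    qed
    then have "\<bar>m\<bar> < int (L k) \<longleftrightarrow> \<bar>real_of_int m\<bar> < R * norm (\<omega> k) / (2 * pi)"
      by (simp add: less_ceiling_iff)
    also have "\<dots> \<longleftrightarrow> norm (pole k m) < R"
      unfolding norm_pole using pos by (simp add: field_simps)
    finally show ?thesis .
  qed
  have inj: "inj_on (\<lambda>(k, m). pole k m) I"
  proof (rule inj_onI, clarify)
    fix k m k' m' assume "(k, m) \<in> I" "(k', m') \<in> I" "pole k m = pole k' m'"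
    then show "k = k' \<and> m = m'"
      using pole_inj[of k' k m m'] by (auto simp: I_def M_def)
  qed
  have "0 \<notin> P" by (auto simp: P_def I_def M_def pole_zero_iff)
  have normP: "norm p < R" if "p \<in> insert 0 P" for p
    using that R by (auto simp: P_def I_def M_def L_iff)
  have sing: "t \<in> insert 0 P" if t: "t \<in> ball 0 (R + g)" "t = 0 \<or> (\<exists>j<r+2. exp (\<omega> j * t) = 1)" for t
  proof (cases "t = 0")
    case False
    then obtain k m where km: "k < r + 2" "t = pole k m"
      using t exp_eq_1_iff_pole by blast
    have "\<bar>R - norm t\<bar> \<ge> g"
      using gap[OF km(1), of "nat \<bar>m\<bar>"] by (simp add: km(2) norm_pole)
    then have "norm t < R" using t g by auto
    then have "(k, m) \<in> I"
      using km False L_iff[OF km(1), of m] by (auto simp: I_def M_def pole_zero_iff)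
    then show ?thesis unfolding km P_def by force
  qed simp
  have "contour_integral (circlepath 0 R) (kernel z) =
      2 * pi * \<i> * (\<Sum>p\<in>insert 0 P. winding_number (circlepath 0 R) p * residue (kernel z) p)"
  proof (rule Residue_theorem[of "ball 0 (R + g)"])
    show "kernel z holomorphic_on ball 0 (R + g) - insert 0 P"
      unfolding kernel_def
    proof (intro holomorphic_intros)
      fix t assume "t \<in> ball 0 (R + g) - insert 0 P"
      then have "t \<noteq> 0" "\<And>j. j < r + 2 \<Longrightarrow> exp (\<omega> j * t) \<noteq> 1" using sing[of t] by auto
      then show "t * (\<Prod>j<r+2. exp (\<omega> j * t) - 1) \<noteq> 0"
        by (simp only: mult_eq_0_iff prod_zero_iff finite_lessThan) auto
    qed
    show "path_image (circlepath 0 R) \<subseteq> ball 0 (R + g) - insert 0 P"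
      using R g normP by (fastforce simp: path_image_circlepath)
    show "\<forall>w. w \<notin> ball 0 (R + g) \<longrightarrow> winding_number (circlepath 0 R) w = 0"
    proof (intro allI impI)
      fix w :: complex assume "w \<notin> ball 0 (R + g)"
      then show "winding_number (circlepath 0 R) w = 0"
        using R g by (intro winding_number_zero_outside[of _ "cball 0 R"]) (auto simp: path_image_circlepath)
    qed
  qed (use finI in \<open>auto simp: P_def\<close>)
  also have "(\<Sum>p\<in>insert 0 P. winding_number (circlepath 0 R) p * residue (kernel z) p) =
             (\<Sum>p\<in>insert 0 P. residue (kernel z) p)"
    using normP by (intro sum.cong refl) (simp add: winding_number_circlepath)
  also have "\<dots> = residue (kernel z) 0 + (\<Sum>p\<in>P. residue (kernel z) p)"
    using \<open>0 \<notin> P\<close> finI by (intro sum.insert) (auto simp: P_def)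
  also have "(\<Sum>p\<in>P. residue (kernel z) p) = (\<Sum>(k, m)\<in>I. T k m / (2 * pi * \<i>))"
    unfolding P_def sum.reindex[OF inj] o_def
    by (intro sum.cong refl) (auto simp: I_def M_def residue_kernel_pole T_def)
  also have "\<dots> = (\<Sum>k<r+2. \<Sum>m\<in>M k. T k m / (2 * pi * \<i>))"
    unfolding I_def using finM by (intro sum.Sigma[symmetric]) auto
  also have "\<dots> = (\<Sum>k<r+2. \<Sum>l<L k. T k (int l) + T k (- int l)) / (2 * pi * \<i>)"
  proof -
    \<comment> \<open>The nonzero m are paired as l and -l; the extra summand l = 0 on the right
      vanishes by the convention for \<open>nterm\<close> at 0.\<close>
    have "(\<Sum>m\<in>{m. m \<noteq> 0 \<and> \<bar>m\<bar> < int N}. T k m) = (\<Sum>l<N. T k (int l) + T k (- int l))" for k N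
    proof (induction N)
      case 0
      have "{m :: int. m \<noteq> 0 \<and> \<bar>m\<bar> < int 0} = {}" by auto
      then show ?case by simp
    next
      case (Suc N)
      show ?case
      proof (cases "N = 0")
        case True
        then have "{m :: int. m \<noteq> 0 \<and> \<bar>m\<bar> < int (Suc N)} = {}" by auto
        then show ?thesis using True by (simp add: T_def nterm_def)
      next
        case False
        then have e: "{m :: int. m \<noteq> 0 \<and> \<bar>m\<bar> < int (Suc N)} =
             insert (int N) (insert (- int N) {m. m \<noteq> 0 \<and> \<bar>m\<bar> < int N})" by auto
        have fin: "finite {m :: int. m \<noteq> 0 \<and> \<bar>m\<bar> < int N}"
          by (rule finite_subset[of _ "{- int N..int N}"]) auto
        show ?thesis unfolding e using False fin Suc.IH by (simp add: algebra_simps)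
      qed
    qed
    then show ?thesis
      by (simp only: M_def sum_divide_distrib[symmetric])
  qed
  finally have "contour_integral (circlepath 0 R) (kernel z) = 2 * pi * \<i> * (residue (kernel z) 0 +
      (\<Sum>k<r+2. \<Sum>l<L k. T k (int l) + T k (- int l)) / (2 * pi * \<i>))" .
  moreover have "2 * pi * \<i> * (a + b / (2 * pi * \<i>)) = 2 * pi * \<i> * a + b" for a b :: complex
    by (simp add: field_simps)
  ultimately show ?thesis
    unfolding T_def L_def by (simp only:)
qed

text \<open>The denominator is at least \<open>exp S * (d / 2) ^ (r + 2)\<close> times
  \<open>norm t\<close>. At the centre c, \<open>Re (c * t)\<close> equals S minus half the sum of
  the \<open>\<bar>Re (\<omega> j * t)\<bar>\<close>, so the numerator loses
  \<open>exp (- \<mu> * norm t)\<close> against it. Moving z by at most \<mu>/2 from c gives back no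
  more than half of this.\<close>

lemma norm_kernel_le:
  assumes \<mu>: "\<And>t. \<mu> * norm t \<le> (\<Sum>j<r+2. \<bar>Re (\<omega> j * t)\<bar>) / 2"
    and z: "norm (z - (\<Sum>j<r+2. \<omega> j) / 2) \<le> \<mu> / 2"
    and d: "0 < d" "d \<le> 1" "\<And>j m. j < r + 2 \<Longrightarrow> d \<le> norm (\<omega> j * t - 2 * pi * \<i> * of_int m)"
    and t: "t \<noteq> 0"
  shows "norm (kernel z t) \<le> exp (- (\<mu> / 2 * norm t)) * (2 / d) ^ (r + 2) / norm t"
proof -
  define c where "c = (\<Sum>j<r+2. \<omega> j) / 2"
  define S where "S = (\<Sum>j<r+2. max 0 (Re (\<omega> j * t)))"
  have "exp S * (d / 2) ^ (r + 2) = (\<Prod>j<r+2. exp (max 0 (Re (\<omega> j * t))) * (d / 2))"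
    by (simp only: prod.distrib prod_constant card_lessThan S_def exp_sum finite_lessThan)
  also have "\<dots> \<le> (\<Prod>j<r+2. norm (exp (\<omega> j * t) - 1))"
    using d by (intro prod_mono conjI norm_exp_minus_1_ge) auto
  also have "\<dots> = norm (\<Prod>j<r+2. exp (\<omega> j * t) - 1)" by (rule prod_norm)
  finally have den: "exp S * (d / 2) ^ (r + 2) \<le> norm (\<Prod>j<r+2. exp (\<omega> j * t) - 1)" .
  have "Re (c * t) = (\<Sum>j<r+2. Re (\<omega> j * t) / 2)"
    unfolding c_def by (simp only: times_divide_eq_left sum_distrib_right Re_divide_numeral Re_sum sum_divide_distrib)
  also have "\<dots> = (\<Sum>j<r+2. max 0 (Re (\<omega> j * t)) - \<bar>Re (\<omega> j * t)\<bar> / 2)"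
    by (intro sum.cong refl) (simp add: max_def)
  also have "\<dots> = S - (\<Sum>j<r+2. \<bar>Re (\<omega> j * t)\<bar>) / 2"
    by (simp only: S_def sum_subtractf sum_divide_distrib)
  also have "\<dots> \<le> S - \<mu> * norm t" using \<mu>[of t] by simp
  finally have "Re (c * t) \<le> S - \<mu> * norm t" .
  moreover have "Re ((z - c) * t) \<le> \<mu> / 2 * norm t"
    using complex_Re_le_cmod[of "(z - c) * t"] mult_right_mono[OF z norm_ge_zero[of t]]
    unfolding norm_mult c_def by linarith
  moreover have "z * t = c * t + (z - c) * t" by (simp add: algebra_simps)
  ultimately have "Re (z * t) \<le> S - \<mu> / 2 * norm t" by simp
  then have num: "norm (exp (z * t)) \<le> exp S * exp (- (\<mu> / 2 * norm t))"
    by (simp add: exp_add[symmetric])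
  have "norm (kernel z t) = norm (exp (z * t)) / (norm t * norm (\<Prod>j<r+2. exp (\<omega> j * t) - 1))"
    by (simp only: kernel_def norm_divide norm_mult)
  also have "\<dots> \<le> exp S * exp (- (\<mu> / 2 * norm t)) / (norm t * (exp S * (d / 2) ^ (r + 2)))"
    by (intro frac_le num mult_left_mono den) (use t d in auto)
  also have "\<dots> = exp (- (\<mu> / 2 * norm t)) * (2 / d) ^ (r + 2) / norm t"
    by (simp add: field_simps)
  finally show ?thesis .
qed


text \<open>The contour integrals over the chosen circles are evaluated in two ways: they tend to 0
  by the kernel bound, and to the residue at 0 plus the full series by the residue theorem.\<close>

lemma sum_log_nish_eq:
  assumes \<mu>: "\<mu> > 0" "\<And>t. \<mu> * norm t \<le> (\<Sum>j<r+2. \<bar>Re (\<omega> j * t)\<bar>) / 2"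
    and z: "norm (z - (\<Sum>j<r+2. \<omega> j) / 2) \<le> \<mu> / 2"
    and s: "\<And>k. k < r + 2 \<Longrightarrow> (\<lambda>l. lterm z k (int l) +
              lterm z k (- int l)) sums s k"
  shows "2 * pi * \<i> * residue (kernel z) 0 + (\<Sum>k<r+2. s k) = 0"
proof -
  obtain D where D: "D \<ge> 1" and "\<forall>N::nat. \<exists>R. real N \<le> R \<and> R \<le> real N + 1 \<and>
           (\<forall>k<r+2. \<forall>m::nat. \<bar>R - 2 * pi * real m / norm (\<omega> k)\<bar> \<ge> 1 / (D * (real N + 1)))"
    using exists_radii_avoiding_poles[of "r + 2" \<omega>] nz by blast
  then obtain R where R: "\<And>N::nat. real N \<le> R N" "\<And>N::nat. R N \<le> real N + 1"
      "\<And>N k (m::nat). k < r + 2 \<Longrightarrow> \<bar>R N - 2 * pi * real m / norm (\<omega> k)\<bar> \<ge> 1 / (D * (real N + 1))"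
    by metis
  have gpos: "1 / (D * (real N + 1)) > 0" for N using D by simp
  have Rpos: "R N > 0" for N
  proof -
    \<comment> \<open>For N = 0 the bound \<open>real N \<le> R N\<close> does not exclude radius 0;
      the avoided value with m = 0 does.\<close>
    have "1 / (D * (real N + 1)) \<le> \<bar>R N\<bar>" using R(3)[of 0 N 0] by simp
    with R(1)[of N] gpos[of N] show ?thesis by linarith
  qed
  define w where "w = Min (insert 1 ((\<lambda>j. norm (\<omega> j)) ` {..<r+2}))"
  have w: "0 < w" "w \<le> 1" "\<And>j. j < r + 2 \<Longrightarrow> w \<le> norm (\<omega> j)"
    unfolding w_def using nz by (auto intro!: Min_le)
  define K where "K = 2 * D / w"
  have bound: "norm (contour_integral (circlepath 0 (R N)) (kernel z)) \<le>
                 2 * pi * exp (- (\<mu> / 2 * real N)) * (K * (real N + 1)) ^ (r + 2)" for N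
  proof -
    \<comment> \<open>The radial gap is turned into a distance of \<open>\<omega> j * t\<close> from
      the multiples of 2 pi i; the scaling by \<open>norm (\<omega> j)\<close> costs at most the
      factor w, which is capped at 1 to keep d at most 1.\<close>
    define d where "d = w / (D * (real N + 1))"
    have DN: "D * (real N + 1) \<ge> 1" using mult_mono[of 1 D 1 "real N + 1"] D by simp
    have d01: "0 < d" "d \<le> 1" using w DN by (auto simp: d_def divide_le_eq)
    have dle: "d \<le> norm (\<omega> j * t - 2 * pi * \<i> * of_int m)" if t: "norm t = R N" "j < r + 2" for t j m
    proof -
      have pos: "norm (\<omega> j) > 0" using nz[OF t(2)] by simp
      have "d = w * (1 / (D * (real N + 1)))" by (simp add: d_def)
      also have "\<dots> \<le> norm (\<omega> j) * \<bar>R N - 2 * pi * real (nat \<bar>m\<bar>) / norm (\<omega> j)\<bar>"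
        by (intro mult_mono w R t less_imp_le[OF gpos]) auto
      also have "\<dots> = \<bar>norm (\<omega> j) * (R N - 2 * pi * real (nat \<bar>m\<bar>) / norm (\<omega> j))\<bar>"
        by (simp add: abs_mult)
      also have "norm (\<omega> j) * (R N - 2 * pi * real (nat \<bar>m\<bar>) / norm (\<omega> j)) =
                 norm (\<omega> j * t) - norm (2 * pi * \<i> * of_int m)"
        using pos t by (simp add: norm_mult field_simps)
      also have "\<bar>\<dots>\<bar> \<le> norm (\<omega> j * t - 2 * pi * \<i> * of_int m)"
        by (rule norm_triangle_ineq3)
      finally show ?thesis .
    qed
    have "continuous_on (path_image (circlepath 0 (R N))) (kernel z)"
      unfolding kernel_def
    proof (intro continuous_intros ballI)
      fix t assume "t \<in> path_image (circlepath 0 (R N))"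
      then have t: "norm t = R N" using Rpos[of N] by (simp add: path_image_circlepath)
      have "exp (\<omega> j * t) - 1 \<noteq> 0" if "j < r + 2" for j
      proof -
        have "0 < exp (max 0 (Re (\<omega> j * t))) * (d / 2)" using d01 by simp
        also have "\<dots> \<le> norm (exp (\<omega> j * t) - 1)"
          using d01 dle[OF t that] by (intro norm_exp_minus_1_ge) auto
        finally show ?thesis by simp
      qed
      moreover have "t \<noteq> 0" using t Rpos[of N] by auto
      ultimately show "t * (\<Prod>j<r+2. exp (\<omega> j * t) - 1) \<noteq> 0"
        by (simp only: mult_eq_0_iff prod_zero_iff finite_lessThan) auto
    qed
    then have ci: "(kernel z has_contour_integral contour_integral (circlepath 0 (R N)) (kernel z)) (circlepath 0 (R N))"
      by (intro has_contour_integral_integral contour_integrable_continuous_circlepath)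
    have "norm (contour_integral (circlepath 0 (R N)) (kernel z)) \<le>
            (exp (- (\<mu> / 2 * R N)) * (2 / d) ^ (r + 2) / R N) * (2 * pi * R N)"
    proof (rule has_contour_integral_bound_circlepath[OF ci])
      fix t :: complex assume "norm (t - 0) = R N"
      then have t: "norm t = R N" by simp
      show "norm (kernel z t) \<le> exp (- (\<mu> / 2 * R N)) * (2 / d) ^ (r + 2) / R N"
      proof -
        have "t \<noteq> 0" using t Rpos[of N] by auto
        from norm_kernel_le[OF \<mu>(2) z d01 dle[OF t] this] show ?thesis unfolding t by simp
      qed
    qed (use Rpos[of N] d01 in auto)
    also have "\<dots> = 2 * pi * exp (- (\<mu> / 2 * R N)) * (2 / d) ^ (r + 2)"
      using Rpos[of N] by (simp add: field_simps)
    also have "\<dots> \<le> 2 * pi * exp (- (\<mu> / 2 * real N)) * (2 / d) ^ (r + 2)"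
      using R(1)[of N] \<mu>(1) d01 by (intro mult_right_mono mult_left_mono) auto
    also have "2 / d = K * (real N + 1)" by (simp add: d_def K_def)
    finally show ?thesis .
  qed
  have lim0: "(\<lambda>N. contour_integral (circlepath 0 (R N)) (kernel z)) \<longlonglongrightarrow> 0"
  proof (rule Lim_null_comparison)
    show "\<forall>\<^sub>F N in sequentially. norm (contour_integral (circlepath 0 (R N)) (kernel z)) \<le>
            2 * pi * exp (- (\<mu> / 2 * real N)) * (K * (real N + 1)) ^ (r + 2)"
      using bound by simp
    \<comment> \<open>The bound is rewritten in the single variable
      \<open>\<mu> / 2 * (N + 1)\<close> as a power over an exponential; the constant
      \<open>exp (\<mu> / 2)\<close> makes up for the step from N to N + 1.\<close>
    have "filterlim (\<lambda>N::nat. \<mu> / 2 * (real N + 1)) at_top sequentially"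
      using \<mu>(1) by (intro filterlim_tendsto_pos_mult_at_top[OF tendsto_const])
         (auto simp: add.commute intro!: filterlim_tendsto_add_at_top[OF tendsto_const] filterlim_real_sequentially)
    then have "(\<lambda>N::nat. (\<mu> / 2 * (real N + 1)) ^ (r + 2) / exp (\<mu> / 2 * (real N + 1))) \<longlonglongrightarrow> 0"
      by (rule filterlim_compose[OF tendsto_power_div_exp_0])
    then have "(\<lambda>N::nat. 2 * pi * exp (\<mu> / 2) * (2 * K / \<mu>) ^ (r + 2) *
         ((\<mu> / 2 * (real N + 1)) ^ (r + 2) / exp (\<mu> / 2 * (real N + 1)))) \<longlonglongrightarrow> 2 * pi * exp (\<mu> / 2) * (2 * K / \<mu>) ^ (r + 2) * 0"
      by (rule tendsto_mult_left)
    moreover have "2 * pi * exp (\<mu> / 2) * (2 * K / \<mu>) ^ (r + 2) *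
         ((\<mu> / 2 * (real N + 1)) ^ (r + 2) / exp (\<mu> / 2 * (real N + 1))) =
         2 * pi * exp (- (\<mu> / 2 * real N)) * (K * (real N + 1)) ^ (r + 2)" for N
    proof -
      have e1: "(2 * K / \<mu>) ^ (r + 2) * (\<mu> / 2 * (real N + 1)) ^ (r + 2) = (K * (real N + 1)) ^ (r + 2)"
        unfolding power_mult_distrib[symmetric] using \<mu>(1) by simp
      have e2: "exp (\<mu> / 2) / exp (\<mu> / 2 * (real N + 1)) = exp (- (\<mu> / 2 * real N))"
        unfolding exp_diff[symmetric] by (simp add: algebra_simps)
      show ?thesis unfolding e1[symmetric] e2[symmetric] by (simp only: times_divide_eq_left times_divide_eq_right mult_ac)
    qed
    ultimately show "(\<lambda>N. 2 * pi * exp (- (\<mu> / 2 * real N)) * (K * (real N + 1)) ^ (r + 2)) \<longlonglongrightarrow> 0"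
      by simp
  qed
  have "(\<lambda>N. 2 * pi * \<i> * residue (kernel z) 0 +
    (\<Sum>k<r+2. \<Sum>l<nat \<lceil>R N * norm (\<omega> k) / (2 * pi)\<rceil>.
       lterm z k (int l) + lterm z k (- int l)))
    \<longlonglongrightarrow> 2 * pi * \<i> * residue (kernel z) 0 + (\<Sum>k<r+2. s k)"
  proof (intro tendsto_add tendsto_const tendsto_sum)
    fix k assume "k \<in> {..<r+2}"
    then have k: "k < r + 2" by simp
    then have pos: "norm (\<omega> k) / (2 * pi) > 0" using nz by simp
    have "filterlim (\<lambda>N. nat \<lceil>R N * norm (\<omega> k) / (2 * pi)\<rceil>) at_top sequentially"
    proof (rule filterlim_compose[OF filterlim_nat_sequentially])
      have "filterlim (\<lambda>N. norm (\<omega> k) / (2 * pi) * R N) at_top sequentially"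
        by (rule filterlim_tendsto_pos_mult_at_top[OF tendsto_const pos])
           (rule filterlim_at_top_mono[OF filterlim_real_sequentially], use R(1) in simp)
      then have lim: "filterlim (\<lambda>N. R N * norm (\<omega> k) / (2 * pi)) at_top sequentially"
        by (simp add: mult.commute)
      show "filterlim (\<lambda>N. \<lceil>R N * norm (\<omega> k) / (2 * pi)\<rceil>) at_top sequentially"
        unfolding filterlim_at_top
      proof
        fix Z :: int
        have "\<forall>\<^sub>F N in sequentially. of_int Z \<le> R N * norm (\<omega> k) / (2 * pi)"
          using lim unfolding filterlim_at_top by blast
        then show "\<forall>\<^sub>F N in sequentially. Z \<le> \<lceil>R N * norm (\<omega> k) / (2 * pi)\<rceil>"
          by eventually_elim linarith
      qed
    qed
    then show "(\<lambda>N. \<Sum>l<nat \<lceil>R N * norm (\<omega> k) / (2 * pi)\<rceil>.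
        lterm z k (int l) + lterm z k (- int l))
        \<longlonglongrightarrow> s k"
      using filterlim_compose[OF s[OF k, unfolded sums_def]] by blast
  qed
  then have "(\<lambda>N. contour_integral (circlepath 0 (R N)) (kernel z)) \<longlonglongrightarrow>
               2 * pi * \<i> * residue (kernel z) 0 + (\<Sum>k<r+2. s k)"
    by (subst contour_integral_kernel[OF Rpos gpos R(3)]) auto
  with lim0 show ?thesis by (blast intro: LIMSEQ_unique)
qed

text \<open>On the disc of radius \<mu>/2 around c all r + 2 logarithmic series converge at once, so
  the residue identity applies there; both sides are meromorphic in z.\<close>

theorem narukawa_modular:
  "eventually (\<lambda>z. (\<Prod>k<r+2. nishG r (\<lambda>j. del_fam k \<omega> j / \<omega> k) (z / \<omega> k)) =
     exp (- 2 * pi * \<i> * bstar (r + 2) (r + 2) z \<omega> / (fact (r + 2) * (\<Prod>j<r+2. \<omega> j)))) (cosparse UNIV)"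
proof -
  obtain \<mu> where \<mu>: "\<mu> > 0" "\<And>t. \<mu> * norm t \<le> (\<Sum>j<r+2. \<bar>Re (\<omega> j * t)\<bar>) / 2"
    using sum_abs_Re_ge[of "r + 2" \<omega>] ratio by auto
  define c where "c = (\<Sum>j<r+2. \<omega> j) / 2"
  show ?thesis
  proof (rule meromorphic_eq_cosparse[where U = "ball c (\<mu> / 2)"])
    have Im_nz: "Im (del_fam k \<omega> j / \<omega> k) \<noteq> 0" if "k < r + 2" "j \<le> r" for k j
      using ratio[of "if j < k then j else Suc j" k] that
      by (auto simp: del_fam_def complex_is_Real_iff split: if_splits)
    show "(\<lambda>z. \<Prod>k<r+2. nishG r (\<lambda>j. del_fam k \<omega> j / \<omega> k) (z / \<omega> k)) meromorphic_on UNIV"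
    proof (intro meromorphic_on_prod)
      fix k assume "k \<in> {..<r+2}"
      then have "nishG r (\<lambda>j. del_fam k \<omega> j / \<omega> k) meromorphic_on UNIV"
        by (intro meromorphic_nishG Im_nz) auto
      then show "(\<lambda>z. nishG r (\<lambda>j. del_fam k \<omega> j / \<omega> k) (z / \<omega> k)) meromorphic_on UNIV"
        by (rule meromorphic_on_compose) (use nz \<open>k \<in> {..<r+2}\<close> in \<open>auto intro!: analytic_intros\<close>)
    qed
    show "(\<lambda>z. exp (- 2 * pi * \<i> * bstar (r + 2) (r + 2) z \<omega> / (fact (r + 2) * (\<Prod>j<r+2. \<omega> j)))) meromorphic_on UNIV"
      using nz unfolding divide_inverse
      by (intro analytic_on_imp_meromorphic_on, subst analytic_on_open)
         (auto simp del: fact_Suc prod.lessThan_Suc intro!: holomorphic_intros holomorphic_bstar)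
    show "open (ball c (\<mu> / 2))" "ball c (\<mu> / 2) \<noteq> {}" using \<mu> by auto
    fix z assume "z \<in> ball c (\<mu> / 2)"
    then have z: "norm (z - c) < \<mu> / 2" by (simp add: dist_norm norm_minus_commute)
    have "\<exists>s. (\<lambda>l. lterm z k (int l) +
                lterm z k (- int l)) sums s \<and>
              nishG r (\<lambda>j. del_fam k \<omega> j / \<omega> k) (z / \<omega> k) = exp s" if k: "k < r + 2" for k
    proof (rule nishG_eq_exp)
      let ?\<tau> = "\<lambda>j. del_fam k \<omega> j / \<omega> k"
      \<comment> \<open>The index k missing from \<open>del_fam k \<omega>\<close> may be added,
        since its ratio is 1 and has imaginary part 0. This makes the strip bounds symmetric in all
        periods.\<close>
      have sum_eq: "(\<Sum>j\<le>r. h (Im (?\<tau> j))) = (\<Sum>j<r+2. h (Im (\<omega> j / \<omega> k)))" if "h 0 = 0" for h :: "real \<Rightarrow> real"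
      proof -
        have "(\<Sum>j<r+2. h (Im (\<omega> j / \<omega> k))) = h (Im (\<omega> k / \<omega> k)) + (\<Sum>j\<in>{..<r+2} - {k}. h (Im (\<omega> j / \<omega> k)))"
          using k by (intro sum.remove) auto
        also have "h (Im (\<omega> k / \<omega> k)) = 0" using nz[OF k] that by simp
        also have "(\<Sum>j\<in>{..<r+2} - {k}. h (Im (\<omega> j / \<omega> k))) = (\<Sum>j\<le>r. h (Im (?\<tau> j)))"
          using k sum_del_fam[of k r "\<lambda>v. h (Im (v / \<omega> k))" \<omega>] by simp
        finally show ?thesis by simp
      qed
      \<comment> \<open>Evaluating the decay inequality at \<open>t = - \<i> / \<omega> k\<close>
        turns real parts into the imaginary parts of the ratios: half the width of the k-th strip is
        at least \<open>\<mu> / norm (\<omega> k)\<close>.\<close>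
      have "\<mu> * norm (- \<i> / \<omega> k) \<le> (\<Sum>j<r+2. \<bar>Re (\<omega> j * (- \<i> / \<omega> k))\<bar>) / 2" by (rule \<mu>)
      also have "(\<Sum>j<r+2. \<bar>Re (\<omega> j * (- \<i> / \<omega> k))\<bar>) = (\<Sum>j<r+2. \<bar>Im (\<omega> j / \<omega> k)\<bar>)"
      proof (intro sum.cong refl)
        fix j
        have "\<omega> j * (- \<i> / \<omega> k) = - \<i> * (\<omega> j / \<omega> k)" by simp
        moreover have "Re (- \<i> * y) = Im y" for y by simp
        ultimately show "\<bar>Re (\<omega> j * (- \<i> / \<omega> k))\<bar> = \<bar>Im (\<omega> j / \<omega> k)\<bar>" by (simp only:)
      qed
      finally have m1: "\<mu> / norm (\<omega> k) \<le> (\<Sum>j<r+2. \<bar>Im (\<omega> j / \<omega> k)\<bar>) / 2"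
        by (simp add: norm_divide)
      have "\<bar>Im ((z - c) / \<omega> k)\<bar> \<le> norm ((z - c) / \<omega> k)" by (rule abs_Im_le_cmod)
      also have "\<dots> < \<mu> / norm (\<omega> k)"
        unfolding norm_divide using z \<mu>(1) nz[OF k] by (intro divide_strict_right_mono) auto
      finally have m2: "\<bar>Im ((z - c) / \<omega> k)\<bar> < (\<Sum>j<r+2. \<bar>Im (\<omega> j / \<omega> k)\<bar>) / 2" using m1 by linarith
      have "Im (c / \<omega> k) = (\<Sum>j<r+2. Im (\<omega> j / \<omega> k)) / 2"
        unfolding c_def by (simp only: divide_divide_eq_left mult.commute[of 2] divide_divide_eq_left[symmetric]
          sum_divide_distrib[of _ _ "\<omega> k"] Im_divide_numeral Im_sum)
      moreover have "z / \<omega> k = c / \<omega> k + (z - c) / \<omega> k" by (simp add: diff_divide_distrib)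
      ultimately have Imz: "Im (z / \<omega> k) = (\<Sum>j<r+2. Im (\<omega> j / \<omega> k)) / 2 + Im ((z - c) / \<omega> k)" by simp
      have mm: "min 0 y = (y - \<bar>y\<bar>) / 2" "max 0 y = (y + \<bar>y\<bar>) / 2" for y :: real by auto
      have arith1: "(A - B) / 2 < A / 2 + a" if "\<bar>a\<bar> < B / 2" for A B a :: real
        using that by (simp add: field_simps abs_less_iff)
      have arith2: "A / 2 + a < (A + B) / 2" if "\<bar>a\<bar> < B / 2" for A B a :: real
        using that by (simp add: field_simps abs_less_iff)
      show "(\<Sum>j\<le>r. min 0 (Im (?\<tau> j))) < Im (z / \<omega> k)"
        unfolding sum_eq[of "min 0", OF min.idem] unfolding Imz mm sum_divide_distrib[symmetric] sum_subtractf
        by (rule arith1[OF m2])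
      show "Im (z / \<omega> k) < (\<Sum>j\<le>r. max 0 (Im (?\<tau> j)))"
        unfolding sum_eq[of "max 0", OF max.idem] unfolding Imz mm sum_divide_distrib[symmetric] sum.distrib
        by (rule arith2[OF m2])
    qed (use Im_nz k in auto)
    then have "\<forall>k\<in>{..<r+2}. \<exists>s. (\<lambda>l. lterm z k (int l) +
                lterm z k (- int l)) sums s \<and>
              nishG r (\<lambda>j. del_fam k \<omega> j / \<omega> k) (z / \<omega> k) = exp s"
      by (simp only: lessThan_iff Ball_def) simp
    from bchoice[OF this] obtain s where s: "\<And>k. k < r + 2 \<Longrightarrow> (\<lambda>l. lterm z k (int l) +
                lterm z k (- int l)) sums s k"
       "\<And>k. k < r + 2 \<Longrightarrow> nishG r (\<lambda>j. del_fam k \<omega> j / \<omega> k) (z / \<omega> k) = exp (s k)"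
      by (simp only: lessThan_iff Ball_def) auto
    have "(\<Prod>k<r+2. nishG r (\<lambda>j. del_fam k \<omega> j / \<omega> k) (z / \<omega> k)) = (\<Prod>k<r+2. exp (s k))"
      by (rule prod.cong[OF refl], rule s(2)) (simp only: lessThan_iff)
    also have "\<dots> = exp (\<Sum>k<r+2. s k)" by (simp only: exp_sum finite_lessThan)
    also have "(\<Sum>k<r+2. s k) = - (2 * pi * \<i> * residue (kernel z) 0)"
    proof -
      have "norm (z - (\<Sum>j<r+2. \<omega> j) / 2) \<le> \<mu> / 2" using less_imp_le[OF z] by (simp only: c_def)
      from sum_log_nish_eq[OF \<mu> this s(1)] show ?thesis by (simp only: add_eq_0_iff)
    qed
    also have "\<dots> = - 2 * pi * \<i> * bstar (r + 2) (r + 2) z \<omega> / (fact (r + 2) * (\<Prod>j<r+2. \<omega> j))"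
    proof -
      have "- (2 * pi * \<i> * (b / d)) = - 2 * pi * \<i> * b / d" for b d :: complex by simp
      then show ?thesis unfolding residue_kernel_0 by (simp only:)
    qed
    finally show "(\<Prod>k<r+2. nishG r (\<lambda>j. del_fam k \<omega> j / \<omega> k) (z / \<omega> k)) =
       exp (- 2 * pi * \<i> * bstar (r + 2) (r + 2) z \<omega> / (fact (r + 2) * (\<Prod>j<r+2. \<omega> j)))" .
  qed
qed

end

subsection \<open>Dual families and primitive vectors\<close>

lemma lat_iff: "v \<in> lat n \<longleftrightarrow> (\<forall>i\<ge>n. v i = 0)"
  by (simp add: lat_def)

lemma lat_zero [simp]: "(\<lambda>i. 0) \<in> lat n"
  by (simp add: lat_def)

lemma lat_add: "u \<in> lat n \<Longrightarrow> v \<in> lat n \<Longrightarrow> (\<lambda>i. u i + v i) \<in> lat n"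
  by (simp add: lat_def)

lemma lat_diff: "u \<in> lat n \<Longrightarrow> v \<in> lat n \<Longrightarrow> (\<lambda>i. u i - v i) \<in> lat n"
  by (simp add: lat_def)

lemma lat_scale: "v \<in> lat n \<Longrightarrow> (\<lambda>i. k * v i) \<in> lat n"
  by (simp add: lat_def)

lemma lat_sum: "(\<And>j. j \<in> A \<Longrightarrow> f j \<in> lat n) \<Longrightarrow> (\<lambda>i. \<Sum>j\<in>A. f j i) \<in> lat n"
  by (simp add: lat_def)

lemmas lat_intros = lat_add lat_diff lat_scale lat_sum

lemma lat_eqI: "u \<in> lat n \<Longrightarrow> v \<in> lat n \<Longrightarrow> (\<And>i. i < n \<Longrightarrow> u i = v i) \<Longrightarrow> u = v"
  by (rule ext) (metis lat_iff not_le)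

lemma pair_add: "pair n (\<lambda>i. u i + v i) c = pair n u c + pair n v c"
  by (simp add: pair_def algebra_simps sum.distrib)

lemma pair_diff: "pair n (\<lambda>i. u i - v i) c = pair n u c - pair n v c"
  by (simp add: pair_def algebra_simps sum_subtractf)

lemma pair_scale: "pair n (\<lambda>i. k * v i) c = k * pair n v c"
  by (simp add: pair_def algebra_simps sum_distrib_left)

lemma pair_sum: "pair n (\<lambda>i. \<Sum>j\<in>A. f j i) c = (\<Sum>j\<in>A. pair n (f j) c)"
  unfolding pair_def sum_distrib_right by (rule sum.swap)

lemmas pair_linear = pair_add pair_diff pair_scale pair_sum

lemma pair_zero [simp]: "pair n (\<lambda>i. 0) c = 0"
  by (simp add: pair_def)

lemma pair_ext:
  assumes "u \<in> lat n" "v \<in> lat n" "\<And>c. c \<in> lat n \<Longrightarrow> pair n u c = pair n v c"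
  shows "u = v"
proof (rule lat_eqI[OF assms(1,2)])
  fix i assume i: "i < n"
  have p: "pair n w (\<lambda>l. if l = i then 1 else 0) = w i" for w
  proof -
    have "pair n w (\<lambda>l. if l = i then 1 else 0) = (\<Sum>l<n. if l = i then w i else 0)"
      unfolding pair_def by (rule sum.cong) auto
    then show ?thesis using i by simp
  qed
  have "(\<lambda>l. if l = i then 1 else 0) \<in> lat n" using i by (auto simp: lat_def)
  from assms(3)[OF this] show "u i = v i" unfolding p .
qed

lemma primitive_lat: "primitive n v \<Longrightarrow> v \<in> lat n"
  by (simp add: primitive_def)

lemma primitiveD: "primitive n v \<Longrightarrow> u \<in> lat n \<Longrightarrow> v = (\<lambda>i. k * u i) \<Longrightarrow> k = 1 \<or> k = - 1"
  unfolding primitive_def by blast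

lemma primitive_uminus: "primitive n v \<Longrightarrow> primitive n (\<lambda>i. - v i)"
  unfolding primitive_def
proof (intro conjI allI ballI impI; elim conjE)
  assume v: "v \<in> lat n" and prim: "\<forall>k. \<forall>u\<in>lat n. v = (\<lambda>i. k * u i) \<longrightarrow> k = 1 \<or> k = - 1"
  show "(\<lambda>i. - v i) \<in> lat n" using v by (simp add: lat_def)
  fix k u assume u: "u \<in> lat n" and eq: "(\<lambda>i. - v i) = (\<lambda>i. k * u i)"
  have "v = (\<lambda>i. (- k) * u i)"
  proof
    fix i
    have "k * u i = - v i" using fun_cong[OF eq, of i] by simp
    then show "v i = (- k) * u i" by simp
  qed
  then have "- k = 1 \<or> - k = - 1" using prim u by blast
  then show "k = 1 \<or> k = - 1" by auto
qed

lemma primitive_nonzero: "primitive n v \<Longrightarrow> v \<noteq> (\<lambda>i. 0)"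
  unfolding primitive_def by (metis lat_zero mult_zero_left zero_neq_one zero_neq_neg_one)

text \<open>The factor d is the gcd of the coordinates.\<close>

lemma primitive_decomposition:
  assumes v: "v \<in> lat n" "v \<noteq> (\<lambda>i. 0)"
  shows "\<exists>d u. d > 0 \<and> primitive n u \<and> v = (\<lambda>i. d * u i)"
proof -
  define d where "d = Gcd (v ` {..<n})"
  obtain i0 where i0: "v i0 \<noteq> 0" using v(2) by auto
  then have "i0 < n" using v(1) by (metis lat_iff not_le)
  have dv: "d dvd v i" for i
    using v(1) by (cases "i < n") (auto simp: d_def lat_iff)
  have "d \<noteq> 0" using dv[of i0] i0 by auto
  moreover have "d \<ge> 0" by (simp add: d_def)
  ultimately have d: "d > 0" by simp
  define u where "u i = v i div d" for i
  have vu: "v = (\<lambda>i. d * u i)" using dv by (simp add: u_def)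
  have "u \<in> lat n" using v(1) by (auto simp: lat_iff u_def)
  moreover have "k = 1 \<or> k = - 1" if "u' \<in> lat n" "u = (\<lambda>i. k * u' i)" for k u'
  proof -
    have "d * k dvd v i" for i using vu that(2) by (metis dvd_triv_left mult.assoc)
    then have "d * k dvd d" unfolding d_def by (intro Gcd_greatest) auto
    then have "k dvd 1" using d by (metis dvd_mult_cancel_left mult.right_neutral less_irrefl)
    then show ?thesis by auto
  qed
  ultimately have "primitive n u" by (auto simp: primitive_def)
  with d vu show ?thesis by blast
qed

text \<open>After reducing p and q to lowest terms, the reduced p divides every coordinate of
  \<gamma> and is therefore a unit.\<close>

lemma primitive_multiple:
  assumes \<gamma>: "primitive n \<gamma>" and p: "p \<noteq> 0" and eq: "\<And>i. p * \<delta> i = q * \<gamma> i"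
  shows "\<exists>k. \<delta> = (\<lambda>i. k * \<gamma> i)"
proof -
  define g where "g = gcd p q"
  obtain p' q' where p'q': "p = p' * g" "q = q' * g" "coprime p' q'"
    using gcd_coprime_exists[of p q] p unfolding g_def by auto
  have g: "g \<noteq> 0" using p p'q' by auto
  have eq': "p' * \<delta> i = q' * \<gamma> i" for i
    using eq[of i] g unfolding p'q' by (simp add: mult_ac)
  have "p' dvd \<gamma> i" for i
    using eq'[of i] p'q'(3) by (metis coprime_dvd_mult_right_iff dvd_triv_left)
  then have \<gamma>_eq: "\<gamma> = (\<lambda>i. p' * (\<gamma> i div p'))" by auto
  have "(\<lambda>i. \<gamma> i div p') \<in> lat n"
    using primitive_lat[OF \<gamma>] by (auto simp: lat_iff)
  then have "p' = 1 \<or> p' = - 1" using \<gamma>_eq by (rule primitiveD[OF \<gamma>])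
  then have "p' * p' = 1" by auto
  then have "\<delta> = (\<lambda>i. (p' * q') * \<gamma> i)" using eq' by (metis mult.assoc mult_1)
  then show ?thesis by blast
qed

text \<open>Proportional primitive vectors agree up to sign, and the positive factors fix the sign.
  This is the source of the uniqueness of \<gamma> and of the primitive dual family.\<close>

lemma primitive_unique:
  assumes "primitive n \<gamma>" "primitive n \<delta>" "p > 0" "q > 0" "\<And>i. p * \<delta> i = q * \<gamma> i"
  shows "\<delta> = \<gamma>"
proof -
  obtain k where k: "\<delta> = (\<lambda>i. k * \<gamma> i)"
    using primitive_multiple[OF assms(1) _ assms(5)] assms(3) by auto
  have "k = 1 \<or> k = - 1"
    by (rule primitiveD[OF assms(2) primitive_lat[OF assms(1)] k])
  moreover obtain i where "\<gamma> i \<noteq> 0" using primitive_nonzero[OF assms(1)] by auto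
  moreover have "p * k * \<gamma> i = q * \<gamma> i" for i using assms(5)[of i] k by (simp add: mult_ac)
  ultimately have "p * k = q" by (metis mult_cancel_right)
  with \<open>k = 1 \<or> k = - 1\<close> assms(3,4) have "k = 1" by auto
  with k show ?thesis by simp
qed

lemma mat_vec_zero_iff:
  assumes "v \<in> carrier_vec n"
  shows "mat n n (\<lambda>(i, j). f i j) *\<^sub>v v = 0\<^sub>v n \<longleftrightarrow> (\<forall>i<n. (\<Sum>k<n. f i k * vec_index v k) = 0)"
  using assms by (auto simp: vec_eq_iff scalar_prod_def lessThan_atLeast0)

lemma detf_nonzero:
  assumes "lin_indep n n a"
  shows "detf n a \<noteq> 0"
proof
  assume "detf n a = 0"
  then obtain v where v: "v \<in> carrier_vec n" "v \<noteq> 0\<^sub>v n" "\<forall>i<n. (\<Sum>k<n. a k i * vec_index v k) = 0"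
    unfolding detf_def by (subst (asm) det_0_iff_vec_prod_zero[of _ n]) (auto simp: mat_vec_zero_iff)
  then have "\<forall>k<n. vec_index v k = 0"
    using assms unfolding lin_indep_def by (auto simp: mult.commute dest: spec[of _ "\<lambda>k. vec_index v k"])
  with v(1,2) show False by (auto simp: vec_eq_iff)
qed

lemma pair_nondegenerate:
  assumes "detf n a \<noteq> 0" "\<delta> \<in> lat n" "\<And>k. k < n \<Longrightarrow> pair n \<delta> (a k) = 0"
  shows "\<delta> = (\<lambda>i. 0)"
proof (rule ccontr)
  assume "\<delta> \<noteq> (\<lambda>i. 0)"
  then obtain i where i: "\<delta> i \<noteq> 0" by auto
  then have "i < n" using assms(2) by (metis lat_iff not_le)
  define A where "A = mat n n (\<lambda>(i, j). a j i)"
  have tr: "transpose_mat A = mat n n (\<lambda>(i, j). a i j)" by (auto simp: A_def)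
  have "det (transpose_mat A) = 0"
    unfolding tr
  proof (subst det_0_iff_vec_prod_zero[of _ n], simp, intro exI[of _ "vec n \<delta>"] conjI)
    show "vec n \<delta> \<noteq> 0\<^sub>v n" using i \<open>i < n\<close> by (auto simp: vec_eq_iff)
    show "mat n n (\<lambda>(i, j). a i j) *\<^sub>v vec n \<delta> = 0\<^sub>v n"
      using assms(3) by (subst mat_vec_zero_iff) (auto simp: pair_def mult.commute)
  qed auto
  then have "det A = 0" by (subst (asm) det_transpose[of _ n]) (auto simp: A_def)
  with assms(1) show False by (simp add: detf_def A_def)
qed

text \<open>The rows of the adjugate matrix pair with the columns to the determinant or to 0;
  multiplying by the sign of the determinant makes the diagonal positive.\<close>

lemma dual_family_exists:
  assumes "detf n a \<noteq> 0"
  shows "\<exists>\<rho>. \<forall>j<n. \<rho> j \<in> lat n \<and> (\<forall>k<n. pair n (\<rho> j) (a k) = (if j = k then \<bar>detf n a\<bar> else 0))"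
proof -
  define A where "A = mat n n (\<lambda>(i, j). a j i)"
  have A: "A \<in> carrier_mat n n" by (simp add: A_def)
  define \<rho> where "\<rho> j i = (if i < n then sgn (detf n a) * adj_mat A $$ (j, i) else 0)" for j i
  have "pair n (\<rho> j) (a k) = (if j = k then \<bar>detf n a\<bar> else 0)" if "j < n" "k < n" for j k
  proof -
    have "pair n (\<rho> j) (a k) = sgn (detf n a) * (\<Sum>i<n. adj_mat A $$ (j, i) * A $$ (i, k))"
      using that by (simp add: pair_def \<rho>_def A_def sum_distrib_left mult_ac)
    also have "(\<Sum>i<n. adj_mat A $$ (j, i) * A $$ (i, k)) = (adj_mat A * A) $$ (j, k)"
      using that A adj_mat(1)[OF A] by (simp add: scalar_prod_def lessThan_atLeast0)
    also have "\<dots> = (if j = k then detf n a else 0)"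
      unfolding adj_mat(3)[OF A] using that by (auto simp: detf_def A_def)
    finally show ?thesis by (auto simp: abs_sgn mult.commute)
  qed
  moreover have "\<rho> j \<in> lat n" for j by (simp add: \<rho>_def lat_def)
  ultimately show ?thesis by blast
qed

text \<open>Every nonzero vector orthogonal to \<open>a\<^sub>0, \<dots>, a\<^sub>r\<close> complements the family, since it is orthogonal
  to its span but not to itself.\<close>
lemma lin_indep_extend:
  assumes "lin_indep (r + 2) (r + 1) a"
  shows "\<exists>u\<in>lat (r + 2). detf (r + 2) (\<lambda>k. if k \<le> r then a k else u) \<noteq> 0"
proof -
  \<comment> \<open>The family padded by a zero column is singular, hence so is its transpose, and a
    kernel vector of the transpose is orthogonal to all \<open>a k\<close>.\<close>
  define B where "B = mat (r + 2) (r + 2) (\<lambda>(i, j). if j \<le> r then a j i else 0)"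
  have trB: "transpose_mat B = mat (r + 2) (r + 2) (\<lambda>(i, j). if i \<le> r then a i j else 0)"
    by (auto simp: B_def)
  have "det B = 0"
    unfolding B_def
  proof (subst det_0_iff_vec_prod_zero[of _ "r + 2"], simp, intro exI[of _ "unit_vec (r + 2) (r + 1)"] conjI)
    show "unit_vec (r + 2) (r + 1) \<noteq> (0\<^sub>v (r + 2) :: int vec)" by (auto simp: vec_eq_iff)
    show "mat (r + 2) (r + 2) (\<lambda>(i, j). if j \<le> r then a j i else 0) *\<^sub>v unit_vec (r + 2) (r + 1) = 0\<^sub>v (r + 2)"
      by (subst mat_vec_zero_iff) (auto intro!: sum.neutral simp: unit_vec_def)
  qed auto
  then have "det (transpose_mat B) = 0" by (subst det_transpose[of _ "r + 2"]) (auto simp: B_def)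
  then obtain v where v: "v \<in> carrier_vec (r + 2)" "v \<noteq> 0\<^sub>v (r + 2)"
      "\<forall>i<r+2. (\<Sum>k<r+2. (if i \<le> r then a i k else 0) * vec_index v k) = 0"
    unfolding trB by (subst (asm) det_0_iff_vec_prod_zero[of _ "r + 2"]) (auto simp: mat_vec_zero_iff)
  define u where "u i = (if i < r + 2 then vec_index v i else 0)" for i
  have u: "u \<in> lat (r + 2)" by (simp add: u_def lat_def)
  have orth: "(\<Sum>i<r+2. a k i * u i) = 0" if "k \<le> r" for k
  proof -
    have "(\<Sum>i<r+2. a k i * u i) = (\<Sum>i<r+2. (if k \<le> r then a k i else 0) * vec_index v i)"
      using that by (intro sum.cong) (auto simp: u_def)
    also have "\<dots> = 0" by (rule v(3)[rule_format]) (use that in simp)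
    finally show ?thesis .
  qed
  obtain i0 where i0: "i0 < r + 2" "u i0 \<noteq> 0"
    using v(1,2) by (auto simp: u_def vec_eq_iff)
  have "(\<Sum>i<r+2. u i * u i) > 0"
    by (rule sum_pos2[of _ i0]) (use i0 in \<open>auto simp: zero_less_mult_iff linorder_neq_iff\<close>)
  have "lin_indep (r + 2) (r + 2) (\<lambda>k. if k \<le> r then a k else u)"
    unfolding lin_indep_def
  proof (intro allI impI)
    fix c :: "nat \<Rightarrow> int" and k
    assume c: "\<forall>i<r+2. (\<Sum>k<r+2. c k * (if k \<le> r then a k else u) i) = 0" and k: "k < r + 2"
    have c': "(\<Sum>k<r+1. c k * a k i) + c (r + 1) * u i = 0" if "i < r + 2" for i
    proof -
      have "(\<Sum>k<r+2. c k * (if k \<le> r then a k else u) i) =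
            (\<Sum>k<r+1. c k * (if k \<le> r then a k else u) i) + c (r + 1) * u i"
        by simp
      also have "(\<Sum>k<r+1. c k * (if k \<le> r then a k else u) i) = (\<Sum>k<r+1. c k * a k i)"
        by (intro sum.cong) auto
      finally show ?thesis using c that by simp
    qed
    \<comment> \<open>Pairing the relation with u removes the multiples of the \<open>a k\<close>
      and isolates the last coefficient.\<close>
    have "0 = (\<Sum>i<r+2. ((\<Sum>k<r+1. c k * a k i) + c (r + 1) * u i) * u i)"
      using c' by (intro sum.neutral[symmetric]) auto
    also have "\<dots> = (\<Sum>i<r+2. \<Sum>k<r+1. c k * (a k i * u i)) + c (r + 1) * (\<Sum>i<r+2. u i * u i)"
      by (simp only: distrib_right sum.distrib sum_distrib_left sum_distrib_right mult.assoc)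
    also have "(\<Sum>i<r+2. \<Sum>k<r+1. c k * (a k i * u i)) = (\<Sum>k<r+1. c k * (\<Sum>i<r+2. a k i * u i))"
      unfolding sum_distrib_left by (rule sum.swap)
    also have "\<dots> = 0" using orth by (intro sum.neutral) auto
    finally have c1: "c (r + 1) = 0" using \<open>(\<Sum>i<r+2. u i * u i) > 0\<close> by auto
    then have "\<forall>i<r+2. (\<Sum>k<r+1. c k * a k i) = 0" using c' by auto
    then have "\<forall>k<r+1. c k = 0" using assms unfolding lin_indep_def by blast
    with c1 k show "c k = 0" by (cases "k = r + 1") auto
  qed
  then have "detf (r + 2) (\<lambda>k. if k \<le> r then a k else u) \<noteq> 0" by (rule detf_nonzero)
  with u show ?thesis by blast
qed

section \<open>Cofactor vectors and the annihilator of a family of r + 1 vectors\<close>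

definition minor :: "nat \<Rightarrow> (nat \<Rightarrow> nat \<Rightarrow> int) \<Rightarrow> nat \<Rightarrow> int" where
  "minor r b i = det (mat (r + 1) (r + 1) (\<lambda>(p, k). b k (if p < i then p else Suc p)))"

lemma detf_expand:
  assumes "j < r + 2"
  shows "detf (r + 2) v = (\<Sum>i<r+2. v j i * ((-1) ^ (i + j) * minor r (del_fam j v) i))"
proof -
  define A where "A = mat (r + 2) (r + 2) (\<lambda>(i, j). v j i)"
  have "detf (r + 2) v = (\<Sum>i<r+2. A $$ (i, j) * cofactor A i j)"
    unfolding detf_def A_def by (rule laplace_expansion_column) (use assms in auto)
  also have "\<dots> = (\<Sum>i<r+2. v j i * ((-1) ^ (i + j) * minor r (del_fam j v) i))"
  proof (intro sum.cong refl)
    fix i assume "i \<in> {..<r+2}"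
    then have i: "i < r + 2" by simp
    have "mat_delete A i j = mat (r + 1) (r + 1) (\<lambda>(p, k). del_fam j v k (if p < i then p else Suc p))"
      unfolding mat_delete_def by (rule eq_matI) (use i assms in \<open>auto simp: A_def del_fam_def\<close>)
    then show "A $$ (i, j) * cofactor A i j = v j i * ((-1) ^ (i + j) * minor r (del_fam j v) i)"
      using i assms by (simp add: cofactor_def minor_def A_def)
  qed
  finally show ?thesis .
qed

text \<open>The generalised cross product of \<open>b 0, ..., b r\<close>: the cofactors along a
  last column with index r + 1, so that pairing with c is the determinant with c appended.\<close>

definition cof :: "nat \<Rightarrow> (nat \<Rightarrow> nat \<Rightarrow> int) \<Rightarrow> nat \<Rightarrow> int" where
  "cof r b i = (if i < r + 2 then (-1) ^ (i + (r + 1)) * minor r b i else 0)"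

lemma cof_lat: "cof r b \<in> lat (r + 2)"
  by (simp add: cof_def lat_def)

lemma minor_cong: "(\<And>k. k \<le> r \<Longrightarrow> b k = b' k) \<Longrightarrow> minor r b i = minor r b' i"
  unfolding minor_def by (rule arg_cong[of _ _ det]) (auto intro!: cong_mat)

lemma detf_last: "detf (r + 2) (\<lambda>k. if k \<le> r then b k else c) = pair (r + 2) (cof r b) c"
proof -
  have "minor r (del_fam (r + 1) (\<lambda>k. if k \<le> r then b k else c)) i = minor r b i" for i
    by (rule minor_cong) (auto simp: del_fam_def)
  then show ?thesis
    unfolding pair_def by (subst detf_expand[of "r + 1"]) (auto simp: cof_def intro!: sum.cong)
qed

text \<open>The sign is that of moving column j to the last place.\<close>

lemma detf_del_fam:
  assumes "j \<le> r + 1"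
  shows "detf (r + 2) a = (-1) ^ (r + 1 + j) * pair (r + 2) (cof r (del_fam j a)) (a j)"
proof -
  have sgn: "(-1) ^ (i + j) = (-1) ^ (r + 1 + j) * ((-1 :: int) ^ (i + (r + 1)))" for i
    by (cases "even (i + j)"; cases "even (r + 1 + j)") auto
  have "detf (r + 2) a = (\<Sum>i<r+2. a j i * ((-1) ^ (i + j) * minor r (del_fam j a) i))"
    by (rule detf_expand) (use assms in auto)
  also have "\<dots> = (\<Sum>i<r+2. (-1) ^ (r + 1 + j) * (cof r (del_fam j a) i * a j i))"
    by (intro sum.cong refl, subst sgn) (simp add: cof_def mult_ac)
  finally show ?thesis by (simp only: pair_def sum_distrib_left)
qed

lemma pair_cof_eq_0:
  assumes "k \<le> r"
  shows "pair (r + 2) (cof r b) (b k) = 0"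
  unfolding detf_last[symmetric] detf_def
  by (rule det_identical_columns[of _ "r + 2" k "r + 1"])
     (use assms in \<open>auto intro!: eq_vecI\<close>)

lemma gamma_of_eqI:
  assumes "primitive (r + 2) \<gamma>" "s > 0" "cof r a = (\<lambda>i. s * \<gamma> i)"
  shows "gamma_of r a = \<gamma>"
  unfolding gamma_of_def
proof (rule some_equality)
  show "primitive (r + 2) \<gamma> \<and> (\<exists>s>0. \<forall>c\<in>lat (r + 2). detf (r + 2) (\<lambda>k. if k \<le> r then a k else c) = s * pair (r + 2) \<gamma> c)"
    using assms unfolding detf_last by (metis pair_scale)
  fix \<gamma>' assume "primitive (r + 2) \<gamma>' \<and> (\<exists>s>0. \<forall>c\<in>lat (r + 2). detf (r + 2) (\<lambda>k. if k \<le> r then a k else c) = s * pair (r + 2) \<gamma>' c)"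
  then obtain s' where s': "primitive (r + 2) \<gamma>'" "s' > 0"
      "\<And>c. c \<in> lat (r + 2) \<Longrightarrow> pair (r + 2) (cof r a) c = s' * pair (r + 2) \<gamma>' c"
    unfolding detf_last by blast
  have "(\<lambda>i. s' * \<gamma>' i) = (\<lambda>i. s * \<gamma> i)"
    using s' assms(1,3) by (intro pair_ext[of _ "r + 2"] lat_scale primitive_lat) (auto simp: pair_scale)
  then have "s' * \<gamma>' i = s * \<gamma> i" for i by (rule fun_cong)
  with s' assms show "\<gamma>' = \<gamma>" by (intro primitive_unique[of _ \<gamma> \<gamma>' s' s]) auto
qed

text \<open>The cofactor vector is nonzero because the family extends to one of nonzero determinant;
  \<gamma> is that vector divided by the gcd of its coordinates.\<close>

lemma gamma_of_props:
  assumes "lin_indep (r + 2) (r + 1) a"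
  shows "primitive (r + 2) (gamma_of r a)"
    and "\<exists>s>0. cof r a = (\<lambda>i. s * gamma_of r a i)"
    and "k \<le> r \<Longrightarrow> pair (r + 2) (gamma_of r a) (a k) = 0"
proof -
  obtain u where u: "detf (r + 2) (\<lambda>k. if k \<le> r then a k else u) \<noteq> 0"
    using lin_indep_extend[OF assms] by blast
  then have "cof r a \<noteq> (\<lambda>i. 0)" unfolding detf_last by auto
  then obtain s \<gamma> where s: "s > 0" "primitive (r + 2) \<gamma>" "cof r a = (\<lambda>i. s * \<gamma> i)"
    using primitive_decomposition[OF cof_lat] by blast
  then have g: "gamma_of r a = \<gamma>" by (intro gamma_of_eqI)
  show "primitive (r + 2) (gamma_of r a)" "\<exists>s>0. cof r a = (\<lambda>i. s * gamma_of r a i)"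
    using s g by auto
  show "pair (r + 2) (gamma_of r a) (a k) = 0" if "k \<le> r"
    using pair_cof_eq_0[OF that, of a] s g by (auto simp: pair_scale)
qed

text \<open>With u completing the family, the combination of \<delta> and \<gamma> that vanishes on
  u vanishes on all r + 2 vectors and is 0. Primitivity of \<gamma> turns the rational
  proportionality into an integral one.\<close>

lemma kernel_gamma_of:
  assumes a: "lin_indep (r + 2) (r + 1) a" and \<delta>: "\<delta> \<in> lat (r + 2)"
    and 0: "\<And>k. k \<le> r \<Longrightarrow> pair (r + 2) \<delta> (a k) = 0"
  shows "\<exists>k. \<delta> = (\<lambda>i. k * gamma_of r a i)"
proof -
  let ?\<gamma> = "gamma_of r a"
  obtain u where u: "detf (r + 2) (\<lambda>k. if k \<le> r then a k else u) \<noteq> 0"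
    using lin_indep_extend[OF a] by blast
  obtain s where s: "s > 0" "cof r a = (\<lambda>i. s * ?\<gamma> i)" using gamma_of_props(2)[OF a] by blast
  have p: "pair (r + 2) ?\<gamma> u \<noteq> 0"
    using u unfolding detf_last s(2) pair_scale by auto
  have \<gamma>: "?\<gamma> \<in> lat (r + 2)" by (rule primitive_lat[OF gamma_of_props(1)[OF a]])
  have "(\<lambda>i. pair (r + 2) ?\<gamma> u * \<delta> i - pair (r + 2) \<delta> u * ?\<gamma> i) = (\<lambda>i. 0)"
  proof (rule pair_nondegenerate[OF u])
    show "(\<lambda>i. pair (r + 2) ?\<gamma> u * \<delta> i - pair (r + 2) \<delta> u * ?\<gamma> i) \<in> lat (r + 2)"
      by (intro lat_intros \<delta> \<gamma>)
    fix k assume "k < r + 2"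
    then show "pair (r + 2) (\<lambda>i. pair (r + 2) ?\<gamma> u * \<delta> i - pair (r + 2) \<delta> u * ?\<gamma> i) (if k \<le> r then a k else u) = 0"
      unfolding pair_linear using 0[of k] gamma_of_props(3)[OF a, of k] by simp
  qed
  then have "pair (r + 2) ?\<gamma> u * \<delta> i = pair (r + 2) \<delta> u * ?\<gamma> i" for i by (simp add: fun_eq_iff)
  then show ?thesis by (rule primitive_multiple[OF gamma_of_props(1)[OF a] p])
qed

text \<open>A dual family exists because one of an extension of the family by a vector u does; its
  last member is dropped.\<close>

lemma alpha_of_posdual:
  assumes "lin_indep (r + 2) (r + 1) a"
  shows "posdual (r + 2) (r + 1) a (alpha_of r a)"
proof -
  obtain u where u: "detf (r + 2) (\<lambda>k. if k \<le> r then a k else u) \<noteq> 0" (is "?d \<noteq> 0")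
    using lin_indep_extend[OF assms] by blast
  obtain \<rho> where \<rho>: "\<And>j. j < r + 2 \<Longrightarrow> \<rho> j \<in> lat (r + 2)"
     "\<And>j k. j < r + 2 \<Longrightarrow> k < r + 2 \<Longrightarrow> pair (r + 2) (\<rho> j) (if k \<le> r then a k else u) = (if j = k then \<bar>?d\<bar> else 0)"
    using dual_family_exists[OF u] by blast
  have "posdual (r + 2) (r + 1) a \<rho>"
    unfolding posdual_def
  proof (intro allI impI conjI)
    fix j assume j: "j < r + 1"
    show "\<rho> j \<in> lat (r + 2)" using \<rho>(1)[of j] j by simp
    show "0 < pair (r + 2) (\<rho> j) (a j)" using \<rho>(2)[of j j] j u by (simp split: if_splits)
    fix k assume "k < r + 1" "k \<noteq> j"
    then show "pair (r + 2) (\<rho> j) (a k) = 0" using \<rho>(2)[of j k] j by (simp split: if_splits)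
  qed
  then have "\<exists>\<alpha>. posdual (r + 2) (r + 1) a \<alpha>" by blast
  then show ?thesis unfolding alpha_of_def by (rule someI_ex)
qed

text \<open>The dual family from the adjugate is made primitive by dividing each member by a
  positive integer, which keeps the signs and zeros of all pairings.\<close>

lemma alpha_prim_props:
  assumes "lin_indep (r + 2) (r + 2) a"
  shows "posdual (r + 2) (r + 2) a (alpha_prim r a)" "j < r + 2 \<Longrightarrow> primitive (r + 2) (alpha_prim r a j)"
proof -
  have d: "detf (r + 2) a \<noteq> 0" by (rule detf_nonzero[OF assms])
  obtain \<rho> where \<rho>: "\<And>j. j < r + 2 \<Longrightarrow> \<rho> j \<in> lat (r + 2)"
     "\<And>j k. j < r + 2 \<Longrightarrow> k < r + 2 \<Longrightarrow> pair (r + 2) (\<rho> j) (a k) = (if j = k then \<bar>detf (r + 2) a\<bar> else 0)"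
    using dual_family_exists[OF d] by blast
  have "\<exists>d u. d > 0 \<and> primitive (r + 2) u \<and> \<rho> j = (\<lambda>i. d * u i)" if "j < r + 2" for j
  proof (rule primitive_decomposition[OF \<rho>(1)[OF that]])
    show "\<rho> j \<noteq> (\<lambda>i. 0)" using \<rho>(2)[OF that that] d by auto
  qed
  then have "\<forall>j. \<exists>u. j < r + 2 \<longrightarrow> (\<exists>d>0. primitive (r + 2) u \<and> \<rho> j = (\<lambda>i. d * u i))" by blast
  from choice[OF this] obtain u where u: "\<And>j. j < r + 2 \<Longrightarrow> \<exists>d>0. primitive (r + 2) (u j) \<and> \<rho> j = (\<lambda>i. d * u j i)"
    by blast
  have "posdual (r + 2) (r + 2) a u \<and> (\<forall>j<r+2. primitive (r + 2) (u j))"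
    unfolding posdual_def
  proof (intro allI impI conjI)
    fix j assume j: "j < r + 2"
    obtain e where e: "e > 0" "primitive (r + 2) (u j)" "\<rho> j = (\<lambda>i. e * u j i)" using u[OF j] by blast
    show "primitive (r + 2) (u j)" by fact
    then show "u j \<in> lat (r + 2)" by (rule primitive_lat)
    have *: "e * pair (r + 2) (u j) (a k) = (if j = k then \<bar>detf (r + 2) a\<bar> else 0)" if "k < r + 2" for k
      using \<rho>(2)[OF j that] unfolding e(3) pair_scale .
    have "0 < e * pair (r + 2) (u j) (a j)" using *[OF j] d by simp
    then show "0 < pair (r + 2) (u j) (a j)" using e(1) by (simp add: zero_less_mult_iff)
    fix k assume "k < r + 2" "k \<noteq> j"
    then show "pair (r + 2) (u j) (a k) = 0" using *[of k] e(1) by simp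
  qed
  then have "\<exists>\<alpha>. posdual (r + 2) (r + 2) a \<alpha> \<and> (\<forall>j<r+2. primitive (r + 2) (\<alpha> j))" by blast
  then have "posdual (r + 2) (r + 2) a (alpha_prim r a) \<and> (\<forall>j<r+2. primitive (r + 2) (alpha_prim r a j))"
    unfolding alpha_prim_def by (rule someI_ex)
  then show "posdual (r + 2) (r + 2) a (alpha_prim r a)" "j < r + 2 \<Longrightarrow> primitive (r + 2) (alpha_prim r a j)"
    by auto
qed

lemma alpha_prim_unique:
  assumes a: "lin_indep (r + 2) (r + 2) a" and \<alpha>: "posdual (r + 2) (r + 2) a \<alpha>"
    and prim: "\<And>j. j < r + 2 \<Longrightarrow> primitive (r + 2) (\<alpha> j)" and j: "j < r + 2"
  shows "alpha_prim r a j = \<alpha> j"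
proof -
  let ?\<beta> = "alpha_prim r a"
  have \<beta>: "posdual (r + 2) (r + 2) a ?\<beta>" "primitive (r + 2) (?\<beta> j)"
    using alpha_prim_props[OF a] j by auto
  define p q where "p = pair (r + 2) (\<alpha> j) (a j)" and "q = pair (r + 2) (?\<beta> j) (a j)"
  have "(\<lambda>i. p * ?\<beta> j i - q * \<alpha> j i) = (\<lambda>i. 0)"
  proof (rule pair_nondegenerate[OF detf_nonzero[OF a]])
    show "(\<lambda>i. p * ?\<beta> j i - q * \<alpha> j i) \<in> lat (r + 2)"
      by (intro lat_intros primitive_lat \<beta> prim j)
    fix k assume "k < r + 2"
    then show "pair (r + 2) (\<lambda>i. p * ?\<beta> j i - q * \<alpha> j i) (a k) = 0"
      using \<alpha> \<beta>(1) j unfolding pair_linear posdual_def by (cases "k = j") (auto simp: p_def q_def)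
  qed
  then have "p * ?\<beta> j i = q * \<alpha> j i" for i by (simp add: fun_eq_iff)
  moreover have "p > 0" "q > 0" using \<alpha> \<beta>(1) j by (auto simp: posdual_def p_def q_def)
  ultimately show ?thesis using primitive_unique[OF prim[OF j] \<beta>(2), of p q] by blast
qed

subsection \<open>Independence of the dual family\<close>

text \<open>Keeps \<open>r + 2\<close> in the form in which it occurs in the definitions.\<close>
declare add_2_eq_Suc' [simp del]

lemma hom_add: "homLC n x \<Longrightarrow> u \<in> lat n \<Longrightarrow> v \<in> lat n \<Longrightarrow> x (\<lambda>i. u i + v i) = x u + x v"
  by (simp add: homLC_def)

lemma hom_zero: "homLC n x \<Longrightarrow> x (\<lambda>i. 0) = 0"
  using hom_add[of n x "\<lambda>i. 0" "\<lambda>i. 0"] by simp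

lemma hom_uminus:
  assumes "homLC n x" "v \<in> lat n"
  shows "x (\<lambda>i. - v i) = - x v"
proof -
  have "(\<lambda>i. - v i) \<in> lat n" using lat_scale[OF assms(2), of "-1"] by simp
  from hom_add[OF assms(1) assms(2) this] show ?thesis
    using hom_zero[OF assms(1)] by (simp add: add_eq_0_iff)
qed

lemma hom_scale:
  assumes "homLC n x" "v \<in> lat n"
  shows "x (\<lambda>i. k * v i) = of_int k * x v"
proof -
  have nat: "x (\<lambda>i. int m * v i) = of_nat m * x v" for m
  proof (induction m)
    case (Suc m)
    have "(\<lambda>i. int (Suc m) * v i) = (\<lambda>i. int m * v i + v i)" by (simp add: algebra_simps)
    then show ?case
      using hom_add[OF assms(1) lat_scale[OF assms(2), of "int m"] assms(2)] Suc
      by (simp add: algebra_simps)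
  qed (simp add: hom_zero[OF assms(1)])
  show ?thesis
  proof (cases "k \<ge> 0")
    case True
    then show ?thesis using nat[of "nat k"] by simp
  next
    case False
    have "(\<lambda>i. k * v i) = (\<lambda>i. - (int (nat (- k)) * v i))" using False by simp
    then show ?thesis
      using hom_uminus[OF assms(1) lat_scale[OF assms(2), of "int (nat (- k))"]] nat[of "nat (- k)"] False
      by simp
  qed
qed

lemma hom_sum:
  assumes "homLC n x" "finite A" "\<And>j. j \<in> A \<Longrightarrow> f j \<in> lat n"
  shows "x (\<lambda>i. \<Sum>j\<in>A. f j i) = (\<Sum>j\<in>A. x (f j))"
  using assms(2,3)
proof (induction A rule: finite_induct)
  case (insert j A)
  have "(\<lambda>i. \<Sum>j\<in>insert j A. f j i) = (\<lambda>i. f j i + (\<Sum>j\<in>A. f j i))"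
    using insert.hyps by simp
  moreover have "(\<lambda>i. \<Sum>j\<in>A. f j i) \<in> lat n" using insert.prems by (intro lat_sum) auto
  ultimately show ?case
    using hom_add[OF assms(1), of "f j"] insert by simp
qed (simp add: hom_zero[OF assms(1)])

lemma nishG_period: "nishG r \<tau> (z + of_int k) = nishG r \<tau> z"
proof -
  have "qexp (z + of_int k - y) = qexp (z - y)" for y
    by (simp add: qexp_add qexp_diff)
  then show ?thesis
    unfolding nishG_def Let_def nish_upper_def nishP1_def nishP2_def by simp
qed

text \<open>Negating the parameters exchanges the index sets S and T, so both sides use the same
  reflected parameters \<tau>', at y and at \<open>(\<Sum>j\<le>r. \<tau>' j) - y\<close>. This
  substitution swaps the two halves of the product and raises \<open>nish_upper\<close> to the power
  (-1)^r. As card S + card T = r + 1, one sign remains.\<close>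

lemma nishG_uminus:
  assumes "\<And>j. j \<le> r \<Longrightarrow> Im (\<tau> j) \<noteq> 0"
  shows "nishG r (\<lambda>j. - \<tau> j) (- z) = inverse (nishG r \<tau> z)"
proof -
  define S where "S = {j. j \<le> r \<and> Im (\<tau> j) < 0}"
  define T where "T = {j. j \<le> r \<and> Im (- \<tau> j) < 0}"
  define \<tau>' where "\<tau>' = (\<lambda>j. if j \<in> S then - \<tau> j else \<tau> j)"
  define y where "y = z - (\<Sum>j\<in>S. \<tau> j)"
  have fin: "finite S" "finite T" by (auto simp: S_def T_def)
  have ST: "S \<inter> T = {}" "S \<union> T = {..r}"
    using assms by (auto simp: S_def T_def linorder_neq_iff)
  have upper_cong: "nish_upper r \<sigma> = nish_upper r \<sigma>'" if "\<And>j. j \<le> r \<Longrightarrow> \<sigma> j = \<sigma>' j" for \<sigma> \<sigma>'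
    using that by (simp add: fun_eq_iff nish_upper_def nishP1_def nishP2_def)
  have "nish_upper r (\<lambda>j. if j \<in> T then - (- \<tau> j) else - \<tau> j) = nish_upper r \<tau>'"
    using ST by (intro upper_cong) (auto simp: \<tau>'_def)
  moreover have "- z - (\<Sum>j\<in>T. - \<tau> j) = (\<Sum>j\<le>r. \<tau>' j) - y"
  proof -
    have "(\<Sum>j\<le>r. \<tau>' j) = (\<Sum>j\<in>S. \<tau>' j) + (\<Sum>j\<in>T. \<tau>' j)"
      unfolding ST(2)[symmetric] using fin ST(1) by (rule sum.union_disjoint)
    also have "(\<Sum>j\<in>S. \<tau>' j) = - (\<Sum>j\<in>S. \<tau> j)" by (simp add: \<tau>'_def sum_negf)
    also have "(\<Sum>j\<in>T. \<tau>' j) = (\<Sum>j\<in>T. \<tau> j)" using ST by (intro sum.cong) (auto simp: \<tau>'_def)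
    finally show ?thesis by (simp add: y_def sum_negf)
  qed
  ultimately have "nishG r (\<lambda>j. - \<tau> j) (- z) = nish_upper r \<tau>' ((\<Sum>j\<le>r. \<tau>' j) - y) powi ((-1) ^ card T)"
    unfolding nishG_def Let_def T_def[symmetric] by simp
  also have "nish_upper r \<tau>' ((\<Sum>j\<le>r. \<tau>' j) - y) = nish_upper r \<tau>' y powi ((-1) ^ r)"
    unfolding nish_upper_def nishP1_eq_qpoch nishP2_eq_qpoch by (cases "even r") auto
  also have "card T = Suc r - card S"
    using card_Un_disjoint[OF fin ST(1)] ST(2) by simp
  moreover have "card S \<le> Suc r" using card_mono[of "{..r}" S] ST by auto
  ultimately have "nishG r (\<lambda>j. - \<tau> j) (- z) = inverse (nish_upper r \<tau>' y powi ((-1) ^ card S))"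
    by (cases "even r"; cases "even (card S)") auto
  then show ?thesis
    unfolding nishG_def Let_def S_def[symmetric] \<tau>'_def[symmetric] y_def[symmetric] by simp
qed

text \<open>Arguments strictly inside the zonotope of the parameters have imaginary part inside the
  strip of convergence.\<close>

lemma sum_interpolation_less:
  fixes y :: "nat \<Rightarrow> real"
  assumes "\<And>j. j \<le> r \<Longrightarrow> y j \<noteq> 0" "\<And>j. j \<le> r \<Longrightarrow> 0 < u j" "\<And>j. j \<le> r \<Longrightarrow> u j < 1"
  shows "(\<Sum>j\<le>r. min 0 (y j)) < (\<Sum>j\<le>r. u j * y j)" "(\<Sum>j\<le>r. u j * y j) < (\<Sum>j\<le>r. max 0 (y j))"
proof -
  have *: "min 0 (y j) < u j * y j \<and> u j * y j < max 0 (y j)" if "j \<le> r" for j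
    using assms[OF that] by (cases "y j > 0") (auto simp: mult_less_0_iff zero_less_mult_iff)
  show "(\<Sum>j\<le>r. min 0 (y j)) < (\<Sum>j\<le>r. u j * y j)" "(\<Sum>j\<le>r. u j * y j) < (\<Sum>j\<le>r. max 0 (y j))"
    by (intro sum_strict_mono; use * in force)+
qed

lemma Im_of_int_mult: "Im (of_int k * z) = of_int k * Im z"
  by simp

section \<open>Products over the quotient by \<gamma> in coordinates\<close>

locale geom =
  fixes r :: nat and a :: "nat \<Rightarrow> nat \<Rightarrow> int" and x :: "(nat \<Rightarrow> int) \<Rightarrow> complex"
  assumes indep: "lin_indep (r + 2) (r + 1) a" and hom: "homLC (r + 2) x"
    and x\<gamma>: "x (gamma_of r a) \<noteq> 0"
begin

abbreviation \<gamma> where "\<gamma> \<equiv> gamma_of r a"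

abbreviation P where "P \<equiv> pair (r + 2)"

abbreviation L where "L \<equiv> lat (r + 2)"

text \<open>The values on \<open>a\<close> are coordinates on \<open>L / \<int>\<gamma>\<close>, so products over the quotient become
  products over finite sets of integer tuples and no representatives have to be chosen.\<close>
definition idx :: "(nat \<Rightarrow> int) \<Rightarrow> nat \<Rightarrow> int" where
  "idx \<delta> = restrict (\<lambda>j. P \<delta> (a j)) {..r}"

definition sec :: "(nat \<Rightarrow> int) \<Rightarrow> nat \<Rightarrow> int" where
  "sec v = (SOME \<delta>. \<delta> \<in> L \<and> idx \<delta> = v)"

text \<open>Defined as an image because not every tuple in the range need occur: the values on
  linearly independent vectors may form a proper subgroup of the integer tuples.\<close>

definition box :: "(nat \<Rightarrow> int) \<Rightarrow> (nat \<Rightarrow> int) set" where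
  "box b = idx ` {\<delta> \<in> L. \<forall>j\<le>r. 0 \<le> P \<delta> (a j) \<and> P \<delta> (a j) < b j}"

text \<open>The geometric function for an arbitrary dual family instead of the one fixed by
  \<open>alpha_of\<close>; different families can then be compared.\<close>

definition Gprod :: "(nat \<Rightarrow> nat \<Rightarrow> int) \<Rightarrow> complex \<Rightarrow> complex" where
  "Gprod \<alpha> w = (\<Prod>v\<in>box (\<lambda>j. P (\<alpha> j) (a j)). nishG r (\<lambda>j. x (\<alpha> j) / x \<gamma>) ((w + x (sec v)) / x \<gamma>))"

lemma \<gamma>_lat: "\<gamma> \<in> L"
  by (rule primitive_lat[OF gamma_of_props(1)[OF indep]])

lemma sec: "\<delta> \<in> L \<Longrightarrow> sec (idx \<delta>) \<in> L \<and> idx (sec (idx \<delta>)) = idx \<delta>"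
  unfolding sec_def by (rule someI[of _ \<delta>]) simp

lemma idx_eq_iff: "idx \<delta> = idx \<delta>' \<longleftrightarrow> (\<forall>j\<le>r. P \<delta> (a j) = P \<delta>' (a j))"
  by (auto simp: idx_def fun_eq_iff restrict_def)

lemma idx_eq_imp:
  assumes "\<delta> \<in> L" "\<delta>' \<in> L" "idx \<delta> = idx \<delta>'"
  shows "\<exists>k. \<delta>' = (\<lambda>i. \<delta> i + k * \<gamma> i)" "\<exists>k. x \<delta>' / x \<gamma> = x \<delta> / x \<gamma> + of_int k"
proof -
  obtain k where k: "(\<lambda>i. \<delta>' i - \<delta> i) = (\<lambda>i. k * \<gamma> i)"
    using kernel_gamma_of[OF indep lat_diff[OF assms(2,1)]] assms(3)
    by (auto simp: pair_diff idx_eq_iff)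
  then have k': "\<delta>' = (\<lambda>i. \<delta> i + k * \<gamma> i)" by (auto simp: fun_eq_iff algebra_simps)
  then show "\<exists>k. \<delta>' = (\<lambda>i. \<delta> i + k * \<gamma> i)" by blast
  have "x \<delta>' = x \<delta> + of_int k * x \<gamma>"
    unfolding k' by (simp add: hom_add[OF hom assms(1) lat_scale[OF \<gamma>_lat]] hom_scale[OF hom \<gamma>_lat])
  then show "\<exists>k. x \<delta>' / x \<gamma> = x \<delta> / x \<gamma> + of_int k"
    using x\<gamma> by (intro exI[of _ k]) (simp add: field_simps)
qed

lemma idx_add_\<gamma>: "idx (\<lambda>i. \<delta> i + k * \<gamma> i) = idx \<delta>"
  using gamma_of_props(3)[OF indep] by (simp add: idx_eq_iff pair_linear)

text \<open>Adding \<gamma> moves the argument by 1, a period of \<open>nishG\<close>.\<close>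

lemma nishG_idx_cong:
  assumes "\<delta> \<in> L" "\<delta>' \<in> L" "idx \<delta> = idx \<delta>'"
  shows "nishG r \<tau> ((w + x \<delta>') / x \<gamma>) = nishG r \<tau> ((w + x \<delta>) / x \<gamma>)"
proof -
  obtain k where "x \<delta>' / x \<gamma> = x \<delta> / x \<gamma> + of_int k" using idx_eq_imp(2)[OF assms] by blast
  then have "(w + x \<delta>') / x \<gamma> = (w + x \<delta>) / x \<gamma> + of_int k" by (simp add: add_divide_distrib)
  then show ?thesis by (simp add: nishG_period)
qed

lemma finite_box [simp]: "finite (box b)"
proof (rule finite_subset)
  show "box b \<subseteq> PiE {..r} (\<lambda>j. {0..<b j})"
    by (auto simp: box_def idx_def restrict_def PiE_def Pi_def extensional_def)
qed (auto intro!: finite_PiE)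

lemma box_Fset: "box (\<lambda>j. P (\<alpha> j) (a j)) = idx ` Fset (r + 2) (r + 1) a \<alpha>"
  by (auto simp: box_def Fset_def less_Suc_eq_le)

lemma Gprod_transversal:
  assumes "D \<subseteq> Fset (r + 2) (r + 1) a \<alpha>" "inj_on idx D" "idx ` D = idx ` Fset (r + 2) (r + 1) a \<alpha>"
  shows "Gprod \<alpha> w = (\<Prod>\<delta>\<in>D. nishG r (\<lambda>j. x (\<alpha> j) / x \<gamma>) ((w + x \<delta>) / x \<gamma>))"
proof -
  have "Gprod \<alpha> w = (\<Prod>\<delta>\<in>D. nishG r (\<lambda>j. x (\<alpha> j) / x \<gamma>) ((w + x (sec (idx \<delta>))) / x \<gamma>))"
    unfolding Gprod_def box_Fset assms(3)[symmetric] by (simp add: prod.reindex[OF assms(2)])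
  also have "\<dots> = (\<Prod>\<delta>\<in>D. nishG r (\<lambda>j. x (\<alpha> j) / x \<gamma>) ((w + x \<delta>) / x \<gamma>))"
  proof (intro prod.cong refl nishG_idx_cong)
    fix \<delta> assume "\<delta> \<in> D"
    then show "\<delta> \<in> L" using assms(1) by (auto simp: Fset_def)
    then show "sec (idx \<delta>) \<in> L" "idx \<delta> = idx (sec (idx \<delta>))" using sec by auto
  qed
  finally show ?thesis .
qed

text \<open>The classes of \<open>modrel F \<gamma>\<close> are the fibres of \<open>idx\<close> on
  F, and the chosen representative affects the factor only through its \<open>idx\<close>.\<close>

lemma geomG_eq_Gprod: "geomG r a w x = Gprod (alpha_of r a) w"
proof -
  define \<alpha> where "\<alpha> = alpha_of r a"
  define F where "F = Fset (r + 2) (r + 1) a \<alpha>"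
  define h where "h v = nishG r (\<lambda>j. x (\<alpha> j) / x \<gamma>) ((w + x (sec v)) / x \<gamma>)" for v
  define pick where "pick C = (SOME \<delta>. \<delta> \<in> C)" for C :: "(nat \<Rightarrow> int) set"
  have FL: "F \<subseteq> L" by (auto simp: F_def Fset_def)
  have cls: "modrel F \<gamma> `` {\<delta>} = {\<delta>' \<in> F. idx \<delta>' = idx \<delta>}" if "\<delta> \<in> F" for \<delta>
  proof (intro equalityI subsetI)
    fix \<delta>' assume "\<delta>' \<in> modrel F \<gamma> `` {\<delta>}"
    then show "\<delta>' \<in> {\<delta>' \<in> F. idx \<delta>' = idx \<delta>}" by (auto simp: modrel_def idx_add_\<gamma>)
  next
    fix \<delta>' assume "\<delta>' \<in> {\<delta>' \<in> F. idx \<delta>' = idx \<delta>}"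
    then show "\<delta>' \<in> modrel F \<gamma> `` {\<delta>}"
      using idx_eq_imp(1)[of \<delta> \<delta>'] that FL by (auto simp: modrel_def)
  qed
  have rep: "\<exists>\<delta>\<in>F. C = {\<delta>' \<in> F. idx \<delta>' = idx \<delta>}" if "C \<in> F // modrel F \<gamma>" for C
    using that cls by (auto simp: quotient_def)
  have pick: "pick {\<delta>' \<in> F. idx \<delta>' = idx \<delta>} \<in> F \<and> idx (pick {\<delta>' \<in> F. idx \<delta>' = idx \<delta>}) = idx \<delta>" if "\<delta> \<in> F" for \<delta>
  proof -
    have "pick {\<delta>' \<in> F. idx \<delta>' = idx \<delta>} \<in> {\<delta>' \<in> F. idx \<delta>' = idx \<delta>}"
      unfolding pick_def by (rule someI[of _ \<delta>]) (use that in simp)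
    then show ?thesis by simp
  qed
  have bij: "bij_betw (\<lambda>C. idx (pick C)) (F // modrel F \<gamma>) (idx ` F)"
  proof (rule bij_betw_imageI)
    show "inj_on (\<lambda>C. idx (pick C)) (F // modrel F \<gamma>)"
    proof (rule inj_onI)
      fix C C' assume C: "C \<in> F // modrel F \<gamma>" "C' \<in> F // modrel F \<gamma>" and eq: "idx (pick C) = idx (pick C')"
      obtain \<delta> \<delta>' where "\<delta> \<in> F" "C = {\<delta>'' \<in> F. idx \<delta>'' = idx \<delta>}" "\<delta>' \<in> F" "C' = {\<delta>'' \<in> F. idx \<delta>'' = idx \<delta>'}"
        using rep[OF C(1)] rep[OF C(2)] by blast
      with eq show "C = C'" using pick by simp
    qed
    show "(\<lambda>C. idx (pick C)) ` (F // modrel F \<gamma>) = idx ` F"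
    proof (intro equalityI subsetI)
      fix v assume "v \<in> (\<lambda>C. idx (pick C)) ` (F // modrel F \<gamma>)"
      then obtain C where C: "C \<in> F // modrel F \<gamma>" "v = idx (pick C)" by blast
      obtain \<delta> where "\<delta> \<in> F" "C = {\<delta>'' \<in> F. idx \<delta>'' = idx \<delta>}" using rep[OF C(1)] by blast
      then show "v \<in> idx ` F" using pick C by auto
    next
      fix v assume "v \<in> idx ` F"
      then obtain \<delta> where \<delta>: "\<delta> \<in> F" "v = idx \<delta>" by blast
      have "modrel F \<gamma> `` {\<delta>} \<in> F // modrel F \<gamma>" using \<delta> by (simp add: quotientI)
      moreover have "idx (pick (modrel F \<gamma> `` {\<delta>})) = v" using cls[OF \<delta>(1)] pick[OF \<delta>(1)] \<delta> by simp
      ultimately show "v \<in> (\<lambda>C. idx (pick C)) ` (F // modrel F \<gamma>)" by (metis image_eqI)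
    qed
  qed
  have "geomG r a w x = (\<Prod>C\<in>F // modrel F \<gamma>. nishG r (\<lambda>j. x (\<alpha> j) / x \<gamma>) ((w + x (pick C)) / x \<gamma>))"
    unfolding geomG_def Let_def F_def \<alpha>_def pick_def ..
  also have "\<dots> = (\<Prod>C\<in>F // modrel F \<gamma>. h (idx (pick C)))"
  proof (rule prod.cong[OF refl])
    fix C assume "C \<in> F // modrel F \<gamma>"
    then obtain \<delta> where "\<delta> \<in> F" "C = {\<delta>'' \<in> F. idx \<delta>'' = idx \<delta>}" using rep by blast
    then have "pick C \<in> L" using pick[of \<delta>] FL by auto
    then show "nishG r (\<lambda>j. x (\<alpha> j) / x \<gamma>) ((w + x (pick C)) / x \<gamma>) = h (idx (pick C))"
      unfolding h_def using sec[of "pick C"] by (intro nishG_idx_cong) auto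
  qed
  also have "\<dots> = (\<Prod>v\<in>idx ` F. h v)" by (rule prod.reindex_bij_betw[OF bij])
  also have "\<dots> = Gprod \<alpha> w" unfolding Gprod_def box_Fset F_def h_def ..
  finally show ?thesis unfolding \<alpha>_def .
qed

text \<open>Modulo rational multiples of \<gamma>, \<delta> is the combination of the
  \<open>\<alpha> j\<close> with coefficients
  \<open>P \<delta> (a j) / P (\<alpha> j) (a j)\<close>; after division by
  \<open>x \<gamma>\<close>, multiples of \<gamma> contribute real numbers only.\<close>

lemma Im_formula:
  assumes \<alpha>: "posdual (r + 2) (r + 1) a \<alpha>" and \<delta>: "\<delta> \<in> L"
  shows "Im (x \<delta> / x \<gamma>) = (\<Sum>j\<le>r. of_int (P \<delta> (a j)) / of_int (P (\<alpha> j) (a j)) * Im (x (\<alpha> j) / x \<gamma>))"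
proof -
  define c where "c j = P (\<alpha> j) (a j)" for j
  \<comment> \<open>A common denominator of these coefficients, used to stay inside the
    lattice.\<close>
  define C where "C = (\<Prod>j\<le>r. c j)"
  define C' where "C' j = (\<Prod>l\<in>{..r} - {j}. c l)" for j
  have c: "c j > 0" "\<alpha> j \<in> L" if "j \<le> r" for j using \<alpha> that by (auto simp: posdual_def c_def)
  have CC': "C = c j * C' j" if "j \<le> r" for j
    unfolding C_def C'_def using that by (intro prod.remove) auto
  have C: "C > 0" unfolding C_def using c by (intro prod_pos) auto
  define \<eta> where "\<eta> = (\<lambda>i. \<Sum>j\<le>r. (P \<delta> (a j) * C' j) * \<alpha> j i)"
  have \<eta>: "\<eta> \<in> L" unfolding \<eta>_def using c by (intro lat_intros) auto
  have P\<eta>: "P \<eta> (a k) = C * P \<delta> (a k)" if k: "k \<le> r" for k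
  proof -
    have "P \<eta> (a k) = (\<Sum>j\<le>r. (P \<delta> (a j) * C' j) * P (\<alpha> j) (a k))"
      unfolding \<eta>_def pair_linear ..
    also have "\<dots> = (\<Sum>j\<le>r. if j = k then (P \<delta> (a k) * C' k) * c k else 0)"
      using \<alpha> k by (intro sum.cong) (auto simp: posdual_def c_def)
    also have "\<dots> = C * P \<delta> (a k)" using k CC'[OF k] by (simp add: mult_ac)
    finally show ?thesis .
  qed
  have "idx \<eta> = idx (\<lambda>i. C * \<delta> i)" using P\<eta> by (simp add: idx_eq_iff pair_scale)
  then obtain k where k: "x (\<lambda>i. C * \<delta> i) / x \<gamma> = x \<eta> / x \<gamma> + of_int k"
    using idx_eq_imp(2)[OF \<eta> lat_scale[OF \<delta>]] by blast
  have x\<eta>: "x \<eta> = (\<Sum>j\<le>r. of_int (P \<delta> (a j) * C' j) * x (\<alpha> j))"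
    unfolding \<eta>_def using c(2) by (subst hom_sum[OF hom]) (auto intro!: lat_scale sum.cong simp: hom_scale[OF hom])
  have "of_int C * (x \<delta> / x \<gamma>) = (\<Sum>j\<le>r. of_int (P \<delta> (a j) * C' j) * (x (\<alpha> j) / x \<gamma>)) + of_int k"
    using k unfolding x\<eta> hom_scale[OF hom \<delta>] by (simp add: sum_divide_distrib)
  then have "Im (of_int C * (x \<delta> / x \<gamma>)) = Im ((\<Sum>j\<le>r. of_int (P \<delta> (a j) * C' j) * (x (\<alpha> j) / x \<gamma>)) + of_int k)"
    by (rule arg_cong)
  from this have eq: "of_int C * Im (x \<delta> / x \<gamma>) = (\<Sum>j\<le>r. of_int (P \<delta> (a j) * C' j) * Im (x (\<alpha> j) / x \<gamma>))"
    by (simp only: plus_complex.sel Im_sum Im_of_int_mult complex_Im_of_int add_0_right)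
  have "Im (x \<delta> / x \<gamma>) = (\<Sum>j\<le>r. of_int (P \<delta> (a j) * C' j) * Im (x (\<alpha> j) / x \<gamma>)) / of_int C"
    using eq C by (simp add: field_simps)
  also have "\<dots> = (\<Sum>j\<le>r. of_int (P \<delta> (a j)) / of_int (c j) * Im (x (\<alpha> j) / x \<gamma>))"
    unfolding sum_divide_distrib
  proof (intro sum.cong refl)
    fix j assume j: "j \<in> {..r}"
    then have "C' j \<noteq> 0" "c j \<noteq> 0" using c CC'[of j] C by auto
    then show "of_int (P \<delta> (a j) * C' j) * Im (x (\<alpha> j) / x \<gamma>) / real_of_int C =
               of_int (P \<delta> (a j)) / of_int (c j) * Im (x (\<alpha> j) / x \<gamma>)"
      using CC'[of j] j by (simp add: field_simps)
  qed
  finally show ?thesis unfolding c_def .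
qed

lemma Im_dual_ratio:
  assumes \<alpha>: "posdual (r + 2) (r + 1) a \<alpha>" and \<alpha>': "posdual (r + 2) (r + 1) a \<alpha>'" and j: "j \<le> r"
  shows "Im (x (\<alpha>' j) / x \<gamma>) = of_int (P (\<alpha>' j) (a j)) / of_int (P (\<alpha> j) (a j)) * Im (x (\<alpha> j) / x \<gamma>)"
proof -
  have "\<alpha>' j \<in> L" using \<alpha>' j by (auto simp: posdual_def)
  then have "Im (x (\<alpha>' j) / x \<gamma>) = (\<Sum>k\<le>r. of_int (P (\<alpha>' j) (a k)) / of_int (P (\<alpha> k) (a k)) * Im (x (\<alpha> k) / x \<gamma>))"
    by (rule Im_formula[OF \<alpha>])
  also have "\<dots> = (\<Sum>k\<le>r. if k = j then of_int (P (\<alpha>' j) (a j)) / of_int (P (\<alpha> j) (a j)) * Im (x (\<alpha> j) / x \<gamma>) else 0)"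
    using \<alpha>' j by (intro sum.cong) (auto simp: posdual_def)
  finally show ?thesis using j by simp
qed

text \<open>For each m a character of the lattice that is trivial on \<gamma>, hence a function of
  \<open>idx\<close> alone.\<close>

definition Q :: "int \<Rightarrow> (nat \<Rightarrow> int) \<Rightarrow> complex" where
  "Q m \<delta> = qexp (of_int m * (x \<delta> / x \<gamma>))"

lemma Q_idx_cong:
  assumes "\<delta> \<in> L" "\<delta>' \<in> L" "idx \<delta> = idx \<delta>'"
  shows "Q m \<delta>' = Q m \<delta>"
proof -
  obtain k where "x \<delta>' / x \<gamma> = x \<delta> / x \<gamma> + of_int k" using idx_eq_imp(2)[OF assms] by blast
  then have "of_int m * (x \<delta>' / x \<gamma>) = of_int m * (x \<delta> / x \<gamma>) + of_int (m * k)"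
    by (simp add: distrib_left)
  then show ?thesis unfolding Q_def by (simp only: qexp_add qexp_of_int mult_1_right)
qed

lemma Q_sec: "\<delta> \<in> L \<Longrightarrow> Q m (sec (idx \<delta>)) = Q m \<delta>"
  using sec[of \<delta>] by (intro Q_idx_cong) auto

lemma Q_power: "\<delta> \<in> L \<Longrightarrow> Q m (\<lambda>i. int k * \<delta> i) = Q m \<delta> ^ k"
proof -
  assume "\<delta> \<in> L"
  then have "of_int m * (x (\<lambda>i. int k * \<delta> i) / x \<gamma>) = of_nat k * (of_int m * (x \<delta> / x \<gamma>))"
    by (simp add: hom_scale[OF hom])
  then show ?thesis unfolding Q_def by (simp only: qexp_of_nat_mult)
qed

lemma Q_add_combination:
  assumes "\<delta> \<in> L" "\<And>j. j \<le> r \<Longrightarrow> \<alpha> j \<in> L"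
  shows "Q m (\<lambda>i. \<delta> i + (\<Sum>j\<le>r. int (k j) * \<alpha> j i)) = Q m \<delta> * (\<Prod>j\<le>r. Q m (\<alpha> j) ^ k j)"
proof -
  have "x (\<lambda>i. \<delta> i + (\<Sum>j\<le>r. int (k j) * \<alpha> j i)) = x \<delta> + (\<Sum>j\<le>r. x (\<lambda>i. int (k j) * \<alpha> j i))"
    using assms by (subst hom_add[OF hom]) (auto intro!: lat_sum lat_scale hom_sum[OF hom])
  then have "Q m (\<lambda>i. \<delta> i + (\<Sum>j\<le>r. int (k j) * \<alpha> j i)) = Q m \<delta> * (\<Prod>j\<le>r. Q m (\<lambda>i. int (k j) * \<alpha> j i))"
    by (simp add: Q_def add_divide_distrib distrib_left qexp_add sum_divide_distrib sum_distrib_left qexp_sum)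
  then show ?thesis using assms by (simp add: Q_power)
qed

text \<open>Division with remainder in each coordinate writes an element of the large box uniquely
  as an element of the small box plus a combination of the \<open>\<alpha> j\<close> with
  coefficients below \<open>c' j\<close>, modulo \<gamma>. The character turns this into a
  product.\<close>

lemma sum_box_refine:
  assumes \<alpha>: "posdual (r + 2) (r + 1) a \<alpha>" and c': "\<And>j. j \<le> r \<Longrightarrow> c' j > 0"
  shows "(\<Sum>v\<in>box (\<lambda>j. P (\<alpha> j) (a j)). Q m (sec v)) * (\<Prod>j\<le>r. \<Sum>i<nat (c' j). Q m (\<alpha> j) ^ i) =
         (\<Sum>v\<in>box (\<lambda>j. P (\<alpha> j) (a j) * c' j). Q m (sec v))"
proof -
  define c where "c j = P (\<alpha> j) (a j)" for j
  have c: "c j > 0" "\<alpha> j \<in> L" if "j \<le> r" for j using \<alpha> that by (auto simp: posdual_def c_def)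
  define K where "K = PiE {..r} (\<lambda>j. {..<nat (c' j)})"
  define join where "join = (\<lambda>(v, k). restrict (\<lambda>j. v j + int (k j) * c j) {..r})"
  define split where "split v = (restrict (\<lambda>j. v j mod c j) {..r}, restrict (\<lambda>j. nat (v j div c j)) {..r})" for v
  have P_comb: "P (\<lambda>i. \<delta> i + (\<Sum>j\<le>r. f j * \<alpha> j i)) (a l) = P \<delta> (a l) + f l * c l" if "l \<le> r" for \<delta> f l
  proof -
    have "(\<Sum>j\<le>r. f j * P (\<alpha> j) (a l)) = (\<Sum>j\<le>r. if j = l then f l * c l else 0)"
      using \<alpha> that by (intro sum.cong) (auto simp: posdual_def c_def)
    then show ?thesis using that by (simp add: pair_linear)
  qed
  have join_idx: "join (idx \<delta>, k) = idx (\<lambda>i. \<delta> i + (\<Sum>j\<le>r. int (k j) * \<alpha> j i))" for \<delta> k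
    unfolding join_def idx_def prod.case by (rule restrict_ext) (simp only: P_comb restrict_apply' atMost_iff)
  have "(\<Prod>j\<le>r. \<Sum>i<nat (c' j). Q m (\<alpha> j) ^ i) = (\<Sum>k\<in>K. \<Prod>j\<le>r. Q m (\<alpha> j) ^ k j)"
    unfolding K_def by (rule prod_sum_PiE) auto
  then have "(\<Sum>v\<in>box c. Q m (sec v)) * (\<Prod>j\<le>r. \<Sum>i<nat (c' j). Q m (\<alpha> j) ^ i) =
             (\<Sum>(v, k)\<in>box c \<times> K. Q m (sec v) * (\<Prod>j\<le>r. Q m (\<alpha> j) ^ k j))"
    by (simp add: sum_product sum.cartesian_product)
  also have "\<dots> = (\<Sum>v\<in>box (\<lambda>j. c j * c' j). Q m (sec v))"
  proof (rule sum.reindex_bij_witness[where i = split and j = join])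
    fix vk assume "vk \<in> box c \<times> K"
    then obtain \<delta> k where vk: "vk = (idx \<delta>, k)" "\<delta> \<in> L" "\<And>j. j \<le> r \<Longrightarrow> 0 \<le> P \<delta> (a j)"
        "\<And>j. j \<le> r \<Longrightarrow> P \<delta> (a j) < c j" "k \<in> K"
      by (auto simp: box_def)
    have kj: "int (k j) < c' j" if "j \<le> r" for j using vk(5) that by (auto simp: K_def PiE_def Pi_def)
    have kext: "k \<in> extensional {..r}" using vk(5) by (auto simp: K_def PiE_def)
    have dm: "(P \<delta> (a j) + int (k j) * c j) mod c j = P \<delta> (a j)"
             "(P \<delta> (a j) + int (k j) * c j) div c j = int (k j)" if "j \<le> r" for j
      using vk(3,4)[OF that] c(1)[OF that] by simp_all
    have idx_app: "idx \<delta> j = P \<delta> (a j)" if "j \<le> r" for j using that by (simp add: idx_def)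
    let ?\<delta> = "\<lambda>i. \<delta> i + (\<Sum>j\<le>r. int (k j) * \<alpha> j i)"
    have \<delta>L: "?\<delta> \<in> L" using vk(2) c(2) by (intro lat_intros) auto
    show "split (join vk) = vk"
      unfolding vk(1) split_def join_def prod.case
    proof (intro arg_cong2[of _ _ _ _ Pair])
      show "restrict (\<lambda>j. restrict (\<lambda>j. idx \<delta> j + int (k j) * c j) {..r} j mod c j) {..r} = idx \<delta>"
      proof (rule extensionalityI[OF restrict_extensional])
        fix j assume "j \<in> {..r}"
        then show "restrict (\<lambda>j. restrict (\<lambda>j. idx \<delta> j + int (k j) * c j) {..r} j mod c j) {..r} j = idx \<delta> j"
          using dm(1)[of j] by (simp only: restrict_apply' idx_app atMost_iff)
      qed (simp add: idx_def)
      show "restrict (\<lambda>j. nat (restrict (\<lambda>j. idx \<delta> j + int (k j) * c j) {..r} j div c j)) {..r} = k"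
      proof (rule extensionalityI[OF restrict_extensional kext])
        fix j assume "j \<in> {..r}"
        then show "restrict (\<lambda>j. nat (restrict (\<lambda>j. idx \<delta> j + int (k j) * c j) {..r} j div c j)) {..r} j = k j"
          using dm(2)[of j] by (simp only: restrict_apply' idx_app atMost_iff nat_int)
      qed
    qed
    show "join vk \<in> box (\<lambda>j. c j * c' j)"
      unfolding vk(1) join_idx box_def
    proof (intro imageI CollectI conjI allI impI \<delta>L)
      fix j assume j: "j \<le> r"
      show "0 \<le> P ?\<delta> (a j)" using P_comb[OF j] vk(3)[OF j] c(1)[OF j] by simp
      have "P ?\<delta> (a j) < c j + int (k j) * c j" using P_comb[OF j] vk(4)[OF j] by simp
      also have "\<dots> = (int (k j) + 1) * c j" by (simp add: algebra_simps)
      also have "\<dots> \<le> c' j * c j" using kj[OF j] c(1)[OF j] by (intro mult_right_mono) auto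
      finally show "P ?\<delta> (a j) < c j * c' j" by (simp add: mult.commute)
    qed
    show "Q m (sec (join vk)) = (case vk of (v, k) \<Rightarrow> Q m (sec v) * (\<Prod>j\<le>r. Q m (\<alpha> j) ^ k j))"
      unfolding vk(1) join_idx prod.case Q_sec[OF \<delta>L] Q_sec[OF vk(2)]
      using vk(2) c(2) by (rule Q_add_combination)
  next
    fix v assume "v \<in> box (\<lambda>j. c j * c' j)"
    then obtain \<delta> where \<delta>: "v = idx \<delta>" "\<delta> \<in> L" "\<And>j. j \<le> r \<Longrightarrow> 0 \<le> P \<delta> (a j)"
        "\<And>j. j \<le> r \<Longrightarrow> P \<delta> (a j) < c j * c' j"
      by (auto simp: box_def)
    have div0: "P \<delta> (a j) div c j \<ge> 0" if "j \<le> r" for j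
      using \<delta>(3)[OF that] c(1)[OF that] by (simp add: pos_imp_zdiv_nonneg_iff)
    show "join (split v) = v"
      unfolding \<delta>(1) split_def join_def prod.case
    proof (rule extensionalityI[OF restrict_extensional])
      fix j assume "j \<in> {..r}"
      then have "int (nat (P \<delta> (a j) div c j)) = P \<delta> (a j) div c j"
        by (intro nat_0_le div0) (simp only: atMost_iff)
      then have "P \<delta> (a j) mod c j + int (nat (P \<delta> (a j) div c j)) * c j = P \<delta> (a j)"
        by (simp only: mod_div_mult_eq)
      with \<open>j \<in> {..r}\<close> show "restrict (\<lambda>j. restrict (\<lambda>j. idx \<delta> j mod c j) {..r} j +
          int (restrict (\<lambda>j. nat (idx \<delta> j div c j)) {..r} j) * c j) {..r} j = idx \<delta> j"
        by (simp only: restrict_apply' idx_def)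
    qed (simp add: idx_def)
    \<comment> \<open>Subtracting multiples of the \<open>\<alpha> j\<close> shows that the tuple of
      remainders is again realised in the lattice, as membership in \<open>box c\<close>
      requires.\<close>
    let ?\<delta> = "\<lambda>i. \<delta> i + (\<Sum>j\<le>r. (- (P \<delta> (a j) div c j)) * \<alpha> j i)"
    have \<delta>L: "?\<delta> \<in> L"
      using \<delta>(2) c(2) by (simp add: lat_iff)
    have P\<delta>: "P ?\<delta> (a j) = P \<delta> (a j) mod c j" if "j \<le> r" for j
      unfolding P_comb[OF that] by (simp add: minus_div_mult_eq_mod)
    have "restrict (\<lambda>j. v j mod c j) {..r} = idx ?\<delta>"
      unfolding \<delta>(1) idx_def by (rule restrict_ext) (simp only: P\<delta> restrict_apply' atMost_iff)
    moreover have "idx ?\<delta> \<in> box c"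
      unfolding box_def using \<delta>L P\<delta> c(1) by (intro imageI) auto
    moreover have "restrict (\<lambda>j. nat (v j div c j)) {..r} \<in> K"
      unfolding K_def
    proof (rule restrict_PiE_iff[THEN iffD2], intro ballI)
      fix j assume "j \<in> {..r}"
      then have j: "j \<le> r" by simp
      have "P \<delta> (a j) div c j < c' j"
      proof -
        have "P \<delta> (a j) div c j * c j \<le> P \<delta> (a j)"
          using pos_mod_sign[OF c(1)[OF j], of "P \<delta> (a j)"] div_mult_mod_eq[of "P \<delta> (a j)" "c j"] by linarith
        also have "\<dots> < c' j * c j" using \<delta>(4)[OF j] by (simp add: mult.commute)
        finally show ?thesis using c(1)[OF j] by (simp add: mult_less_cancel_right_pos)
      qed
      then show "nat (v j div c j) \<in> {..<nat (c' j)}"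
        using j div0[OF j] c'[OF j] by (simp add: \<delta>(1) idx_def)
    qed
    ultimately show "split v \<in> box c \<times> K" unfolding split_def by simp
  qed
  finally show ?thesis unfolding c_def .
qed


lemma posdualD:
  assumes "posdual (r + 2) (r + 1) a \<alpha>" "j \<le> r"
  shows "\<alpha> j \<in> L" "P (\<alpha> j) (a j) > 0" "k \<le> r \<Longrightarrow> k \<noteq> j \<Longrightarrow> P (\<alpha> j) (a k) = 0"
  using assms unfolding posdual_def by auto

definition nonreal :: "(nat \<Rightarrow> nat \<Rightarrow> int) \<Rightarrow> bool" where
  "nonreal \<alpha> \<longleftrightarrow> (\<forall>j\<le>r. Im (x (\<alpha> j) / x \<gamma>) \<noteq> 0)"

lemma nonreal_posdual:
  assumes "posdual (r + 2) (r + 1) a \<alpha>" "posdual (r + 2) (r + 1) a \<alpha>'" "nonreal \<alpha>"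
  shows "nonreal \<alpha>'"
  unfolding nonreal_def
proof (intro allI impI)
  fix j assume j: "j \<le> r"
  have "P (\<alpha> j) (a j) \<noteq> 0" "P (\<alpha>' j) (a j) \<noteq> 0"
    using posdualD(2)[OF assms(1) j] posdualD(2)[OF assms(2) j] by auto
  then show "Im (x (\<alpha>' j) / x \<gamma>) \<noteq> 0"
    using Im_dual_ratio[OF assms(1,2) j] assms(3) j unfolding nonreal_def by simp
qed

lemma nterm_sum_factor:
  "(\<Sum>v\<in>A. nterm r (\<lambda>j. x (\<alpha> j) / x \<gamma>) ((w + x (sec v)) / x \<gamma>) m) =
   qexp (of_int m * (w / x \<gamma>)) / of_int m * ((\<Sum>v\<in>A. Q m (sec v)) / (\<Prod>j\<le>r. Q m (\<alpha> j) - 1))"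
proof -
  have "nterm r (\<lambda>j. x (\<alpha> j) / x \<gamma>) ((w + x (sec v)) / x \<gamma>) m =
        qexp (of_int m * (w / x \<gamma>)) / of_int m * (Q m (sec v) / (\<Prod>j\<le>r. Q m (\<alpha> j) - 1))" for v
    by (simp add: nterm_def Q_def add_divide_distrib distrib_left qexp_add)
  then show ?thesis by (simp only: sum_distrib_left sum_divide_distrib)
qed

lemma Q_neq_1:
  assumes "nonreal \<alpha>" "j \<le> r" "m \<noteq> 0" "N > 0"
  shows "Q m (\<alpha> j) ^ N \<noteq> 1"
proof
  assume "Q m (\<alpha> j) ^ N = 1"
  then have "qexp (of_nat N * (of_int m * (x (\<alpha> j) / x \<gamma>))) = 1" unfolding qexp_of_nat_mult Q_def .
  then have "Im (of_nat N * (of_int m * (x (\<alpha> j) / x \<gamma>))) = 0" by (rule qexp_eq_1_imp_real)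
  then have "real N * (of_int m * Im (x (\<alpha> j) / x \<gamma>)) = 0"
    by (metis Im_of_int_mult of_int_of_nat_eq)
  with assms show False by (auto simp: nonreal_def)
qed

text \<open>Scaling \<open>\<alpha> j\<close> by \<open>c' j\<close> multiplies numerator and
  denominator by the same finite geometric sums, which are nonzero because \<open>nonreal\<close>
  keeps the powers of \<open>Q m (\<alpha> j)\<close> away from 1.\<close>

lemma sum_box_quotient:
  assumes \<alpha>: "posdual (r + 2) (r + 1) a \<alpha>" "nonreal \<alpha>" and m: "m \<noteq> 0" and c': "\<And>j. j \<le> r \<Longrightarrow> c' j > 0"
  shows "(\<Sum>v\<in>box (\<lambda>j. P (\<alpha> j) (a j)). Q m (sec v)) / (\<Prod>j\<le>r. Q m (\<alpha> j) - 1) =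
         (\<Sum>v\<in>box (\<lambda>j. P (\<alpha> j) (a j) * c' j). Q m (sec v)) / (\<Prod>j\<le>r. Q m (\<alpha> j) ^ nat (c' j) - 1)"
proof -
  have fac: "Q m (\<alpha> j) ^ nat (c' j) - 1 = (Q m (\<alpha> j) - 1) * (\<Sum>i<nat (c' j). Q m (\<alpha> j) ^ i)" for j
    by (rule power_diff_1_eq)
  have "(\<Sum>i<nat (c' j). Q m (\<alpha> j) ^ i) \<noteq> 0" if "j \<le> r" for j
    using fac[of j] Q_neq_1[OF \<alpha>(2) that m, of "nat (c' j)"] c'[OF that] by auto
  then have "(\<Prod>j\<le>r. \<Sum>i<nat (c' j). Q m (\<alpha> j) ^ i) \<noteq> 0" by simp
  note cancel = mult_divide_mult_cancel_right[OF this]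
  show ?thesis
    unfolding fac prod.distrib
    by (subst sum_box_refine[OF \<alpha>(1) c', symmetric], assumption) (rule cancel[symmetric])
qed

text \<open>Both boxes refine to the one with sides
  \<open>P (\<alpha> j) (a j) * P (\<alpha>' j) (a j)\<close>. There the denominators agree, since
  the two rescaled families have equal values on all \<open>a k\<close> and so differ by multiples
  of \<gamma>.\<close>

lemma nterm_sum_indep:
  assumes \<alpha>: "posdual (r + 2) (r + 1) a \<alpha>" "nonreal \<alpha>" and \<alpha>': "posdual (r + 2) (r + 1) a \<alpha>'"
  shows "(\<Sum>v\<in>box (\<lambda>j. P (\<alpha> j) (a j)). nterm r (\<lambda>j. x (\<alpha> j) / x \<gamma>) ((w + x (sec v)) / x \<gamma>) m) =
         (\<Sum>v\<in>box (\<lambda>j. P (\<alpha>' j) (a j)). nterm r (\<lambda>j. x (\<alpha>' j) / x \<gamma>) ((w + x (sec v)) / x \<gamma>) m)"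
proof (cases "m = 0")
  case False
  have pos: "P (\<alpha> j) (a j) > 0" "P (\<alpha>' j) (a j) > 0" "\<alpha> j \<in> L" "\<alpha>' j \<in> L" if "j \<le> r" for j
    using posdualD[OF \<alpha>(1) that] posdualD[OF \<alpha>' that] by auto
  have "Q m (\<alpha> j) ^ nat (P (\<alpha>' j) (a j)) = Q m (\<alpha>' j) ^ nat (P (\<alpha> j) (a j))" if j: "j \<le> r" for j
  proof -
    have "Q m (\<lambda>i. int (nat (P (\<alpha>' j) (a j))) * \<alpha> j i) = Q m (\<lambda>i. int (nat (P (\<alpha> j) (a j))) * \<alpha>' j i)"
    proof (rule Q_idx_cong)
      show "(\<lambda>i. int (nat (P (\<alpha>' j) (a j))) * \<alpha> j i) \<in> L" "(\<lambda>i. int (nat (P (\<alpha> j) (a j))) * \<alpha>' j i) \<in> L"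
        by (intro lat_scale pos j)+
      have "int (nat (P (\<alpha> j) (a j))) * P (\<alpha>' j) (a k) = int (nat (P (\<alpha>' j) (a j))) * P (\<alpha> j) (a k)" if "k \<le> r" for k
        using pos[OF j] posdualD(3)[OF \<alpha>(1) j that] posdualD(3)[OF \<alpha>' j that]
        by (cases "k = j") (simp_all add: mult.commute)
      then show "idx (\<lambda>i. int (nat (P (\<alpha> j) (a j))) * \<alpha>' j i) = idx (\<lambda>i. int (nat (P (\<alpha>' j) (a j))) * \<alpha> j i)"
        by (simp only: idx_eq_iff pair_scale) simp
    qed
    then show ?thesis by (simp only: Q_power pos j)
  qed
  then have prod_eq: "(\<Prod>j\<le>r. Q m (\<alpha> j) ^ nat (P (\<alpha>' j) (a j)) - 1) = (\<Prod>j\<le>r. Q m (\<alpha>' j) ^ nat (P (\<alpha> j) (a j)) - 1)"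
    by (intro prod.cong) auto
  have box_eq: "box (\<lambda>j. P (\<alpha> j) (a j) * P (\<alpha>' j) (a j)) = box (\<lambda>j. P (\<alpha>' j) (a j) * P (\<alpha> j) (a j))"
    by (simp only: mult.commute)
  have "(\<Sum>v\<in>box (\<lambda>j. P (\<alpha> j) (a j)). Q m (sec v)) / (\<Prod>j\<le>r. Q m (\<alpha> j) - 1) =
        (\<Sum>v\<in>box (\<lambda>j. P (\<alpha> j) (a j) * P (\<alpha>' j) (a j)). Q m (sec v)) / (\<Prod>j\<le>r. Q m (\<alpha> j) ^ nat (P (\<alpha>' j) (a j)) - 1)"
    by (rule sum_box_quotient[OF \<alpha> False pos(2)])
  also have "\<dots> = (\<Sum>v\<in>box (\<lambda>j. P (\<alpha>' j) (a j) * P (\<alpha> j) (a j)). Q m (sec v)) / (\<Prod>j\<le>r. Q m (\<alpha>' j) ^ nat (P (\<alpha> j) (a j)) - 1)"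
    unfolding prod_eq box_eq ..
  also have "\<dots> = (\<Sum>v\<in>box (\<lambda>j. P (\<alpha>' j) (a j)). Q m (sec v)) / (\<Prod>j\<le>r. Q m (\<alpha>' j) - 1)"
    by (rule sum_box_quotient[OF \<alpha>' nonreal_posdual[OF \<alpha>(1) \<alpha>' \<alpha>(2)] False pos(1), symmetric])
  finally show ?thesis unfolding nterm_sum_factor by (rule arg_cong)
qed (simp add: nterm_def)

section \<open>Common domain of convergence and continuation in w\<close>

definition region :: "(nat \<Rightarrow> nat \<Rightarrow> int) \<Rightarrow> complex set" where
  "region \<alpha> = (\<Inter>v\<in>box (\<lambda>j. P (\<alpha> j) (a j)).
     {w. (\<Sum>j\<le>r. min 0 (Im (x (\<alpha> j) / x \<gamma>))) < Im ((w + x (sec v)) / x \<gamma>)} \<inter>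
     {w. Im ((w + x (sec v)) / x \<gamma>) < (\<Sum>j\<le>r. max 0 (Im (x (\<alpha> j) / x \<gamma>)))})"

lemma open_region: "open (region \<alpha>)"
  unfolding region_def using x\<gamma>
  by (intro open_INT open_Int open_Collect_less continuous_intros finite_box ballI) auto

text \<open>The values of a box element on \<open>a j\<close> are integers, hence at most
  \<open>P (\<alpha> j) (a j) - 1\<close>. This leaves room for a shift \<theta> strictly between 0
  and 1 in every coordinate.\<close>

lemma in_region:
  assumes \<alpha>: "posdual (r + 2) (r + 1) a \<alpha>" "nonreal \<alpha>"
    and w: "Im (w / x \<gamma>) = (\<Sum>j\<le>r. \<theta> j / of_int (P (\<alpha> j) (a j)) * Im (x (\<alpha> j) / x \<gamma>))"
    and \<theta>: "\<And>j. j \<le> r \<Longrightarrow> 0 < \<theta> j" "\<And>j. j \<le> r \<Longrightarrow> \<theta> j < 1"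
  shows "w \<in> region \<alpha>"
proof -
  have "(\<Sum>j\<le>r. min 0 (Im (x (\<alpha> j) / x \<gamma>))) < Im ((w + x (sec v)) / x \<gamma>) \<and>
        Im ((w + x (sec v)) / x \<gamma>) < (\<Sum>j\<le>r. max 0 (Im (x (\<alpha> j) / x \<gamma>)))"
    if v: "v \<in> box (\<lambda>j. P (\<alpha> j) (a j))" for v
  proof -
    obtain \<delta>' where \<delta>': "v = idx \<delta>'" "\<delta>' \<in> L" "\<And>j. j \<le> r \<Longrightarrow> 0 \<le> P \<delta>' (a j) \<and> P \<delta>' (a j) < P (\<alpha> j) (a j)"
      using v by (auto simp: box_def)
    define \<delta> where "\<delta> = sec v"
    have \<delta>L: "\<delta> \<in> L" and "idx \<delta> = idx \<delta>'" using sec[OF \<delta>'(2)] by (auto simp: \<delta>_def \<delta>'(1))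
    then have \<delta>: "0 \<le> P \<delta> (a j) \<and> P \<delta> (a j) < P (\<alpha> j) (a j)" if "j \<le> r" for j
      using \<delta>'(3)[OF that] that by (simp add: idx_eq_iff)
    define u where "u j = (\<theta> j + of_int (P \<delta> (a j))) / of_int (P (\<alpha> j) (a j))" for j
    have u: "0 < u j" "u j < 1" if "j \<le> r" for j
    proof -
      have 1: "0 \<le> real_of_int (P \<delta> (a j))" "real_of_int (P \<delta> (a j)) + 1 \<le> real_of_int (P (\<alpha> j) (a j))"
        using \<delta>[OF that] by linarith+
      show "0 < u j" "u j < 1"
        unfolding u_def using 1 \<theta>[OF that] by (auto simp: divide_less_eq intro!: divide_pos_pos)
    qed
    have "Im ((w + x \<delta>) / x \<gamma>) = Im (w / x \<gamma>) + Im (x \<delta> / x \<gamma>)" by (simp add: add_divide_distrib)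
    also have "\<dots> = (\<Sum>j\<le>r. u j * Im (x (\<alpha> j) / x \<gamma>))"
      unfolding w Im_formula[OF \<alpha>(1) \<delta>L] sum.distrib[symmetric] u_def
      by (intro sum.cong refl) (simp only: add_divide_distrib distrib_right)
    finally show ?thesis
      using sum_interpolation_less[of r "\<lambda>j. Im (x (\<alpha> j) / x \<gamma>)" u] u \<alpha>(2)
      unfolding \<delta>_def nonreal_def by simp
  qed
  then show ?thesis unfolding region_def by blast
qed

text \<open>A small positive multiple of the sum of the \<open>x (\<alpha> j)\<close> lies in both
  regions: its shifts \<theta> are the same for both families because \<open>\<alpha> j\<close> and
  \<open>\<alpha>' j\<close> are proportional modulo \<gamma>. The factor \<eta> makes all shifts
  less than 1.\<close>

lemma regions_meet:
  assumes \<alpha>: "posdual (r + 2) (r + 1) a \<alpha>" "nonreal \<alpha>" and \<alpha>': "posdual (r + 2) (r + 1) a \<alpha>'"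
  shows "region \<alpha> \<inter> region \<alpha>' \<noteq> {}"
proof -
  define c where "c j = P (\<alpha> j) (a j)" for j
  have c: "c j > 0" if "j \<le> r" for j using \<alpha>(1) that by (auto simp: posdual_def c_def)
  define \<eta> where "\<eta> = 1 / (1 + real_of_int (\<Sum>j\<le>r. c j))"
  have cs: "c j \<le> (\<Sum>j\<le>r. c j)" if "j \<le> r" for j
    using that c by (intro member_le_sum) (auto simp: less_imp_le)
  have \<theta>: "0 < \<eta> * of_int (c j)" "\<eta> * of_int (c j) < 1" if "j \<le> r" for j
  proof -
    have "0 < real_of_int (c j)" "real_of_int (c j) < 1 + real_of_int (\<Sum>j\<le>r. c j)"
      using c[OF that] cs[OF that] by linarith+
    then show "0 < \<eta> * of_int (c j)" "\<eta> * of_int (c j) < 1" by (auto simp: \<eta>_def divide_simps)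
  qed
  define w where "w = of_real \<eta> * (\<Sum>j\<le>r. x (\<alpha> j))"
  have w: "Im (w / x \<gamma>) = (\<Sum>j\<le>r. \<eta> * Im (x (\<alpha> j) / x \<gamma>))"
  proof -
    have "w / x \<gamma> = of_real \<eta> * (\<Sum>j\<le>r. x (\<alpha> j) / x \<gamma>)" unfolding w_def times_divide_eq_right[symmetric] sum_divide_distrib ..
    moreover have "Im (of_real \<eta> * z) = \<eta> * Im z" for z by simp
    ultimately show ?thesis by (simp only: Im_sum sum_distrib_left)
  qed
  have "w \<in> region \<alpha>"
  proof (rule in_region[OF \<alpha>, of _ "\<lambda>j. \<eta> * of_int (c j)"])
    show "Im (w / x \<gamma>) = (\<Sum>j\<le>r. \<eta> * of_int (c j) / of_int (P (\<alpha> j) (a j)) * Im (x (\<alpha> j) / x \<gamma>))"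
      unfolding w by (intro sum.cong refl) (use c in \<open>force simp: c_def\<close>)
  qed (use \<theta> in auto)
  moreover have "w \<in> region \<alpha>'"
  proof (rule in_region[OF \<alpha>' nonreal_posdual[OF \<alpha>(1) \<alpha>' \<alpha>(2)], of _ "\<lambda>j. \<eta> * of_int (c j)"])
    show "Im (w / x \<gamma>) = (\<Sum>j\<le>r. \<eta> * of_int (c j) / of_int (P (\<alpha>' j) (a j)) * Im (x (\<alpha>' j) / x \<gamma>))"
      unfolding w
    proof (intro sum.cong refl)
      fix j assume "j \<in> {..r}"
      then have j: "j \<le> r" by simp
      have nz: "P (\<alpha>' j) (a j) \<noteq> 0" "c j \<noteq> 0" using posdualD(2)[OF \<alpha>' j] c[OF j] by auto
      show "\<eta> * Im (x (\<alpha> j) / x \<gamma>) = \<eta> * of_int (c j) / of_int (P (\<alpha>' j) (a j)) * Im (x (\<alpha>' j) / x \<gamma>)"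
        unfolding Im_dual_ratio[OF \<alpha>(1) \<alpha>' j] c_def[symmetric] using nz by simp
    qed
  qed (use \<theta> in auto)
  ultimately show ?thesis by blast
qed

lemma Gprod_eq_exp:
  assumes "nonreal \<alpha>" "w \<in> region \<alpha>"
  shows "\<exists>s. (\<lambda>l. (\<Sum>v\<in>box (\<lambda>j. P (\<alpha> j) (a j)). nterm r (\<lambda>j. x (\<alpha> j) / x \<gamma>) ((w + x (sec v)) / x \<gamma>) (int l)) +
           (\<Sum>v\<in>box (\<lambda>j. P (\<alpha> j) (a j)). nterm r (\<lambda>j. x (\<alpha> j) / x \<gamma>) ((w + x (sec v)) / x \<gamma>) (- int l))) sums s \<and>
         Gprod \<alpha> w = exp s"
proof -
  define B where "B = box (\<lambda>j. P (\<alpha> j) (a j))"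
  define T where "T v = nterm r (\<lambda>j. x (\<alpha> j) / x \<gamma>) ((w + x (sec v)) / x \<gamma>)" for v
  have "\<exists>s. (\<lambda>l. T v (int l) + T v (- int l)) sums s \<and> nishG r (\<lambda>j. x (\<alpha> j) / x \<gamma>) ((w + x (sec v)) / x \<gamma>) = exp s"
    if "v \<in> B" for v
    unfolding T_def by (rule nishG_eq_exp) (use assms that in \<open>auto simp: nonreal_def region_def B_def\<close>)
  then have "\<forall>v\<in>B. \<exists>s. (\<lambda>l. T v (int l) + T v (- int l)) sums s \<and>
               nishG r (\<lambda>j. x (\<alpha> j) / x \<gamma>) ((w + x (sec v)) / x \<gamma>) = exp s" ..
  from bchoice[OF this] obtain s where s: "\<And>v. v \<in> B \<Longrightarrow> (\<lambda>l. T v (int l) + T v (- int l)) sums s v"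
     "\<And>v. v \<in> B \<Longrightarrow> nishG r (\<lambda>j. x (\<alpha> j) / x \<gamma>) ((w + x (sec v)) / x \<gamma>) = exp (s v)"
    by blast
  have "(\<lambda>l. \<Sum>v\<in>B. T v (int l) + T v (- int l)) sums (\<Sum>v\<in>B. s v)"
    by (rule sums_sum) (rule s(1))
  moreover have "Gprod \<alpha> w = exp (\<Sum>v\<in>B. s v)"
    unfolding Gprod_def B_def[symmetric] by (simp add: s(2) exp_sum B_def)
  ultimately show ?thesis unfolding sum.distrib T_def B_def by blast
qed

lemma meromorphic_Gprod:
  assumes "nonreal \<alpha>"
  shows "Gprod \<alpha> meromorphic_on UNIV"
  unfolding Gprod_def[abs_def]
proof (rule meromorphic_on_prod)
  fix v
  have "nishG r (\<lambda>j. x (\<alpha> j) / x \<gamma>) meromorphic_on UNIV"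
    using assms by (intro meromorphic_nishG) (auto simp: nonreal_def)
  moreover have "(\<lambda>w. (w + x (sec v)) / x \<gamma>) analytic_on UNIV"
    by (intro analytic_intros) (use x\<gamma> in simp)
  ultimately show "(\<lambda>w. nishG r (\<lambda>j. x (\<alpha> j) / x \<gamma>) ((w + x (sec v)) / x \<gamma>)) meromorphic_on UNIV"
    by (rule meromorphic_on_compose) simp
qed

theorem Gprod_indep:
  assumes \<alpha>: "posdual (r + 2) (r + 1) a \<alpha>" "nonreal \<alpha>" and \<alpha>': "posdual (r + 2) (r + 1) a \<alpha>'"
  shows "eventually (\<lambda>w. Gprod \<alpha> w = Gprod \<alpha>' w) (cosparse UNIV)"
proof (rule meromorphic_eq_cosparse[where U = "region \<alpha> \<inter> region \<alpha>'"])
  have nr: "nonreal \<alpha>'" by (rule nonreal_posdual[OF \<alpha>(1) \<alpha>' \<alpha>(2)])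
  show "Gprod \<alpha> meromorphic_on UNIV" "Gprod \<alpha>' meromorphic_on UNIV"
    using \<alpha>(2) nr by (auto intro: meromorphic_Gprod)
  show "open (region \<alpha> \<inter> region \<alpha>')" by (intro open_Int open_region)
  show "region \<alpha> \<inter> region \<alpha>' \<noteq> {}" by (rule regions_meet[OF \<alpha> \<alpha>'])
  fix w assume "w \<in> region \<alpha> \<inter> region \<alpha>'"
  then show "Gprod \<alpha> w = Gprod \<alpha>' w"
    using Gprod_eq_exp[OF \<alpha>(2), of w] Gprod_eq_exp[OF nr, of w]
    unfolding nterm_sum_indep[OF \<alpha> \<alpha>'] by (auto dest: sums_unique2)
qed

end

subsection \<open>Equivariance\<close>

lemma lcomp_lat [simp]: "lcomp n \<delta> g \<in> lat n"
  by (simp add: lcomp_def lat_def)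

lemma pair_lcomp: "pair n (lcomp n \<delta> g) v = pair n \<delta> (gact n g v)"
proof -
  have "pair n (lcomp n \<delta> g) v = (\<Sum>l<n. \<Sum>i<n. \<delta> i * g i l * v l)"
    unfolding pair_def lcomp_def by (rule sum.cong) (auto simp: sum_distrib_right)
  also have "\<dots> = (\<Sum>i<n. \<Sum>l<n. \<delta> i * g i l * v l)" by (rule sum.swap)
  also have "\<dots> = pair n \<delta> (gact n g v)"
    unfolding pair_def gact_def by (rule sum.cong) (auto simp: sum_distrib_left mult.assoc)
  finally show ?thesis .
qed

lemma lcomp_scale: "lcomp n (\<lambda>i. k * \<delta> i) g = (\<lambda>i. k * lcomp n \<delta> g i)"
  by (auto simp: lcomp_def fun_eq_iff sum_distrib_left mult.assoc)

text \<open>For determinant 1 the adjugate matrix is an integral inverse.\<close>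

lemma SL_inverse:
  assumes "g \<in> SL n"
  shows "\<exists>h. (\<forall>i<n. \<forall>j<n. (\<Sum>k<n. g i k * h k j) = (if i = j then 1 else 0)) \<and>
           (\<forall>i<n. \<forall>j<n. (\<Sum>k<n. h i k * g k j) = (if i = j then 1 else 0))"
proof -
  define G where "G = mat n n (\<lambda>(i, j). g i j)"
  have G: "G \<in> carrier_mat n n" and det: "det G = 1" using assms by (auto simp: G_def SL_def)
  note adj = adj_mat[OF G]
  define h where "h k j = adj_mat G $$ (k, j)" for k j
  have dim: "dim_row (adj_mat G) = n" "dim_col (adj_mat G) = n" using adj(1) by auto
  have "(\<Sum>k<n. g i k * h k j) = (G * adj_mat G) $$ (i, j)" if "i < n" "j < n" for i j
    using that G dim by (simp add: scalar_prod_def lessThan_atLeast0 h_def G_def)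
  moreover have "(\<Sum>k<n. h i k * g k j) = (adj_mat G * G) $$ (i, j)" if "i < n" "j < n" for i j
    using that G dim by (simp add: scalar_prod_def lessThan_atLeast0 h_def G_def)
  ultimately show ?thesis
    unfolding adj(2,3) det by (intro exI[of _ h]) auto
qed

lemma lcomp_inverse:
  assumes gh: "\<forall>i<n. \<forall>j<n. (\<Sum>k<n. g i k * h k j) = (if i = j then 1 else 0)"
    and \<delta>: "\<delta> \<in> lat n"
  shows "lcomp n (lcomp n \<delta> g) h = \<delta>"
proof (rule lat_eqI[OF lcomp_lat \<delta>])
  fix l assume l: "l < n"
  have "lcomp n (lcomp n \<delta> g) h l = (\<Sum>k<n. \<Sum>i<n. \<delta> i * (g i k * h k l))"
    unfolding lcomp_def using l by (auto simp: sum_distrib_right mult.assoc intro!: sum.cong)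
  also have "\<dots> = (\<Sum>i<n. \<delta> i * (\<Sum>k<n. g i k * h k l))"
    unfolding sum_distrib_left by (rule sum.swap)
  also have "\<dots> = (\<Sum>i<n. if i = l then \<delta> l else 0)"
    using l by (intro sum.cong) (auto simp: gh)
  also have "\<dots> = \<delta> l" using l by simp
  finally show "lcomp n (lcomp n \<delta> g) h l = \<delta> l" .
qed

lemma bij_lcomp:
  assumes "g \<in> SL n"
  shows "bij_betw (\<lambda>\<delta>. lcomp n \<delta> g) (lat n) (lat n)"
proof -
  obtain h where h: "\<forall>i<n. \<forall>j<n. (\<Sum>k<n. g i k * h k j) = (if i = j then 1 else 0)"
    "\<forall>i<n. \<forall>j<n. (\<Sum>k<n. h i k * g k j) = (if i = j then 1 else 0)"
    using SL_inverse[OF assms] by blast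
  show ?thesis
    by (rule bij_betw_byWitness[where f' = "\<lambda>\<delta>. lcomp n \<delta> h"]) (auto simp: lcomp_inverse h)
qed

lemma primitive_lcomp:
  assumes "g \<in> SL n" "primitive n \<delta>"
  shows "primitive n (lcomp n \<delta> g)"
proof -
  obtain h where h: "\<forall>i<n. \<forall>j<n. (\<Sum>k<n. g i k * h k j) = (if i = j then 1 else 0)"
    "\<forall>i<n. \<forall>j<n. (\<Sum>k<n. h i k * g k j) = (if i = j then 1 else 0)"
    using SL_inverse[OF assms(1)] by blast
  have "k = 1 \<or> k = - 1" if "lcomp n \<delta> g = (\<lambda>i. k * u i)" for k u
  proof (rule primitiveD[OF assms(2) lcomp_lat[of n u h]])
    show "\<delta> = (\<lambda>i. k * lcomp n u h i)"
      using lcomp_inverse[OF h(1) primitive_lat[OF assms(2)]] unfolding that lcomp_scale by simp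
  qed
  then show ?thesis unfolding primitive_def by auto
qed

lemma lin_indep_gfam:
  assumes g: "g \<in> SL n" and a: "lin_indep n m a"
  shows "lin_indep n m (gfam n g a)"
  unfolding lin_indep_def
proof (intro allI impI)
  fix c :: "nat \<Rightarrow> int" and k
  assume c: "\<forall>i<n. (\<Sum>k<m. c k * gfam n g a k i) = 0" and k: "k < m"
  obtain h where h': "\<forall>i<n. \<forall>j<n. (\<Sum>k<n. g i k * h k j) = (if i = j then 1 else 0)"
    and h: "\<forall>i<n. \<forall>j<n. (\<Sum>k<n. h i k * g k j) = (if i = j then 1 else 0)"
    using SL_inverse[OF g] by blast
  define b where "b l = (\<Sum>k<m. c k * a k l)" for l
  have gb: "(\<Sum>l<n. g i l * b l) = 0" if "i < n" for i
  proof -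
    have "0 = (\<Sum>k<m. \<Sum>l<n. c k * (g i l * a k l))"
      using c that by (simp add: gfam_def gact_def sum_distrib_left)
    also have "\<dots> = (\<Sum>l<n. \<Sum>k<m. c k * (g i l * a k l))" by (rule sum.swap)
    also have "\<dots> = (\<Sum>l<n. g i l * b l)"
      by (intro sum.cong refl) (simp add: b_def sum_distrib_left mult_ac)
    finally show ?thesis by simp
  qed
  have "b j = 0" if j: "j < n" for j
  proof -
    have "b j = (\<Sum>l<n. if j = l then b l else 0)" using j by simp
    also have "\<dots> = (\<Sum>l<n. (\<Sum>i<n. h j i * g i l) * b l)"
      using j by (intro sum.cong refl) (simp add: h)
    also have "\<dots> = (\<Sum>l<n. \<Sum>i<n. h j i * (g i l * b l))"
      by (simp add: sum_distrib_right mult.assoc)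
    also have "\<dots> = (\<Sum>i<n. h j i * (\<Sum>l<n. g i l * b l))"
      unfolding sum_distrib_left by (rule sum.swap)
    also have "\<dots> = 0" using gb by (intro sum.neutral) auto
    finally show ?thesis .
  qed
  then show "c k = 0" using a k unfolding lin_indep_def b_def by blast
qed

lemma detf_gfam:
  assumes "g \<in> SL n"
  shows "detf n (gfam n g a) = detf n a"
proof -
  have "mat n n (\<lambda>(i, j). gfam n g a j i) = mat n n (\<lambda>(i, j). g i j) * mat n n (\<lambda>(i, j). a j i)"
    by (rule eq_matI) (auto simp: gfam_def gact_def scalar_prod_def lessThan_atLeast0)
  then show ?thesis
    using assms unfolding detf_def SL_def by (simp add: det_mult[of _ n])
qed

lemma homLC_dact: "homLC n x \<Longrightarrow> homLC n (dact n g x)"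
proof -
  assume x: "homLC n x"
  have "lcomp n (\<lambda>i. \<delta> i + \<delta>' i) g = (\<lambda>i. lcomp n \<delta> g i + lcomp n \<delta>' g i)" for \<delta> \<delta>'
    by (auto simp: lcomp_def fun_eq_iff distrib_right sum.distrib)
  then show ?thesis
    using hom_add[OF x] by (simp add: homLC_def dact_def)
qed

lemma posdual_gfam: "posdual n m (gfam n g a) \<alpha> \<Longrightarrow> posdual n m a (\<lambda>j. lcomp n (\<alpha> j) g)"
  unfolding posdual_def pair_lcomp gfam_def by simp

lemma Fset_gfam:
  assumes "\<delta> \<in> lat n"
  shows "\<delta> \<in> Fset n m (gfam n g a) \<alpha> \<longleftrightarrow> lcomp n \<delta> g \<in> Fset n m a (\<lambda>j. lcomp n (\<alpha> j) g)"
  using assms by (simp add: Fset_def pair_lcomp gfam_def)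

lemma bij_Fset_gfam:
  assumes "g \<in> SL n"
  shows "bij_betw (\<lambda>\<delta>. lcomp n \<delta> g) (Fset n m (gfam n g a) \<alpha>) (Fset n m a (\<lambda>j. lcomp n (\<alpha> j) g))"
proof (rule bij_betw_imageI)
  have sub: "Fset n m b \<beta> \<subseteq> lat n" for b \<beta> by (auto simp: Fset_def)
  show "inj_on (\<lambda>\<delta>. lcomp n \<delta> g) (Fset n m (gfam n g a) \<alpha>)"
    using bij_lcomp[OF assms] sub by (meson bij_betw_imp_inj_on inj_on_subset)
  show "(\<lambda>\<delta>. lcomp n \<delta> g) ` Fset n m (gfam n g a) \<alpha> = Fset n m a (\<lambda>j. lcomp n (\<alpha> j) g)"
  proof (intro equalityI subsetI)
    fix \<delta> assume "\<delta> \<in> (\<lambda>\<delta>. lcomp n \<delta> g) ` Fset n m (gfam n g a) \<alpha>"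
    then obtain \<delta>' where "\<delta>' \<in> Fset n m (gfam n g a) \<alpha>" "\<delta> = lcomp n \<delta>' g" by blast
    then show "\<delta> \<in> Fset n m a (\<lambda>j. lcomp n (\<alpha> j) g)" using Fset_gfam[of \<delta>'] sub by blast
  next
    fix \<delta> assume \<delta>: "\<delta> \<in> Fset n m a (\<lambda>j. lcomp n (\<alpha> j) g)"
    then have "\<delta> \<in> lat n" using sub by blast
    then obtain \<delta>' where \<delta>': "\<delta>' \<in> lat n" "\<delta> = lcomp n \<delta>' g"
      using bij_betw_imp_surj_on[OF bij_lcomp[OF assms]] by blast
    then show "\<delta> \<in> (\<lambda>\<delta>. lcomp n \<delta> g) ` Fset n m (gfam n g a) \<alpha>"
      using \<delta> Fset_gfam[of \<delta>'] by blast
  qed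
qed

text \<open>g preserves the determinant, so the defining property of \<gamma> is transported by the
  adjunction \<open>pair_lcomp\<close>.\<close>

lemma gamma_of_gfam:
  assumes g: "g \<in> SL (r + 2)" and a: "lin_indep (r + 2) (r + 1) a"
  shows "lcomp (r + 2) (gamma_of r (gfam (r + 2) g a)) g = gamma_of r a"
proof -
  let ?b = "gfam (r + 2) g a"
  note props = gamma_of_props[OF lin_indep_gfam[OF g a]]
  obtain s where s: "s > 0" "cof r ?b = (\<lambda>i. s * gamma_of r ?b i)" using props(2) by blast
  have "cof r a = (\<lambda>i. s * lcomp (r + 2) (gamma_of r ?b) g i)"
  proof (rule pair_ext[of _ "r + 2"])
    fix c
    have "pair (r + 2) (cof r a) c = detf (r + 2) (gfam (r + 2) g (\<lambda>k. if k \<le> r then a k else c))"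
      unfolding detf_gfam[OF g] detf_last ..
    also have "gfam (r + 2) g (\<lambda>k. if k \<le> r then a k else c) = (\<lambda>k. if k \<le> r then ?b k else gact (r + 2) g c)"
      by (auto simp: gfam_def)
    also have "detf (r + 2) \<dots> = s * pair (r + 2) (gamma_of r ?b) (gact (r + 2) g c)"
      unfolding detf_last s(2) pair_scale ..
    finally show "pair (r + 2) (cof r a) c = pair (r + 2) (\<lambda>i. s * lcomp (r + 2) (gamma_of r ?b) g i) c"
      unfolding pair_scale pair_lcomp .
  qed (intro cof_lat lat_scale lcomp_lat)+
  then show ?thesis
    by (rule gamma_of_eqI[OF primitive_lcomp[OF g props(1)] s(1), symmetric])
qed

text \<open>The Hilbert choice \<open>alpha_of\<close> need not commute with g, so the transported
  dual family is in general different from the chosen one for a; the right-hand side is therefore a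
  \<open>Gprod\<close> and not \<open>geomG\<close>.\<close>

lemma geomG_gfam:
  assumes g: "g \<in> SL (r + 2)" and a: "lin_indep (r + 2) (r + 1) a" and x: "homLC (r + 2) x"
    and x\<gamma>: "x (gamma_of r a) \<noteq> 0"
  shows "geomG r (gfam (r + 2) g a) w (dact (r + 2) g x) =
         geom.Gprod r a x (\<lambda>j. lcomp (r + 2) (alpha_of r (gfam (r + 2) g a) j) g) w"
proof -
  let ?b = "gfam (r + 2) g a" and ?y = "dact (r + 2) g x" and ?l = "\<lambda>\<delta>. lcomp (r + 2) \<delta> g"
  define \<alpha> where "\<alpha> = alpha_of r ?b"
  note \<gamma> = gamma_of_gfam[OF g a]
  interpret A: geom r a x by unfold_locales fact+
  interpret B: geom r ?b ?y
    by unfold_locales (use lin_indep_gfam[OF g a] homLC_dact[OF x] x\<gamma> \<gamma> in \<open>auto simp: dact_def\<close>)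
  have idx: "B.idx \<delta> = A.idx (?l \<delta>)" for \<delta>
    unfolding A.idx_def B.idx_def pair_lcomp by (simp add: gfam_def)
  have box: "B.box (\<lambda>j. pair (r + 2) (\<alpha> j) (?b j)) = A.box (\<lambda>j. pair (r + 2) (?l (\<alpha> j)) (a j))"
  proof -
    have "B.idx ` S = A.idx ` (?l ` S)" for S unfolding image_image idx ..
    then show ?thesis
      unfolding A.box_Fset B.box_Fset bij_betw_imp_surj_on[OF bij_Fset_gfam[OF g], symmetric] by blast
  qed
  have "geomG r ?b w ?y = B.Gprod \<alpha> w" unfolding \<alpha>_def by (rule B.geomG_eq_Gprod)
  also have "\<dots> = A.Gprod (\<lambda>j. ?l (\<alpha> j)) w"
    unfolding A.Gprod_def B.Gprod_def box
  proof (rule prod.cong[OF refl])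
    fix v assume v: "v \<in> A.box (\<lambda>j. pair (r + 2) (?l (\<alpha> j)) (a j))"
    then obtain \<delta> where \<delta>: "\<delta> \<in> lat (r + 2)" "v = B.idx \<delta>"
      unfolding box[symmetric] by (auto simp: B.box_def)
    obtain \<delta>' where \<delta>': "\<delta>' \<in> lat (r + 2)" "v = A.idx \<delta>'" using v by (auto simp: A.box_def)
    \<comment> \<open>The two sections are unrelated choices, but they have the same
      \<open>idx\<close> and so give the same factor.\<close>
    have "A.idx (?l (B.sec v)) = v" using B.sec[OF \<delta>(1)] \<delta>(2) idx by simp
    moreover have "A.sec v \<in> lat (r + 2)" "A.idx (A.sec v) = v" using A.sec[OF \<delta>'(1)] \<delta>'(2) by auto
    ultimately show "nishG r (\<lambda>j. ?y (\<alpha> j) / ?y (gamma_of r ?b)) ((w + ?y (B.sec v)) / ?y (gamma_of r ?b)) =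
          nishG r (\<lambda>j. x (?l (\<alpha> j)) / x (gamma_of r a)) ((w + x (A.sec v)) / x (gamma_of r a))"
      unfolding dact_def \<gamma> by (intro A.nishG_idx_cong) auto
  qed
  finally show ?thesis unfolding \<alpha>_def .
qed

lemma geom_domD:
  assumes "lin_indep (r + 2) (r + 1) a" "homLC (r + 2) x" "geom_dom r a x"
  shows "geom r a x" "geom.nonreal r a x (alpha_of r a)"
proof -
  show *: "geom r a x" using assms by unfold_locales (auto simp: geom_dom_def)
  show "geom.nonreal r a x (alpha_of r a)"
    using assms(3) unfolding geom.nonreal_def[OF *] geom_dom_def by (auto simp: complex_is_Real_iff)
qed

text \<open>Independence of the dual family closes the gap left by \<open>geomG_gfam\<close>. It
  holds off a sparse set, which suffices for \<open>remove_sings\<close>.\<close>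

lemma geomG_equivariant:
  assumes g: "g \<in> SL (r + 2)" and a: "lin_indep (r + 2) (r + 1) a" and x: "homLC (r + 2) x"
    and dom: "geom_dom r a x"
  shows "remove_sings (\<lambda>w. geomG r (gfam (r + 2) g a) w (dact (r + 2) g x)) w = remove_sings (\<lambda>w. geomG r a w x) w"
proof (rule remove_sings_cong[OF _ refl])
  interpret geom r a x by (rule geom_domD[OF a x dom])
  define \<beta> where "\<beta> = (\<lambda>j. lcomp (r + 2) (alpha_of r (gfam (r + 2) g a) j) g)"
  have "posdual (r + 2) (r + 1) a \<beta>"
    unfolding \<beta>_def by (intro posdual_gfam alpha_of_posdual lin_indep_gfam g a)
  then have "eventually (\<lambda>w. Gprod (alpha_of r a) w = Gprod \<beta> w) (at w)"
    using Gprod_indep[OF alpha_of_posdual[OF a] geom_domD(2)[OF a x dom]]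
    by (simp add: eventually_cosparse_open_eq)
  then show "eventually (\<lambda>w. geomG r (gfam (r + 2) g a) w (dact (r + 2) g x) = geomG r a w x) (at w)"
    unfolding geomG_gfam[OF g a x x\<gamma>] \<beta>_def[symmetric] geomG_eq_Gprod
    by eventually_elim simp
qed

lemma bstar_cong: "(\<And>j. j < n \<Longrightarrow> \<omega> j = \<omega>' j) \<Longrightarrow> bstar n k z \<omega> = bstar n k z \<omega>'"
  unfolding bstar_def by (intro arg_cong2[of _ _ _ _ "(*)"] arg_cong2[of _ _ _ _ fps_nth] prod.cong refl) auto

text \<open>The primitive dual family is unique on the indices below r + 2, so it is equivariant
  there and literal equality holds.\<close>

lemma bernB_equivariant:
  assumes g: "g \<in> SL (r + 2)" and a: "lin_indep (r + 2) (r + 2) a"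
  shows "bernB r (gfam (r + 2) g a) w (dact (r + 2) g x) = bernB r a w x"
proof -
  let ?b = "gfam (r + 2) g a" and ?l = "\<lambda>\<delta>. lcomp (r + 2) \<delta> g"
  define \<alpha>' where "\<alpha>' = alpha_prim r ?b"
  define \<alpha> where "\<alpha> = alpha_prim r a"
  note props = alpha_prim_props[OF lin_indep_gfam[OF g a]]
  have \<alpha>: "\<alpha> j = ?l (\<alpha>' j)" if "j < r + 2" for j
    unfolding \<alpha>_def \<alpha>'_def
    by (rule alpha_prim_unique[OF a posdual_gfam[OF props(1)] primitive_lcomp[OF g props(2)]]) (use that in auto)
  have F: "Fset (r + 2) (r + 2) a (\<lambda>j. ?l (\<alpha>' j)) = Fset (r + 2) (r + 2) a \<alpha>"
    unfolding Fset_def using \<alpha> by auto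
  have "(\<Sum>\<delta>\<in>Fset (r + 2) (r + 2) ?b \<alpha>'. bstar (r + 2) (r + 2) (w + x (?l \<delta>)) (\<lambda>j. x (?l (\<alpha>' j)))) =
        (\<Sum>\<delta>\<in>Fset (r + 2) (r + 2) a \<alpha>. bstar (r + 2) (r + 2) (w + x \<delta>) (\<lambda>j. x (?l (\<alpha>' j))))"
    using sum.reindex_bij_betw[OF bij_Fset_gfam[OF g, of "r + 2" a \<alpha>'],
        of "\<lambda>\<delta>. bstar (r + 2) (r + 2) (w + x \<delta>) (\<lambda>j. x (?l (\<alpha>' j)))"]
    unfolding F .
  also have "\<dots> = (\<Sum>\<delta>\<in>Fset (r + 2) (r + 2) a \<alpha>. bstar (r + 2) (r + 2) (w + x \<delta>) (\<lambda>j. x (\<alpha> j)))"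
    by (intro sum.cong refl bstar_cong) (simp add: \<alpha>)
  finally have S: "(\<Sum>\<delta>\<in>Fset (r + 2) (r + 2) ?b \<alpha>'. bstar (r + 2) (r + 2) (w + x (?l \<delta>)) (\<lambda>j. x (?l (\<alpha>' j)))) =
      (\<Sum>\<delta>\<in>Fset (r + 2) (r + 2) a \<alpha>. bstar (r + 2) (r + 2) (w + x \<delta>) (\<lambda>j. x (\<alpha> j)))" .
  have Pr: "(\<Prod>j<r+2. x (?l (\<alpha>' j))) = (\<Prod>j<r+2. x (\<alpha> j))"
    by (intro prod.cong refl) (simp add: \<alpha>)
  show ?thesis
    unfolding bernB_def Let_def \<alpha>_def[symmetric] \<alpha>'_def[symmetric] dact_def detf_gfam[OF g] S Pr ..
qed

subsection \<open>The geometric modular property\<close>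

lemma lin_indep_del_fam:
  assumes "lin_indep (r + 2) (r + 2) a" "j \<le> r + 1"
  shows "lin_indep (r + 2) (r + 1) (del_fam j a)"
  unfolding lin_indep_def
proof (intro allI impI)
  fix c :: "nat \<Rightarrow> int" and k
  assume c: "\<forall>i<r+2. (\<Sum>k<r+1. c k * del_fam j a k i) = 0" and k: "k < r + 1"
  define c' where "c' l = (if l = j then 0 else if l < j then c l else c (l - 1))" for l
  have "(\<Sum>l<r+2. c' l * a l i) = 0" if "i < r + 2" for i
  proof -
    have "(\<Sum>l<r+2. c' l * a l i) = c' j * a j i + (\<Sum>l\<in>{..<r+2} - {j}. c' l * a l i)"
      using assms(2) by (intro sum.remove) auto
    also have "\<dots> = (\<Sum>l\<in>{..<r+2} - {j}. c' l * a l i)" by (simp add: c'_def)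
    also have "\<dots> = (\<Sum>k<r+1. c k * del_fam j a k i)"
      by (rule sum.reindex_bij_witness[where j = "\<lambda>l. if l < j then l else l - 1" and i = "\<lambda>l. if l < j then l else Suc l"])
         (use assms(2) in \<open>auto simp: del_fam_def c'_def\<close>)
    finally show ?thesis using c that by simp
  qed
  then have "\<forall>l<r+2. c' l = 0" using assms(1) unfolding lin_indep_def by blast
  then have "c' (if k < j then k else Suc k) = 0" using k by auto
  then show "c k = 0" by (auto simp: c'_def split: if_splits)
qed

lemma del_fam_all: "j \<le> r + 1 \<Longrightarrow> (\<forall>k\<le>r. Q (del_fam j a k)) \<longleftrightarrow> (\<forall>k<r+2. k \<noteq> j \<longrightarrow> Q (a k))"
proof (intro iffI allI impI)
  fix k assume *: "\<forall>k\<le>r. Q (del_fam j a k)" "k < r + 2" "k \<noteq> j" "j \<le> r + 1"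
  show "Q (a k)"
  proof (cases "k < j")
    case True
    then show ?thesis using spec[OF *(1), of k] *(4) by (simp add: del_fam_def)
  next
    case False
    then have "\<not> k - 1 < j" "Suc (k - 1) = k" "k - 1 \<le> r" using *(2,3) by auto
    then show ?thesis using spec[OF *(1), of "k - 1"] by (simp add: del_fam_def)
  qed
next
  fix k assume "\<forall>k<r+2. k \<noteq> j \<longrightarrow> Q (a k)" "k \<le> r" "j \<le> r + 1"
  then show "Q (del_fam j a k)" by (auto simp: del_fam_def)
qed

lemma posdual_del_fam:
  assumes "posdual (r + 2) (r + 2) a \<alpha>" "j \<le> r + 1"
  shows "posdual (r + 2) (r + 1) (del_fam j a) (del_fam j \<alpha>)"
  using assms unfolding posdual_def del_fam_def by auto

lemma Fset_del_fam:
  assumes "j \<le> r + 1"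
  shows "\<delta> \<in> Fset (r + 2) (r + 1) (del_fam j a) (del_fam j \<alpha>) \<longleftrightarrow>
     \<delta> \<in> lat (r + 2) \<and> (\<forall>k<r+2. k \<noteq> j \<longrightarrow> 0 \<le> pair (r + 2) \<delta> (a k) \<and> pair (r + 2) \<delta> (a k) < pair (r + 2) (\<alpha> k) (a k))"
proof -
  have "(\<forall>k\<le>r. 0 \<le> pair (r + 2) \<delta> (del_fam j a k) \<and> pair (r + 2) \<delta> (del_fam j a k) < pair (r + 2) (del_fam j \<alpha> k) (del_fam j a k)) \<longleftrightarrow>
        (\<forall>k\<le>r. (\<lambda>(\<beta>, b). 0 \<le> pair (r + 2) \<delta> b \<and> pair (r + 2) \<delta> b < pair (r + 2) \<beta> b) (del_fam j (\<lambda>k. (\<alpha> k, a k)) k))"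
    by (auto simp: del_fam_def)
  also have "\<dots> \<longleftrightarrow> (\<forall>k<r+2. k \<noteq> j \<longrightarrow> 0 \<le> pair (r + 2) \<delta> (a k) \<and> pair (r + 2) \<delta> (a k) < pair (r + 2) (\<alpha> k) (a k))"
    unfolding del_fam_all[OF assms] by simp
  finally show ?thesis unfolding Fset_def by (simp add: less_Suc_eq_le)
qed

lemma powi_sign_mult:
  fixes y :: complex
  assumes "s = 1 \<or> s = - 1" "t = 1 \<or> t = - 1"
  shows "(y powi s) powi t = y powi (s * t)"
  using assms by auto

lemma prod_powi_sign:
  fixes f :: "'a \<Rightarrow> complex"
  assumes "s = 1 \<or> s = - 1"
  shows "(\<Prod>i\<in>A. f i powi s) = (\<Prod>i\<in>A. f i) powi s"
  using assms by (auto simp: prod_inversef[symmetric])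

locale modular =
  fixes r :: nat and a :: "nat \<Rightarrow> nat \<Rightarrow> int" and x :: "(nat \<Rightarrow> int) \<Rightarrow> complex"
  assumes indep: "lin_indep (r + 2) (r + 2) a" and hom: "homLC (r + 2) x"
    and dom: "\<And>j. j \<le> r + 1 \<Longrightarrow> geom_dom r (del_fam j a) x"
begin

abbreviation \<alpha> where "\<alpha> \<equiv> alpha_prim r a"

definition \<omega> where "\<omega> j = x (\<alpha> j)"

definition \<epsilon> where "\<epsilon> = sgn ((-1) ^ (r + 1) * detf (r + 2) a)"

abbreviation P where "P \<equiv> pair (r + 2)"

abbreviation F where "F \<equiv> Fset (r + 2) (r + 2) a \<alpha>"

lemmas \<alpha>_posdual = alpha_prim_props(1)[OF indep]
lemmas \<alpha>_prim = alpha_prim_props(2)[OF indep]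

lemma \<alpha>D:
  assumes "j < r + 2"
  shows "\<alpha> j \<in> lat (r + 2)" "P (\<alpha> j) (a j) > 0" "k < r + 2 \<Longrightarrow> k \<noteq> j \<Longrightarrow> P (\<alpha> j) (a k) = 0"
  using \<alpha>_posdual assms unfolding posdual_def by auto

lemma \<epsilon>_cases: "\<epsilon> = 1 \<or> \<epsilon> = - 1"
  using detf_nonzero[OF indep] unfolding \<epsilon>_def by (auto simp: sgn_if)

text \<open>The cofactor vector of the deleted family vanishes on every \<open>a k\<close> with k
  different from j, hence is a multiple of \<open>\<alpha> j\<close>. Its value on
  \<open>a j\<close> is the determinant up to (-1)^(r+1+j), and this gives the sign.\<close>

lemma gamma_del_fam:
  assumes j: "j \<le> r + 1"
  shows "gamma_of r (del_fam j a) = (\<lambda>i. (-1) ^ j * \<epsilon> * \<alpha> j i)"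
proof -
  define \<kappa> where "\<kappa> = cof r (del_fam j a)"
  define c where "c = P (\<alpha> j) (a j)"
  have j': "j < r + 2" using j by simp
  have c: "c > 0" unfolding c_def by (rule \<alpha>D(2)[OF j'])
  have \<kappa>0: "P \<kappa> (a k) = 0" if "k < r + 2" "k \<noteq> j" for k
  proof -
    have "\<forall>k\<le>r. P \<kappa> (del_fam j a k) = 0" unfolding \<kappa>_def by (simp add: pair_cof_eq_0)
    then show ?thesis using del_fam_all[OF j, of "\<lambda>b. P \<kappa> b = 0"] that by blast
  qed
  have \<kappa>j: "P \<kappa> (a j) = (-1) ^ (r + 1 + j) * detf (r + 2) a"
    unfolding detf_del_fam[OF j] \<kappa>_def mult.assoc[symmetric] power_add[symmetric] by simp
  have "(\<lambda>i. c * \<kappa> i - P \<kappa> (a j) * \<alpha> j i) = (\<lambda>i. 0)"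
  proof (rule pair_nondegenerate[OF detf_nonzero[OF indep]])
    show "(\<lambda>i. c * \<kappa> i - P \<kappa> (a j) * \<alpha> j i) \<in> lat (r + 2)"
      unfolding \<kappa>_def by (intro lat_diff lat_scale cof_lat \<alpha>D(1) j')
    fix k assume k: "k < r + 2"
    show "P (\<lambda>i. c * \<kappa> i - P \<kappa> (a j) * \<alpha> j i) (a k) = 0"
      unfolding pair_linear using \<kappa>0[OF k] \<alpha>D(3)[OF j' k] by (cases "k = j") (auto simp: c_def)
  qed
  then have eq: "c * \<kappa> i = P \<kappa> (a j) * \<alpha> j i" for i by (simp add: fun_eq_iff)
  obtain k where k: "\<kappa> = (\<lambda>i. k * \<alpha> j i)"
    using primitive_multiple[OF \<alpha>_prim[OF j'] _ eq] c by auto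
  have kc: "k * c = (-1) ^ (r + 1 + j) * detf (r + 2) a"
    unfolding \<kappa>j[symmetric] c_def unfolding k pair_scale ..
  have k0: "k \<noteq> 0" using kc detf_nonzero[OF indep] by auto
  have "sgn k = sgn (k * c)" using c by (simp add: sgn_mult)
  also have "\<dots> = (-1) ^ j * \<epsilon>"
  proof -
    have sgn_pm: "sgn ((-1) ^ m * d) = (-1) ^ m * sgn d" for m and d :: int
      by (cases "even m") (auto simp: sgn_mult)
    show ?thesis unfolding kc \<epsilon>_def sgn_pm by (simp add: power_add mult_ac)
  qed
  finally have sgnk: "sgn k = (-1) ^ j * \<epsilon>" .
  show ?thesis
  proof (rule gamma_of_eqI)
    have "sgn k = 1 \<or> sgn k = - 1" using k0 by (auto simp: sgn_if)
    then show "primitive (r + 2) (\<lambda>i. (-1) ^ j * \<epsilon> * \<alpha> j i)"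
      unfolding sgnk[symmetric] using \<alpha>_prim[OF j'] primitive_uminus[OF \<alpha>_prim[OF j']] by auto
    show "\<bar>k\<bar> > 0" using k0 by simp
    show "cof r (del_fam j a) = (\<lambda>i. \<bar>k\<bar> * ((-1) ^ j * \<epsilon> * \<alpha> j i))"
      unfolding \<kappa>_def[symmetric] k sgnk[symmetric] mult.assoc[symmetric] abs_mult_sgn ..
  qed
qed

lemma geom_del_fam: "j \<le> r + 1 \<Longrightarrow> geom r (del_fam j a) x"
  by (rule geom_domD(1)[OF lin_indep_del_fam[OF indep] hom dom])

lemma nonreal_del_fam:
  assumes "j \<le> r + 1"
  shows "geom.nonreal r (del_fam j a) x (del_fam j \<alpha>)"
proof -
  interpret G: geom r "del_fam j a" x by (rule geom_del_fam[OF assms])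
  show ?thesis
    by (rule G.nonreal_posdual[OF alpha_of_posdual[OF lin_indep_del_fam[OF indep assms]]
          posdual_del_fam[OF \<alpha>_posdual assms] geom_domD(2)[OF lin_indep_del_fam[OF indep assms] hom dom[OF assms]]])
qed

lemma x_gamma_del_fam:
  assumes "j \<le> r + 1"
  shows "x (gamma_of r (del_fam j a)) = of_int ((-1) ^ j * \<epsilon>) * \<omega> j"
  unfolding gamma_del_fam[OF assms] \<omega>_def using assms by (intro hom_scale[OF hom \<alpha>D(1)]) simp

lemma sign_cases: "(-1) ^ j * \<epsilon> = 1 \<or> (-1) ^ j * \<epsilon> = - 1"
  using \<epsilon>_cases by (cases "even j") auto

lemma \<omega>_nonzero: "j \<le> r + 1 \<Longrightarrow> \<omega> j \<noteq> 0"
  using geom.x\<gamma>[OF geom_del_fam] x_gamma_del_fam by fastforce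

lemma \<omega>_ratio:
  assumes "j \<le> r + 1" "k \<le> r"
  shows "Im (del_fam j \<omega> k / \<omega> j) \<noteq> 0"
proof -
  have "Im (x (del_fam j \<alpha> k) / (of_int ((-1) ^ j * \<epsilon>) * \<omega> j)) \<noteq> 0"
    using nonreal_del_fam[OF assms(1)] assms(2)
    unfolding geom.nonreal_def[OF geom_del_fam[OF assms(1)]] x_gamma_del_fam[OF assms(1)] by blast
  moreover have "x (del_fam j \<alpha> k) = del_fam j \<omega> k" by (simp add: del_fam_def \<omega>_def)
  ultimately have *: "Im (del_fam j \<omega> k / (of_int s * \<omega> j)) \<noteq> 0" if "s = (-1) ^ j * \<epsilon>" for s
    using that by simp
  show ?thesis using *[of 1] *[of "-1"] sign_cases[of j] by auto
qed

sublocale narukawa r \<omega>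
proof
  show "\<omega> j \<noteq> 0" if "j < r + 2" for j using \<omega>_nonzero[of j] that by simp
  show "\<omega> k / \<omega> j \<notin> \<real>" if "k < r + 2" "j < r + 2" "k \<noteq> j" for j k
  proof -
    have "\<forall>k\<le>r. Im (del_fam j \<omega> k / \<omega> j) \<noteq> 0" using \<omega>_ratio that by simp
    then have "\<forall>k<r+2. k \<noteq> j \<longrightarrow> Im (\<omega> k / \<omega> j) \<noteq> 0"
      using del_fam_all[of j r "\<lambda>v. Im (v / \<omega> j) \<noteq> 0" \<omega>] that by simp
    with that show ?thesis by (auto simp: complex_is_Real_iff)
  qed
qed

text \<open>Adding \<gamma> leaves the values on the other \<open>a k\<close> unchanged and moves
  the value on \<open>a j\<close> by plus or minus \<open>P (\<alpha> j) (a j)\<close>. Each class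
  therefore has exactly one element satisfying the additional inequality that defines F.\<close>

lemma transversal:
  assumes j: "j \<le> r + 1"
  shows "F \<subseteq> Fset (r + 2) (r + 1) (del_fam j a) (del_fam j \<alpha>)"
    and "inj_on (geom.idx r (del_fam j a)) F"
    and "geom.idx r (del_fam j a) ` F = geom.idx r (del_fam j a) ` Fset (r + 2) (r + 1) (del_fam j a) (del_fam j \<alpha>)"
proof -
  interpret G: geom r "del_fam j a" x by (rule geom_del_fam[OF j])
  have j': "j < r + 2" using j by simp
  define c where "c = P (\<alpha> j) (a j)"
  have c: "c > 0" unfolding c_def by (rule \<alpha>D(2)[OF j'])
  have idx_iff: "G.idx \<delta> = G.idx \<delta>' \<longleftrightarrow> (\<forall>k<r+2. k \<noteq> j \<longrightarrow> P \<delta> (a k) = P \<delta>' (a k))" for \<delta> \<delta>'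
    unfolding G.idx_eq_iff by (rule del_fam_all[OF j, of "\<lambda>b. P \<delta> b = P \<delta>' b"])
  show sub: "F \<subseteq> Fset (r + 2) (r + 1) (del_fam j a) (del_fam j \<alpha>)"
    using Fset_del_fam[OF j] by (auto simp: Fset_def[of _ "r + 2"])
  show "inj_on G.idx F"
  proof (rule inj_onI)
    fix \<delta> \<delta>' assume F: "\<delta> \<in> F" "\<delta>' \<in> F" and eq: "G.idx \<delta> = G.idx \<delta>'"
    have L: "\<delta> \<in> lat (r + 2)" "\<delta>' \<in> lat (r + 2)" using F by (auto simp: Fset_def)
    obtain k where k: "\<delta>' = (\<lambda>i. \<delta> i + k * gamma_of r (del_fam j a) i)"
      using G.idx_eq_imp(1)[OF L eq] by blast
    define s where "s = (-1) ^ j * \<epsilon>"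
    have "P \<delta>' (a j) = P \<delta> (a j) + k * (s * c)"
      unfolding k pair_linear gamma_del_fam[OF j] c_def s_def ..
    moreover have "0 \<le> P \<delta> (a j)" "P \<delta> (a j) < c" "0 \<le> P \<delta>' (a j)" "P \<delta>' (a j) < c"
      using F j' by (auto simp: Fset_def c_def)
    ultimately have "\<bar>k * (s * c)\<bar> < c" by linarith
    moreover have "\<bar>s\<bar> = 1" using sign_cases[of j] by (auto simp: s_def)
    ultimately have "\<bar>k\<bar> * c < 1 * c" using c by (simp add: abs_mult)
    then have "k = 0" using c by (simp only: mult_less_cancel_right_pos)
    then show "\<delta> = \<delta>'" using k by simp
  qed
  show "G.idx ` F = G.idx ` Fset (r + 2) (r + 1) (del_fam j a) (del_fam j \<alpha>)"
  proof (rule equalityI[OF image_mono[OF sub] subsetI])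
    fix v assume "v \<in> G.idx ` Fset (r + 2) (r + 1) (del_fam j a) (del_fam j \<alpha>)"
    then obtain \<delta> where v: "v = G.idx \<delta>" and \<delta>: "\<delta> \<in> lat (r + 2)"
        "\<And>k. k < r + 2 \<Longrightarrow> k \<noteq> j \<Longrightarrow> 0 \<le> P \<delta> (a k) \<and> P \<delta> (a k) < P (\<alpha> k) (a k)"
      using Fset_del_fam[OF j] by blast
    define \<delta>' where "\<delta>' = (\<lambda>i. \<delta> i - (P \<delta> (a j) div c) * \<alpha> j i)"
    have \<delta>'k: "P \<delta>' (a k) = P \<delta> (a k)" if "k < r + 2" "k \<noteq> j" for k
      unfolding \<delta>'_def pair_linear using \<alpha>D(3)[OF j' that] by simp
    have \<delta>'j: "P \<delta>' (a j) = P \<delta> (a j) mod c"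
      unfolding \<delta>'_def pair_linear c_def by (simp add: minus_div_mult_eq_mod)
    have "\<delta>' \<in> F"
      unfolding Fset_def
    proof (intro CollectI conjI allI impI)
      show "\<delta>' \<in> lat (r + 2)" unfolding \<delta>'_def by (intro lat_diff lat_scale \<delta>(1) \<alpha>D(1) j')
      fix k assume k: "k < r + 2"
      show "0 \<le> P \<delta>' (a k)" "P \<delta>' (a k) < P (\<alpha> k) (a k)"
        using \<delta>'k[OF k] \<delta>'j \<delta>(2)[OF k] c by (cases "k = j"; simp add: c_def)+
    qed
    moreover have "G.idx \<delta>' = v" unfolding v idx_iff using \<delta>'k by simp
    ultimately show "v \<in> G.idx ` F" by blast
  qed
qed

lemma finite_F: "finite F"
proof -
  interpret G: geom r "del_fam 0 a" x by (rule geom_del_fam) simp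
  have "finite (G.idx ` F)"
    unfolding transversal(3)[OF le0] G.box_Fset[symmetric] by simp
  then show ?thesis using transversal(2)[OF le0] by (rule finite_imageD)
qed

text \<open>Replacing \<gamma> by \<open>\<alpha> j\<close> changes it by the sign s = (-1)^j
  \<epsilon>, which by the reflection formula becomes an exponent s. Together with the exponent
  (-1)^j this leaves \<epsilon>, independent of j.\<close>

lemma geomG_del_fam:
  assumes j: "j \<le> r + 1"
  shows "eventually (\<lambda>w. geomG r (del_fam j a) w x powi ((-1) ^ j) =
     (\<Prod>\<delta>\<in>F. nishG r (\<lambda>k. del_fam j \<omega> k / \<omega> j) ((w + x \<delta>) / \<omega> j)) powi \<epsilon>) (cosparse UNIV)"
proof -
  interpret G: geom r "del_fam j a" x by (rule geom_del_fam[OF j])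
  define s where "s = (-1) ^ j * \<epsilon>"
  have s: "s = 1 \<or> s = - 1" unfolding s_def by (rule sign_cases)
  have x\<alpha>: "x (del_fam j \<alpha> k) = del_fam j \<omega> k" for k by (simp add: del_fam_def \<omega>_def)
  have nish: "nishG r (\<lambda>k. x (del_fam j \<alpha> k) / x (gamma_of r (del_fam j a))) (z / x (gamma_of r (del_fam j a))) = nishG r (\<lambda>k. del_fam j \<omega> k / \<omega> j) (z / \<omega> j) powi s" for z
  proof (cases "s = 1")
    case True
    then show ?thesis unfolding x_gamma_del_fam[OF j] s_def[symmetric] x\<alpha> by simp
  next
    case False
    then have "s = - 1" using s by simp
    then show ?thesis
      unfolding x_gamma_del_fam[OF j] s_def[symmetric] x\<alpha>
      using nishG_uminus[of r "\<lambda>k. del_fam j \<omega> k / \<omega> j" "z / \<omega> j"] \<omega>_ratio[OF j] by simp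
  qed
  have "s * (-1) ^ j = \<epsilon>" by (simp add: s_def mult_ac flip: power_mult_distrib)
  moreover have "(-1) ^ j = (1::int) \<or> (-1) ^ j = (- 1::int)" by (cases "even j") auto
  ultimately have eq: "G.Gprod (del_fam j \<alpha>) w powi ((-1) ^ j) =
      (\<Prod>\<delta>\<in>F. nishG r (\<lambda>k. del_fam j \<omega> k / \<omega> j) ((w + x \<delta>) / \<omega> j)) powi \<epsilon>" for w
    unfolding G.Gprod_transversal[OF transversal[OF j]] nish prod_powi_sign[OF s]
    using powi_sign_mult[OF s] by simp
  have "eventually (\<lambda>w. G.Gprod (del_fam j \<alpha>) w = G.Gprod (alpha_of r (del_fam j a)) w) (cosparse UNIV)"
    by (rule G.Gprod_indep[OF posdual_del_fam[OF \<alpha>_posdual j] nonreal_del_fam[OF j] alpha_of_posdual[OF lin_indep_del_fam[OF indep j]]])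
  then show ?thesis
    unfolding G.geomG_eq_Gprod by eventually_elim (simp only: eq[symmetric])
qed

lemma product_formula:
  "eventually (\<lambda>w. (\<Prod>j\<le>r+1. geomG r (del_fam j a) w x powi ((-1) ^ j)) = exp (\<i> * pi * bernB r a w x)) (cosparse UNIV)"
proof -
  define N where "N j z = nishG r (\<lambda>k. del_fam j \<omega> k / \<omega> j) (z / \<omega> j)" for j z
  define E where "E z = - 2 * pi * \<i> * bstar (r + 2) (r + 2) z \<omega> / (fact (r + 2) * (\<Prod>j<r+2. \<omega> j))" for z
  \<comment> \<open>The modular property is needed at \<open>w + x \<delta>\<close> for each
    \<delta> in F; translations preserve the filter, and F is finite.\<close>
  have shift: "eventually (\<lambda>w. Q (w + c)) (cosparse UNIV)" if "eventually Q (cosparse UNIV)" for Q and c :: complex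
    unfolding eventually_cosparse_open_eq[OF open_UNIV]
  proof
    fix u :: complex
    have "eventually Q (at (u + c))" using that by (simp add: eventually_cosparse_open_eq)
    then show "eventually (\<lambda>w. Q (w + c)) (at u)"
      unfolding at_to_0[of "u + c"] at_to_0[of u] eventually_filtermap by (simp add: add_ac)
  qed
  have "eventually (\<lambda>w. \<forall>\<delta>\<in>F. (\<Prod>j<r+2. N j (w + x \<delta>)) = exp (E (w + x \<delta>))) (cosparse UNIV)"
    using shift[OF narukawa_modular] finite_F
    unfolding N_def[symmetric] E_def[symmetric] by (intro eventually_ball_finite ballI)
  moreover have "eventually (\<lambda>w. \<forall>j\<in>{..r+1}. geomG r (del_fam j a) w x powi ((-1) ^ j) = (\<Prod>\<delta>\<in>F. N j (w + x \<delta>)) powi \<epsilon>) (cosparse UNIV)"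
    using geomG_del_fam unfolding N_def[symmetric] by (intro eventually_ball_finite ballI) auto
  ultimately show ?thesis
  proof eventually_elim
    case (elim w)
    have "(\<Prod>j\<le>r+1. geomG r (del_fam j a) w x powi ((-1) ^ j)) = (\<Prod>j\<le>r+1. (\<Prod>\<delta>\<in>F. N j (w + x \<delta>)) powi \<epsilon>)"
      using elim(2) by (intro prod.cong) auto
    also have "\<dots> = (\<Prod>j\<le>r+1. \<Prod>\<delta>\<in>F. N j (w + x \<delta>)) powi \<epsilon>" by (rule prod_powi_sign[OF \<epsilon>_cases])
    also have "(\<Prod>j\<le>r+1. \<Prod>\<delta>\<in>F. N j (w + x \<delta>)) = (\<Prod>\<delta>\<in>F. \<Prod>j\<le>r+1. N j (w + x \<delta>))" by (rule prod.swap)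
    also have "(\<Prod>\<delta>\<in>F. \<Prod>j\<le>r+1. N j (w + x \<delta>)) = (\<Prod>\<delta>\<in>F. exp (E (w + x \<delta>)))"
    proof (rule prod.cong[OF refl])
      fix \<delta> assume "\<delta> \<in> F"
      have "{..r+1} = {..<r+2}" by auto
      with elim(1) \<open>\<delta> \<in> F\<close> show "(\<Prod>j\<le>r+1. N j (w + x \<delta>)) = exp (E (w + x \<delta>))" by simp
    qed
    also have "\<dots> = exp (\<Sum>\<delta>\<in>F. E (w + x \<delta>))" by (simp only: exp_sum finite_F)
    also have "exp (\<Sum>\<delta>\<in>F. E (w + x \<delta>)) powi \<epsilon> = exp (of_int \<epsilon> * (\<Sum>\<delta>\<in>F. E (w + x \<delta>)))"
      using \<epsilon>_cases by (auto simp: exp_minus)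
    also have "of_int \<epsilon> * (\<Sum>\<delta>\<in>F. E (w + x \<delta>)) = \<i> * pi * bernB r a w x"
    proof -
      define S where "S = (\<Sum>\<delta>\<in>F. bstar (r + 2) (r + 2) (w + x \<delta>) \<omega>)"
      have "(\<Sum>\<delta>\<in>F. E (w + x \<delta>)) = - 2 * pi * \<i> * S / (fact (r + 2) * (\<Prod>j<r+2. \<omega> j))"
        unfolding E_def S_def sum_distrib_left sum_divide_distrib ..
      moreover have "bernB r a w x = inverse (\<Prod>j<r+2. \<omega> j) * (- 2 * of_int \<epsilon> / fact (r + 2)) * S"
        unfolding bernB_def Let_def S_def \<epsilon>_def \<omega>_def[abs_def] by simp
      ultimately show ?thesis by (simp add: field_simps del: fact_Suc)
    qed
    finally show ?case .
  qed
qed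

text \<open>A meromorphic function without a pole at w has a limit there, which is the value of
  \<open>remove_sings\<close>. The limit of the product is then found from the identity valid near
  w. The exponent stands inside \<open>is_pole\<close>, so for odd j poles of the inverse are
  excluded.\<close>

lemma modular_property:
  assumes poles: "\<And>j. j \<le> r + 1 \<Longrightarrow> \<not> is_pole (\<lambda>w. geomG r (del_fam j a) w x powi ((-1) ^ j)) w"
  shows "(\<Prod>j\<le>r+1. remove_sings (\<lambda>w. geomG r (del_fam j a) w x powi ((-1) ^ j)) w) = exp (\<i> * pi * bernB r a w x)"
proof -
  define f where "f j w = geomG r (del_fam j a) w x powi ((-1) ^ j)" for j w
  have lim: "(f j \<longlongrightarrow> remove_sings (f j) w) (at w)" if j: "j \<le> r + 1" for j
  proof -
    interpret G: geom r "del_fam j a" x by (rule geom_del_fam[OF j])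
    have "f j meromorphic_on UNIV"
      unfolding f_def[abs_def] G.geomG_eq_Gprod
      by (intro meromorphic_on_powi G.meromorphic_Gprod geom_domD(2)[OF lin_indep_del_fam[OF indep j] hom dom[OF j]])
    then have "f j meromorphic_on {w}" by (rule meromorphic_on_subset) simp
    then have "not_essential (f j) w" by (simp add: meromorphic_at_iff)
    moreover have "\<not> is_pole (f j) w" using poles[OF j] unfolding f_def[abs_def] .
    ultimately obtain c where "(f j \<longlongrightarrow> c) (at w)" unfolding not_essential_def by blast
    then show ?thesis using remove_sings_eqI by metis
  qed
  have "((\<lambda>w. \<Prod>j\<le>r+1. f j w) \<longlongrightarrow> (\<Prod>j\<le>r+1. remove_sings (f j) w)) (at w)"
    by (intro tendsto_prod lim) simp
  moreover have "eventually (\<lambda>w. (\<Prod>j\<le>r+1. f j w) = exp (\<i> * pi * bernB r a w x)) (at w)"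
    using product_formula unfolding f_def by (simp add: eventually_cosparse_open_eq)
  ultimately have "((\<lambda>w. exp (\<i> * pi * bernB r a w x)) \<longlongrightarrow> (\<Prod>j\<le>r+1. remove_sings (f j) w)) (at w)"
    by (rule Lim_transform_eventually)
  moreover have "((\<lambda>w. exp (\<i> * pi * bernB r a w x)) \<longlongrightarrow> exp (\<i> * pi * bernB r a w x)) (at w)"
  proof -
    have "(\<lambda>w. bstar (r + 2) (r + 2) (w + c) \<omega>') holomorphic_on UNIV" for c \<omega>'
      using holomorphic_on_compose_gen[OF _ holomorphic_bstar[of "r + 2" "r + 2" \<omega>' UNIV], of "\<lambda>w. w + c" UNIV]
      by (simp add: o_def holomorphic_intros)
    then have "(\<lambda>w. exp (\<i> * pi * bernB r a w x)) holomorphic_on UNIV"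
      unfolding bernB_def Let_def by (intro holomorphic_intros)
    then have "isCont (\<lambda>w. exp (\<i> * pi * bernB r a w x)) w"
      using holomorphic_on_imp_continuous_on continuous_on_eq_continuous_at open_UNIV by blast
    then show ?thesis by (simp add: isCont_def)
  qed
  ultimately have "(\<Prod>j\<le>r+1. remove_sings (f j) w) = exp (\<i> * pi * bernB r a w x)"
    using tendsto_unique trivial_limit_at by blast
  then show ?thesis unfolding f_def[abs_def] .
qed

end

theorem theorem6:
  fixes r :: nat
  shows
   "(\<forall>a w x. fam_ok (r+2) (r+2) a \<and> homLC (r+2) x \<and>
        (\<forall>j\<le>r+1. geom_dom r (del_fam j a) x \<and>
           \<not> is_pole (\<lambda>w. geomG r (del_fam j a) w x powi ((-1::int) ^ j)) w) \<longrightarrow>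
        (\<Prod>j\<le>r+1. remove_sings (\<lambda>w. geomG r (del_fam j a) w x powi ((-1::int) ^ j)) w)
          = exp (\<i> * pi * bernB r a w x))
    \<and> (\<forall>a w x g. fam_ok (r+2) (r+1) a \<and> homLC (r+2) x \<and> g \<in> SL (r+2) \<and>
        geom_dom r a x \<and> \<not> is_pole (\<lambda>w. geomG r a w x) w \<longrightarrow>
        remove_sings (\<lambda>w. geomG r (gfam (r+2) g a) w (dact (r+2) g x)) w
          = remove_sings (\<lambda>w. geomG r a w x) w)
    \<and> (\<forall>a w x g. fam_ok (r+2) (r+2) a \<and> homLC (r+2) x \<and> g \<in> SL (r+2) \<longrightarrow>
        bernB r (gfam (r+2) g a) w (dact (r+2) g x) = bernB r a w x)"
proof (intro conjI allI impI)
  fix a w x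
  assume *: "fam_ok (r+2) (r+2) a \<and> homLC (r+2) x \<and>
        (\<forall>j\<le>r+1. geom_dom r (del_fam j a) x \<and>
           \<not> is_pole (\<lambda>w. geomG r (del_fam j a) w x powi ((-1::int) ^ j)) w)"
  interpret modular r a x
    by unfold_locales (use * in \<open>auto simp: fam_ok_def\<close>)
  show "(\<Prod>j\<le>r+1. remove_sings (\<lambda>w. geomG r (del_fam j a) w x powi ((-1::int) ^ j)) w)
          = exp (\<i> * pi * bernB r a w x)"
    by (rule modular_property) (use * in blast)
next
  fix a w x g
  assume "fam_ok (r+2) (r+1) a \<and> homLC (r+2) x \<and> g \<in> SL (r+2) \<and>
        geom_dom r a x \<and> \<not> is_pole (\<lambda>w. geomG r a w x) w"
  then show "remove_sings (\<lambda>w. geomG r (gfam (r+2) g a) w (dact (r+2) g x)) w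
          = remove_sings (\<lambda>w. geomG r a w x) w"
    by (intro geomG_equivariant) (auto simp: fam_ok_def)
next
  fix a w x g
  assume "fam_ok (r+2) (r+2) a \<and> homLC (r+2) x \<and> g \<in> SL (r+2)"
  then show "bernB r (gfam (r+2) g a) w (dact (r+2) g x) = bernB r a w x"
    by (intro bernB_equivariant) (auto simp: fam_ok_def)
qed

end
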